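(* Let $0<\theta\le1$, $C_{\mathrm{mark}}\ge1$, $\lambda_{\mathrm{sym}},\lambda_{\mathrm{alg}}>0$, and $u_0^{0,0}\in\mathcal{X}_0$. With $q_\theta:=[1-(1-q_{\mathrm{red}}^2)\theta]^{1/2}$, suppose that $$0<\frac{q_{\mathrm{sym}}^\star+\frac{2\,q_{\mathrm{alg}}}{1-q_{\mathrm{alg}}}\,\lambda_{\mathrm{alg}}}{1-\frac{2\,q_{\mathrm{alg}}}{1-q_{\mathrm{alg}}}\,\lambda_{\mathrm{alg}}}=:q_{\mathrm{sym}}<1\quad\text{and}\quad\lambda_{\mathrm{alg}}\lambda_{\mathrm{sym}}<\frac{(1-q_{\mathrm{alg}})(1-q_{\mathrm{sym}}^\star)(1-q_\theta)}{8\,q_{\mathrm{alg}}\,C_{\mathrm{stab}}}.$$ Consider the adaptive finite element algorithm with nested contractive solvers (described in the context) for the second-order linear elliptic boundary value problem (described in the context), run with these parameters, and define the quasi-error $$\mathrm{H}_\ell^{k,j}:=|||u_\ell^\star-u_\ell^{k,j}|||+|||u_\ell^{k,\star}-u_\ell^{k,j}|||+\eta_\ell(u_\ell^{k,j})\quad\text{for }(\ell,k,j)\in\mathcal{Q}.$$ Then there exist constants $0<q_{\mathrm{lin}}<1$ and $C_{\mathrm{lin}}>0$ such that $$\mathrm{H}_\ell^{k,j}\le C_{\mathrm{lin}}\,q_{\mathrm{lin}}^{|\ell,k,j|-|\ell',k',j'|}\,\mathrm{H}_{\ell'}^{k',j'}\quad\text{for all }(\ell',k',j'),(\ell,k,j)\in\mathcal{Q}\text{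 with }|\ell',k',j'|\le|\ell,k,j|.$$
   Context: **Model problem.** $\Omega\subset\mathbb{R}^d$, $d\ge1$, is a bounded polyhedral Lipschitz domain. Consider $-\operatorname{div}(\boldsymbol{A}\nabla u^\star)+\boldsymbol{b}\cdot\nabla u^\star+cu^\star=f-\operatorname{div}\boldsymbol{f}$ in $\Omega$, $u^\star=0$ on $\partial\Omega$, where $\boldsymbol{A},\boldsymbol{b},c\in L^\infty(\Omega)$, $f,\boldsymbol{f}\in L^2(\Omega)$, and for a.e. $x$: $\boldsymbol{A}(x)\in\mathbb{R}^{d\times d}$ is symmetric positive definite, $\boldsymbol{b}(x),\boldsymbol{f}(x)\in\mathbb{R}^d$, $c(x),f(x)\in\mathbb{R}$. Set $a(u,v):=\langle\boldsymbol{A}\nabla u,\nabla v\rangle_{L^2(\Omega)}$ and $b(u,v):=a(u,v)+\langle\boldsymbol{b}\cdot\nabla u+cu,v\rangle_{L^2(\Omega)}$; both are assumed continuous and elliptic on $H^1_0(\Omega)$. The energy norm is $|||u|||:=a(u,u)^{1/2}$. Let $0<\alpha\le L$ be such that $\alpha|||v|||^2\le b(v,v)$ and $|b(v,w)|\le L\,|||v|||\,|||w|||$ for all $v,w\in H^1_0(\Omega)$. With $F(v):=\langle f,v\rangle_{L^2(\Omega)}+\langle\boldsymbol{f},\nabla v\rangle_{L^2(\Omega)}$, $u^\star\in H^1_0(\Omega)$ is the unique solution of $b(u^\star,v)=F(v)$ for all $v\in H^1_0(\Omega)$. **Meshes and spaces.** $\mathcal{T}_0$ is an initial conforming simplicial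 triangulation of $\Omega$. Refinement is by newest-vertex bisection (NVB): for $\mathcal{M}_H\subseteq\mathcal{T}_H$, $\mathtt{refine}(\mathcal{T}_H,\mathcal{M}_H)$ is the coarsest conforming NVB refinement of $\mathcal{T}_H$ in which at least all elements of $\mathcal{M}_H$ have been refined. $\mathbb{T}(\mathcal{T}_H)$ is the set of meshes obtained from $\mathcal{T}_H$ by finitely many steps of NVB, and $\mathbb{T}:=\mathbb{T}(\mathcal{T}_0)$. For fixed $p\in\mathbb{N}$ and $\mathcal{T}_H\in\mathbb{T}$, $\mathcal{X}_H:=\{v_H\in H^1_0(\Omega): v_H|_T$ is a polynomial of total degree $\le p$ for all $T\in\mathcal{T}_H\}$; the Galerkin solution $u_H^\star\in\mathcal{X}_H$ solves $b(u_H^\star,v_H)=F(v_H)$ for all $v_H\in\mathcal{X}_H$. Quantities for the mesh $\mathcal{T}_\ell$ carry the index $\ell$. **Estimator.** $\boldsymbol{A}$ and $\boldsymbol{f}$ are regular enough for the following to be well-defined (e.g. $\boldsymbol{A}|_T,\boldsymbol{f}|_T\in W^{1,\infty}(T)$ for all $T\in\mathcal{T}_0$). For $T\in\mathcal{T}_H$, $v_H\in\mathcal{X}_H$, $$\eta_H(T,v_H)^2:=|T|^{2/d}\|-\operatorname{div}(\boldsymbol{A}\nabla v_H-\boldsymbol{f})+\boldsymbol{b}\cdot\nabla v_H+c\,v_H-f\|_{L^2(T)}^2+|T|^{1/d}\|[\![(\boldsymbol{A}\nabla v_H-\boldsymbol{f})\cdot n]\!]\|_{L^2(\partial T\cap\Omega)}^2,$$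 where $[\![\cdot]\!]$ is the jump over $(d-1)$-dimensional faces; $\eta_H(\mathcal{U}_H,v_H):=(\sum_{T\in\mathcal{U}_H}\eta_H(T,v_H)^2)^{1/2}$ for $\mathcal{U}_H\subseteq\mathcal{T}_H$, and $\eta_H(v_H):=\eta_H(\mathcal{T}_H,v_H)$. **Known properties (recalled from the literature), fixing $C_{\mathrm{stab}}$ and $q_{\mathrm{red}}$.** There are constants $C_{\mathrm{stab}},C_{\mathrm{rel}},C_{\mathrm{mon}}>0$, $q_{\mathrm{red}}=2^{-1/(2d)}$ such that for all $\mathcal{T}_H\in\mathbb{T}$, $\mathcal{T}_h\in\mathbb{T}(\mathcal{T}_H)$, $v_H\in\mathcal{X}_H$, $v_h\in\mathcal{X}_h$: (stability) $|\eta_h(\mathcal{T}_h\cap\mathcal{T}_H,v_h)-\eta_H(\mathcal{T}_h\cap\mathcal{T}_H,v_H)|\le C_{\mathrm{stab}}|||v_h-v_H|||$; (reduction) $\eta_h(\mathcal{T}_h\setminus\mathcal{T}_H,v_H)\le q_{\mathrm{red}}\,\eta_H(\mathcal{T}_H\setminus\mathcal{T}_h,v_H)$; (reliability) $|||u^\star-u_H^\star|||\le C_{\mathrm{rel}}\eta_H(u_H^\star)$; (quasi-monotonicity) $\eta_h(u_h^\star)\le C_{\mathrm{mon}}\eta_H(u_H^\star)$. Moreover (quasi-orthogonality) there are $C_{\mathrm{orth}}>0$, $0<\delta'\le1$ such that for every nested sequence $\mathcal{X}_\ell\subseteq\mathcal{X}_{\ell+1}\subset H^1_0(\Omega)$ of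 finite-dimensional subspaces with Galerkin solutions $u_\ell^\star$: $\sum_{\ell'=\ell}^{\ell+N}|||u_{\ell'+1}^\star-u_{\ell'}^\star|||^2\le C_{\mathrm{orth}}(N+1)^{1-\delta'}|||u^\star-u_\ell^\star|||^2$ for all $\ell,N\in\mathbb{N}_0$. **Zarantonello symmetrization.** Fix $0<\delta<2\alpha/L^2$ and set $0<q_{\mathrm{sym}}^\star:=[1-\delta(2\alpha-\delta L^2)]^{1/2}<1$. The map $\Phi_H(\delta;\cdot):\mathcal{X}_H\to\mathcal{X}_H$ is defined by $a(\Phi_H(\delta;u_H),v_H)=a(u_H,v_H)+\delta[F(v_H)-b(u_H,v_H)]$ for all $u_H,v_H\in\mathcal{X}_H$. It satisfies $|||u_H^\star-\Phi_H(\delta;u_H)|||\le q_{\mathrm{sym}}^\star|||u_H^\star-u_H|||$. **Algebraic solver.** There is $0<q_{\mathrm{alg}}<1$, independent of $\mathcal{X}_H$, and iteration maps $\Psi_H(u_H^\sharp;\cdot):\mathcal{X}_H\to\mathcal{X}_H$ with $|||u_H^\sharp-\Psi_H(u_H^\sharp;w_H)|||\le q_{\mathrm{alg}}|||u_H^\sharp-w_H|||$ for all $w_H\in\mathcal{X}_H$ and all $\mathcal{T}_H\in\mathbb{T}$, where $u_H^\sharp:=\Phi_H(\delta;u_H)$, $u_H\in\mathcal{X}_H$. **Algorithm (AFEM with nested contractive solvers).** Input: $\mathcal{T}_0$, $\delta$, $0<\theta\le1$, $C_{\mathrm{mark}}\ge1$, $\lambda_{\mathrm{sym}},\lambda_{\mathrm{alg}}>0$,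 $u_0^{0,0}=:u_0^{0,\underline{j}}\in\mathcal{X}_0$. For $\ell=0,1,2,\dots$: (i) For $k=1,2,3,\dots$ repeat (a)–(c) until $|||u_\ell^{k,\underline{j}}-u_\ell^{k-1,\underline{j}}|||\le\lambda_{\mathrm{sym}}\,\eta_\ell(u_\ell^{k,\underline{j}})$: (a) set $u_\ell^{k,0}:=u_\ell^{k-1,\underline{j}}$ and (theoretical quantity) $u_\ell^{k,\star}:=\Phi_\ell(\delta;u_\ell^{k-1,\underline{j}})$; (b) for $j=1,2,3,\dots$ compute $u_\ell^{k,j}:=\Psi_\ell(u_\ell^{k,\star};u_\ell^{k,j-1})$ and $\eta_\ell(T,u_\ell^{k,j})$ for all $T\in\mathcal{T}_\ell$, until $|||u_\ell^{k,j}-u_\ell^{k,j-1}|||\le\lambda_{\mathrm{alg}}[\lambda_{\mathrm{sym}}\eta_\ell(u_\ell^{k,j})+|||u_\ell^{k,j}-u_\ell^{k-1,\underline{j}}|||]$; (c) upon termination set $\underline{j}[\ell,k]:=j\in\mathbb{N}$, $u_\ell^{k,\underline{j}}:=u_\ell^{k,\underline{j}[\ell,k]}$. (ii) Upon termination of the $k$-loop set $\underline{k}[\ell]:=k\in\mathbb{N}$, $u_\ell^{\underline{k},\underline{j}}:=u_\ell^{\underline{k}[\ell],\underline{j}}$. (iii) Choose $\mathcal{M}_\ell\in\mathbb{M}_\ell:=\{\mathcal{U}_\ell\subseteq\mathcal{T}_\ell:\theta\,\eta_\ell(u_\ell^{\underline{k},\underline{j}})^2\le\eta_\ell(\mathcal{U}_\ell,u_\ell^{\underline{k},\underline{j}})^2\}$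 with $\#\mathcal{M}_\ell\le C_{\mathrm{mark}}\min_{\mathcal{U}_\ell^\star\in\mathbb{M}_\ell}\#\mathcal{U}_\ell^\star$. (iv) Set $\mathcal{T}_{\ell+1}:=\mathtt{refine}(\mathcal{T}_\ell,\mathcal{M}_\ell)$ and $u_{\ell+1}^{0,0}:=u_{\ell+1}^{0,\underline{j}}:=u_\ell^{\underline{k},\underline{j}}$. For $k=0$ the convention is $u_\ell^{0,\star}:=u_\ell^{0,0}=u_\ell^{0,\underline{j}}$ (so $\underline{j}[\ell,0]=0$). It is known that the inner $j$-loop always terminates; the $k$-loop may fail to terminate on some mesh, in which case the algorithm stays on that mesh forever. **Index set.** $\mathcal{Q}:=\{(\ell,k,j)\in\mathbb{N}_0^3:u_\ell^{k,j}$ is used in the algorithm$\}$, ordered lexicographically by $(\ell',k',j')\le(\ell,k,j)$ iff $u_{\ell'}^{k',j'}$ is defined not later than $u_\ell^{k,j}$; total step counter $|\ell,k,j|:=\#\{(\ell',k',j')\in\mathcal{Q}:(\ell',k',j')\le(\ell,k,j)\}$. *)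

theory Defs
  imports "HOL-Analysis.Analysis" "HOL-Library.Extended_Nat"
begin

section \<open>Lebesgue and Sobolev spaces\<close>

text \<open>
  Elements of function spaces are represented by functions on the whole of \<open>\<real>\<^sup>d\<close>; only their
  values almost everywhere in the set under consideration matter.
\<close>

definition L2 :: "(real^'d) set \<Rightarrow> (real^'d::finite \<Rightarrow> 'b::real_normed_vector) \<Rightarrow> bool" where
  "L2 U g \<longleftrightarrow> g \<in> borel_measurable (lebesgue_on U) \<and>
     integrable (lebesgue_on U) (\<lambda>x. (norm (g x))\<^sup>2)"

definition Linf :: "(real^'d) set \<Rightarrow> (real^'d::finite \<Rightarrow> 'b::real_normed_vector) \<Rightarrow> bool" where
  "Linf U g \<longleftrightarrow> g \<in> borel_measurable (lebesgue_on U) \<and>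
     (\<exists>C. AE x in lebesgue_on U. norm (g x) \<le> C)"

definition pderiv_at :: "'d \<Rightarrow> (real^'d::finite \<Rightarrow> real) \<Rightarrow> real^'d \<Rightarrow> real" where
  "pderiv_at i \<phi> x = frechet_derivative \<phi> (at x) (axis i 1)"

primrec Ck :: "nat \<Rightarrow> (real^'d::finite \<Rightarrow> real) \<Rightarrow> bool" where
  "Ck 0 \<phi> \<longleftrightarrow> continuous_on UNIV \<phi>"
| "Ck (Suc n) \<phi> \<longleftrightarrow> (\<forall>x. \<phi> differentiable (at x)) \<and> (\<forall>i. Ck n (pderiv_at i \<phi>))"

text \<open>\<open>C\<^sub>c\<^sup>\<infinity>(U)\<close>\<close>
definition test_function :: "(real^'d::finite) set \<Rightarrow> (real^'d \<Rightarrow> real) \<Rightarrow> bool" where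
  "test_function U \<phi> \<longleftrightarrow> (\<forall>n. Ck n \<phi>) \<and>
     (\<exists>K. compact K \<and> K \<subseteq> U \<and> (\<forall>x. x \<notin> K \<longrightarrow> \<phi> x = 0))"

definition has_weak_grad ::
    "(real^'d::finite) set \<Rightarrow> (real^'d \<Rightarrow> real) \<Rightarrow> (real^'d \<Rightarrow> real^'d) \<Rightarrow> bool" where
  "has_weak_grad U u g \<longleftrightarrow> (\<forall>\<phi>. test_function U \<phi> \<longrightarrow> (\<forall>i.
     (LINT x|lebesgue_on U. u x * pderiv_at i \<phi> x) = - (LINT x|lebesgue_on U. g x $ i * \<phi> x)))"

definition has_weak_div ::
    "(real^'d::finite) set \<Rightarrow> (real^'d \<Rightarrow> real^'d) \<Rightarrow> (real^'d \<Rightarrow> real) \<Rightarrow> bool" where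
  "has_weak_div U G g \<longleftrightarrow> (\<forall>\<phi>. test_function U \<phi> \<longrightarrow>
     (LINT x|lebesgue_on U. (\<Sum>i\<in>UNIV. G x $ i * pderiv_at i \<phi> x)) =
     - (LINT x|lebesgue_on U. g x * \<phi> x))"

text \<open>Weak derivatives in \<open>L\<^sup>2\<close> are unique almost everywhere, so any choice may be made.\<close>

definition wgrad :: "(real^'d::finite) set \<Rightarrow> (real^'d \<Rightarrow> real) \<Rightarrow> real^'d \<Rightarrow> real^'d" where
  "wgrad U u = (SOME g. L2 U g \<and> has_weak_grad U u g)"

definition wdiv :: "(real^'d::finite) set \<Rightarrow> (real^'d \<Rightarrow> real^'d) \<Rightarrow> real^'d \<Rightarrow> real" where
  "wdiv U G = (SOME g. L2 U g \<and> has_weak_div U G g)"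

definition H1 :: "(real^'d::finite) set \<Rightarrow> (real^'d \<Rightarrow> real) set" where
  "H1 U = {u. L2 U u \<and> (\<exists>g. L2 U g \<and> has_weak_grad U u g)}"

definition H1_norm :: "(real^'d::finite) set \<Rightarrow> (real^'d \<Rightarrow> real) \<Rightarrow> real" where
  "H1_norm U u =
     sqrt ((LINT x|lebesgue_on U. (u x)\<^sup>2) + (LINT x|lebesgue_on U. (norm (wgrad U u x))\<^sup>2))"

text \<open>\<open>H\<^sup>1\<^sub>0(U)\<close> is the closure of \<open>C\<^sub>c\<^sup>\<infinity>(U)\<close> in \<open>H\<^sup>1(U)\<close>.\<close>
definition H10 :: "(real^'d::finite) set \<Rightarrow> (real^'d \<Rightarrow> real) set" where
  "H10 U = {u \<in> H1 U. \<exists>\<phi>. (\<forall>n. test_function U (\<phi> n)) \<and>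
     (\<lambda>n. H1_norm U (\<lambda>x. \<phi> n x - u x)) \<longlonglongrightarrow> 0}"


section \<open>Domains\<close>

text \<open>Near each boundary point, the domain is the strict epigraph of a Lipschitz function in the
  coordinates \<open>(x - z) - t e \<in> e\<^sup>\<bottom>\<close> and \<open>t = (x - z) \<bullet> e\<close>.\<close>
definition lipschitz_boundary :: "(real^'d::finite) set \<Rightarrow> bool" where
  "lipschitz_boundary \<Omega> \<longleftrightarrow> (\<forall>z\<in>frontier \<Omega>. \<exists>e r h C (\<gamma> :: real^'d \<Rightarrow> real).
     norm e = 1 \<and> 0 < r \<and> 0 < h \<and> C-lipschitz_on UNIV \<gamma> \<and>
     (\<forall>x. let t = (x - z) \<bullet> e; y = (x - z) - t *\<^sub>R e in
        norm y < r \<and> \<bar>t\<bar> < h \<longrightarrow> (x \<in> \<Omega> \<longleftrightarrow> \<gamma> y < t)))"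

definition polyhedral_lipschitz_domain :: "(real^'d::finite) set \<Rightarrow> bool" where
  "polyhedral_lipschitz_domain \<Omega> \<longleftrightarrow>
     open \<Omega> \<and> connected \<Omega> \<and> \<Omega> \<noteq> {} \<and> bounded \<Omega> \<and> lipschitz_boundary \<Omega> \<and>
     (\<exists>\<P>. finite \<P> \<and> (\<forall>S\<in>\<P>. polytope S) \<and> closure \<Omega> = \<Union>\<P>)"


section \<open>The model problem\<close>

record ('d::finite) problem =
  dom :: "(real^'d) set"
  cA :: "real^'d \<Rightarrow> real^'d^'d"
  cb :: "real^'d \<Rightarrow> real^'d"
  cc :: "real^'d \<Rightarrow> real"
  rhs :: "real^'d \<Rightarrow> real"
  rhsv :: "real^'d \<Rightarrow> real^'d"

abbreviation grad_of :: "('d::finite) problem \<Rightarrow> (real^'d \<Rightarrow> real) \<Rightarrow> real^'d \<Rightarrow> real^'d" where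
  "grad_of P \<equiv> wgrad (dom P)"

definition model_problem :: "('d::finite) problem \<Rightarrow> bool" where
  "model_problem P \<longleftrightarrow>
     polyhedral_lipschitz_domain (dom P) \<and>
     Linf (dom P) (cA P) \<and> Linf (dom P) (cb P) \<and> Linf (dom P) (cc P) \<and>
     L2 (dom P) (rhs P) \<and> L2 (dom P) (rhsv P) \<and>
     (AE x in lebesgue_on (dom P). transpose (cA P x) = cA P x \<and>
        (\<forall>\<xi>. \<xi> \<noteq> 0 \<longrightarrow> 0 < \<xi> \<bullet> (cA P x *v \<xi>)))"

definition a_form :: "('d::finite) problem \<Rightarrow> (real^'d \<Rightarrow> real) \<Rightarrow> (real^'d \<Rightarrow> real) \<Rightarrow> real" where
  "a_form P u v = (LINT x|lebesgue_on (dom P). (cA P x *v grad_of P u x) \<bullet> grad_of P v x)"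

definition b_form :: "('d::finite) problem \<Rightarrow> (real^'d \<Rightarrow> real) \<Rightarrow> (real^'d \<Rightarrow> real) \<Rightarrow> real" where
  "b_form P u v = a_form P u v +
     (LINT x|lebesgue_on (dom P). (cb P x \<bullet> grad_of P u x + cc P x * u x) * v x)"

definition load :: "('d::finite) problem \<Rightarrow> (real^'d \<Rightarrow> real) \<Rightarrow> real" where
  "load P v = (LINT x|lebesgue_on (dom P). rhs P x * v x) +
     (LINT x|lebesgue_on (dom P). rhsv P x \<bullet> grad_of P v x)"

definition continuous_elliptic ::
    "(real^'d::finite) set \<Rightarrow> ((real^'d \<Rightarrow> real) \<Rightarrow> (real^'d \<Rightarrow> real) \<Rightarrow> real) \<Rightarrow> bool" where
  "continuous_elliptic \<Omega> B \<longleftrightarrow>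
     (\<exists>C. \<forall>u\<in>H10 \<Omega>. \<forall>v\<in>H10 \<Omega>. \<bar>B u v\<bar> \<le> C * H1_norm \<Omega> u * H1_norm \<Omega> v) \<and>
     (\<exists>c>0. \<forall>v\<in>H10 \<Omega>. c * (H1_norm \<Omega> v)\<^sup>2 \<le> B v v)"

definition enorm :: "('d::finite) problem \<Rightarrow> (real^'d \<Rightarrow> real) \<Rightarrow> real" where
  "enorm P u = sqrt (a_form P u u)"

abbreviation edist :: "('d::finite) problem \<Rightarrow> (real^'d \<Rightarrow> real) \<Rightarrow> (real^'d \<Rightarrow> real) \<Rightarrow> real" where
  "edist P u v \<equiv> enorm P (\<lambda>x. u x - v x)"

definition galerkin_solution ::
    "('d::finite) problem \<Rightarrow> (real^'d \<Rightarrow> real) set \<Rightarrow> (real^'d \<Rightarrow> real) \<Rightarrow> bool" where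
  "galerkin_solution P V u \<longleftrightarrow> u \<in> V \<and> (\<forall>v\<in>V. b_form P u v = load P v)"

abbreviation weak_solution :: "('d::finite) problem \<Rightarrow> (real^'d \<Rightarrow> real) \<Rightarrow> bool" where
  "weak_solution P u \<equiv> galerkin_solution P (H10 (dom P)) u"


section \<open>Meshes and newest-vertex bisection\<close>

text \<open>A tagged simplex \<open>([z\<^sub>0, \<dots>, z\<^sub>d], \<gamma>)\<close> carries the ordering of its vertices and its type
  \<open>\<gamma> \<in> {0, \<dots>, d - 1}\<close>; the refinement edge is always \<open>z\<^sub>0 z\<^sub>d\<close>.\<close>
type_synonym 'd tsimplex = "(real^'d) list \<times> nat"
type_synonym 'd mesh = "'d tsimplex set"

definition tagged_simplex :: "('d::finite) tsimplex \<Rightarrow> bool" where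
  "tagged_simplex \<tau> \<longleftrightarrow> length (fst \<tau>) = CARD('d) + 1 \<and> distinct (fst \<tau>) \<and>
     \<not> affine_dependent (set (fst \<tau>)) \<and> snd \<tau> < CARD('d)"

definition elem :: "('d::finite) tsimplex \<Rightarrow> (real^'d) set" where
  "elem \<tau> = convex hull (set (fst \<tau>))"

definition conforming :: "('d::finite) mesh \<Rightarrow> bool" where
  "conforming \<T> \<longleftrightarrow> inj_on elem \<T> \<and> triangulation (elem ` \<T>)"

definition initial_mesh :: "(real^'d::finite) set \<Rightarrow> 'd mesh \<Rightarrow> bool" where
  "initial_mesh \<Omega> \<T> \<longleftrightarrow>
     (\<forall>\<tau>\<in>\<T>. tagged_simplex \<tau>) \<and> conforming \<T> \<and> \<Union>(elem ` \<T>) = closure \<Omega>"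

text \<open>Bisection rule of Maubach, Traxler and Stevenson, which for \<open>d = 2\<close> is newest-vertex
  bisection: with \<open>m = (z\<^sub>0 + z\<^sub>d) / 2\<close>, the children are \<open>(z\<^sub>0, m, z\<^sub>1, \<dots>, z\<^sub>d\<^sub>-\<^sub>1)\<close> and
  \<open>(z\<^sub>d, m, z\<^sub>1, \<dots>, z\<^sub>\<gamma>, z\<^sub>d\<^sub>-\<^sub>1, \<dots>, z\<^sub>\<gamma>\<^sub>+\<^sub>1)\<close>, both of type \<open>(\<gamma> + 1) mod d\<close>.\<close>
definition children :: "('d::finite) tsimplex \<Rightarrow> 'd mesh" where
  "children \<tau> = (let zs = fst \<tau>; \<gamma> = snd \<tau>; \<gamma>' = Suc \<gamma> mod CARD('d);
       m = midpoint (hd zs) (last zs); ys = butlast (tl zs) in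
     {(hd zs # m # ys, \<gamma>'), (last zs # m # take \<gamma> ys @ rev (drop \<gamma> ys), \<gamma>')})"

definition bisect :: "('d::finite) mesh \<Rightarrow> 'd mesh \<Rightarrow> bool" where
  "bisect \<T> \<T>' \<longleftrightarrow> (\<exists>\<tau>\<in>\<T>. \<T>' = (\<T> - {\<tau>}) \<union> children \<tau>)"

abbreviation bisections :: "('d::finite) mesh \<Rightarrow> 'd mesh \<Rightarrow> bool" where
  "bisections \<equiv> bisect\<^sup>*\<^sup>*"

text \<open>\<open>\<T>'\<close> is the coarsest conforming refinement of \<open>\<T>\<close> in which all elements of \<open>\<M>\<close> are refined;
  meshes between \<open>\<T>\<close> and \<open>\<T>'\<close> need not be conforming.\<close>
definition is_refine :: "('d::finite) mesh \<Rightarrow> 'd mesh \<Rightarrow> 'd mesh \<Rightarrow> bool" where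
  "is_refine \<T> \<M> \<T>' \<longleftrightarrow> bisections \<T> \<T>' \<and> conforming \<T>' \<and> \<M> \<inter> \<T>' = {} \<and>
     (\<forall>\<S>. bisections \<T> \<S> \<and> conforming \<S> \<and> \<M> \<inter> \<S> = {} \<longrightarrow> bisections \<T>' \<S>)"

definition refinements :: "('d::finite) mesh \<Rightarrow> 'd mesh set" where
  "refinements \<T> = {\<T>'. (\<lambda>\<S> \<S>'. \<exists>\<M>\<subseteq>\<S>. is_refine \<S> \<M> \<S>')\<^sup>*\<^sup>* \<T> \<T>'}"


section \<open>Finite element spaces\<close>

definition polynomial_deg_le :: "nat \<Rightarrow> (real^'d::finite \<Rightarrow> real) \<Rightarrow> bool" where
  "polynomial_deg_le p q \<longleftrightarrow> (\<exists>c :: ('d \<Rightarrow> nat) \<Rightarrow> real. \<forall>x.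
     q x = (\<Sum>m | (\<Sum>i\<in>UNIV. m i) \<le> p. c m * (\<Prod>i\<in>UNIV. (x $ i) ^ m i)))"

definition fe_space :: "('d::finite) problem \<Rightarrow> nat \<Rightarrow> 'd mesh \<Rightarrow> (real^'d \<Rightarrow> real) set" where
  "fe_space P p \<T> = {v \<in> H10 (dom P). \<forall>\<tau>\<in>\<T>. \<exists>q. polynomial_deg_le p q \<and>
     (AE x in lebesgue_on (elem \<tau>). v x = q x)}"

definition finite_dim_subspace :: "(real^'d::finite) set \<Rightarrow> (real^'d \<Rightarrow> real) set \<Rightarrow> bool" where
  "finite_dim_subspace \<Omega> V \<longleftrightarrow> V \<subseteq> H10 \<Omega> \<and> (\<lambda>x. 0) \<in> V \<and>
     (\<forall>u\<in>V. \<forall>v\<in>V. (\<lambda>x. u x + v x) \<in> V) \<and> (\<forall>c. \<forall>v\<in>V. (\<lambda>x. c * v x) \<in> V) \<and>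
     (\<exists>B. finite B \<and> (\<forall>v\<in>V. \<exists>c. AE x in lebesgue_on \<Omega>. v x = (\<Sum>g\<in>B. c g * g x)))"


section \<open>Residual error estimator\<close>

definition flux :: "('d::finite) problem \<Rightarrow> (real^'d \<Rightarrow> real) \<Rightarrow> real^'d \<Rightarrow> real^'d" where
  "flux P v x = cA P x *v grad_of P v x - rhsv P x"

text \<open>Traces on the boundary of an element are pointwise limits of averages. For Sobolev functions
  this is the usual trace, up to a null set of the boundary; for functions in
  \<open>W\<^sup>1\<^sup>,\<^sup>\<infinity>\<close> of the element it is the restriction of the continuous representative.\<close>

definition trace_average :: "(real^'d::finite) set \<Rightarrow> (real^'d \<Rightarrow> real^'d) \<Rightarrow> real^'d \<Rightarrow> real \<Rightarrow> real^'d" where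
  "trace_average T G y r = (1 / measure lebesgue (T \<inter> ball y r)) *\<^sub>R
     (LINT x|lebesgue_on (T \<inter> ball y r). G x)"

definition elem_trace :: "(real^'d::finite) set \<Rightarrow> (real^'d \<Rightarrow> real^'d) \<Rightarrow> real^'d \<Rightarrow> real^'d" where
  "elem_trace T G y = Lim (at_right 0) (trace_average T G y)"

text \<open>Integration over a flat \<open>(d - 1)\<close>-dimensional face \<open>F\<close> with respect to surface measure: by
  Fubini, this is integration of the function extended constantly in normal direction over the
  right prism of height one on \<open>F\<close>. For \<open>d = 1\<close>, it is evaluation at the point.\<close>

definition face_normal :: "(real^'d::finite) set \<Rightarrow> real^'d" where
  "face_normal F = (SOME n. norm n = 1 \<and> (\<forall>x\<in>F. \<forall>y\<in>F. n \<bullet> (x - y) = 0))"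

definition face_prism :: "(real^'d::finite) set \<Rightarrow> (real^'d) set" where
  "face_prism F = {x + t *\<^sub>R face_normal F | x t. x \<in> F \<and> 0 \<le> t \<and> t \<le> 1}"

abbreviation face_proj :: "(real^'d::finite) set \<Rightarrow> real^'d \<Rightarrow> real^'d" where
  "face_proj F \<equiv> closest_point (affine hull F)"

definition face_integral :: "(real^'d::finite) set \<Rightarrow> (real^'d \<Rightarrow> real) \<Rightarrow> real" where
  "face_integral F g = (LINT z|lebesgue_on (face_prism F). g (face_proj F z))"

text \<open>The interior faces of \<open>\<tau>\<close> in a conforming mesh are its intersections with its neighbours.\<close>
definition neighbours :: "('d::finite) mesh \<Rightarrow> 'd tsimplex \<Rightarrow> 'd mesh" where
  "neighbours \<T> \<tau> = {\<tau>' \<in> \<T>. \<tau>' \<noteq> \<tau> \<and> aff_dim (elem \<tau> \<inter> elem \<tau>') = int CARD('d) - 1}"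

definition normal_jump ::
    "(real^'d::finite \<Rightarrow> real^'d) \<Rightarrow> 'd tsimplex \<Rightarrow> 'd tsimplex \<Rightarrow> real^'d \<Rightarrow> real" where
  "normal_jump G \<tau> \<tau>' y =
     (elem_trace (elem \<tau>) G y - elem_trace (elem \<tau>') G y) \<bullet> face_normal (elem \<tau> \<inter> elem \<tau>')"

definition residual :: "('d::finite) problem \<Rightarrow> (real^'d \<Rightarrow> real) \<Rightarrow> 'd tsimplex \<Rightarrow> real^'d \<Rightarrow> real" where
  "residual P v \<tau> x = - wdiv (interior (elem \<tau>)) (flux P v) x +
     cb P x \<bullet> grad_of P v x + cc P x * v x - rhs P x"

definition eta_sq :: "('d::finite) problem \<Rightarrow> 'd mesh \<Rightarrow> 'd tsimplex \<Rightarrow> (real^'d \<Rightarrow> real) \<Rightarrow> real" where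
  "eta_sq P \<T> \<tau> v =
     measure lebesgue (elem \<tau>) powr (2 / real CARD('d)) *
       (LINT x|lebesgue_on (elem \<tau>). (residual P v \<tau> x)\<^sup>2) +
     measure lebesgue (elem \<tau>) powr (1 / real CARD('d)) *
       (\<Sum>\<tau>'\<in>neighbours \<T> \<tau>.
          face_integral (elem \<tau> \<inter> elem \<tau>') (\<lambda>y. (normal_jump (flux P v) \<tau> \<tau>' y)\<^sup>2))"

definition eta_on :: "('d::finite) problem \<Rightarrow> 'd mesh \<Rightarrow> 'd mesh \<Rightarrow> (real^'d \<Rightarrow> real) \<Rightarrow> real" where
  "eta_on P \<T> \<U> v = sqrt (\<Sum>\<tau>\<in>\<U>. eta_sq P \<T> \<tau> v)"

abbreviation eta :: "('d::finite) problem \<Rightarrow> 'd mesh \<Rightarrow> (real^'d \<Rightarrow> real) \<Rightarrow> real" where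
  "eta P \<T> \<equiv> eta_on P \<T> \<T>"

text \<open>The regularity required of the coefficient \<open>A\<close> and the datum \<open>\<^bold>f\<close>: divergence, traces and
  jumps of the flux exist and are square-integrable. This is the case if both are in
  \<open>W\<^sup>1\<^sup>,\<^sup>\<infinity>\<close> of each element of the initial mesh.\<close>
definition estimator_well_defined :: "('d::finite) problem \<Rightarrow> nat \<Rightarrow> 'd mesh \<Rightarrow> bool" where
  "estimator_well_defined P p \<T>0 \<longleftrightarrow>
     (\<forall>\<T>\<in>refinements \<T>0. \<forall>v\<in>fe_space P p \<T>. \<forall>\<tau>\<in>\<T>.
        (\<exists>g. L2 (interior (elem \<tau>)) g \<and> has_weak_div (interior (elem \<tau>)) (flux P v) g) \<and>
        (\<forall>\<tau>'\<in>neighbours \<T> \<tau>. let F = elem \<tau> \<inter> elem \<tau>' in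
           (AE z in lebesgue_on (face_prism F).
              \<exists>l. (trace_average (elem \<tau>) (flux P v) (face_proj F z) \<longlongrightarrow> l) (at_right 0)) \<and>
           L2 (face_prism F) (\<lambda>z. normal_jump (flux P v) \<tau> \<tau>' (face_proj F z))))"


section \<open>Properties of estimator and Galerkin solutions\<close>

definition stability :: "('d::finite) problem \<Rightarrow> nat \<Rightarrow> 'd mesh \<Rightarrow> real \<Rightarrow> bool" where
  "stability P p \<T>0 Cstab \<longleftrightarrow>
     (\<forall>\<T>\<in>refinements \<T>0. \<forall>\<T>'\<in>refinements \<T>. \<forall>v\<in>fe_space P p \<T>. \<forall>v'\<in>fe_space P p \<T>'.
        \<bar>eta_on P \<T>' (\<T>' \<inter> \<T>) v' - eta_on P \<T> (\<T>' \<inter> \<T>) v\<bar> \<le> Cstab * edist P v' v)"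

definition reduction :: "('d::finite) problem \<Rightarrow> nat \<Rightarrow> 'd mesh \<Rightarrow> real \<Rightarrow> bool" where
  "reduction P p \<T>0 qred \<longleftrightarrow>
     (\<forall>\<T>\<in>refinements \<T>0. \<forall>\<T>'\<in>refinements \<T>. \<forall>v\<in>fe_space P p \<T>.
        eta_on P \<T>' (\<T>' - \<T>) v \<le> qred * eta_on P \<T> (\<T> - \<T>') v)"

text \<open>In the following, \<open>ug \<T>\<close> is the Galerkin solution in the finite element space on \<open>\<T>\<close>.\<close>

definition reliability :: "('d::finite) problem \<Rightarrow> 'd mesh \<Rightarrow> (real^'d \<Rightarrow> real) \<Rightarrow>
    ('d mesh \<Rightarrow> real^'d \<Rightarrow> real) \<Rightarrow> real \<Rightarrow> bool" where
  "reliability P \<T>0 ustar ug Crel \<longleftrightarrow>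
     (\<forall>\<T>\<in>refinements \<T>0. edist P ustar (ug \<T>) \<le> Crel * eta P \<T> (ug \<T>))"

definition quasi_monotonicity :: "('d::finite) problem \<Rightarrow> 'd mesh \<Rightarrow>
    ('d mesh \<Rightarrow> real^'d \<Rightarrow> real) \<Rightarrow> real \<Rightarrow> bool" where
  "quasi_monotonicity P \<T>0 ug Cmon \<longleftrightarrow>
     (\<forall>\<T>\<in>refinements \<T>0. \<forall>\<T>'\<in>refinements \<T>. eta P \<T>' (ug \<T>') \<le> Cmon * eta P \<T> (ug \<T>))"

definition quasi_orthogonality ::
    "('d::finite) problem \<Rightarrow> (real^'d \<Rightarrow> real) \<Rightarrow> real \<Rightarrow> real \<Rightarrow> bool" where
  "quasi_orthogonality P ustar Corth \<delta>' \<longleftrightarrow>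
     (\<forall>X u. (\<forall>l::nat. finite_dim_subspace (dom P) (X l) \<and> X l \<subseteq> X (Suc l) \<and>
               galerkin_solution P (X l) (u l)) \<longrightarrow>
        (\<forall>l N. (\<Sum>i=l..l+N. (edist P (u (Suc i)) (u i))\<^sup>2) \<le>
               Corth * (real N + 1) powr (1 - \<delta>') * (edist P ustar (u l))\<^sup>2))"


section \<open>The adaptive algorithm\<close>

definition zarantonello :: "('d::finite) problem \<Rightarrow> real \<Rightarrow> (real^'d \<Rightarrow> real) set \<Rightarrow>
    ((real^'d \<Rightarrow> real) \<Rightarrow> (real^'d \<Rightarrow> real)) \<Rightarrow> bool" where
  "zarantonello P \<delta> V \<Phi> \<longleftrightarrow> (\<forall>u\<in>V. \<Phi> u \<in> V \<and>
     (\<forall>v\<in>V. a_form P (\<Phi> u) v = a_form P u v + \<delta> * (load P v - b_form P u v)))"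

text \<open>\<open>\<Psi> w\<^sup>\<sharp> w\<close> is one step of the solver for the system with solution \<open>w\<^sup>\<sharp>\<close> and current iterate \<open>w\<close>.\<close>
definition contractive_solver :: "('d::finite) problem \<Rightarrow> real \<Rightarrow> (real^'d \<Rightarrow> real) set \<Rightarrow>
    ((real^'d \<Rightarrow> real) \<Rightarrow> (real^'d \<Rightarrow> real)) \<Rightarrow>
    ((real^'d \<Rightarrow> real) \<Rightarrow> (real^'d \<Rightarrow> real) \<Rightarrow> (real^'d \<Rightarrow> real)) \<Rightarrow> bool" where
  "contractive_solver P q V \<Phi> \<Psi> \<longleftrightarrow> (\<forall>u\<in>V. \<forall>w\<in>V. \<Psi> (\<Phi> u) w \<in> V \<and>
     edist P (\<Phi> u) (\<Psi> (\<Phi> u) w) \<le> q * edist P (\<Phi> u) w)"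

definition doerfler_sets :: "('d::finite) problem \<Rightarrow> real \<Rightarrow> 'd mesh \<Rightarrow> (real^'d \<Rightarrow> real) \<Rightarrow> 'd mesh set" where
  "doerfler_sets P \<theta> \<T> v = {\<U>. \<U> \<subseteq> \<T> \<and> \<theta> * (eta P \<T> v)\<^sup>2 \<le> (eta_on P \<T> \<U> v)\<^sup>2}"

text \<open>
  The data produced by one execution. The stopping index \<open>kmax \<ell>\<close> is \<open>\<infinity>\<close> if the \<open>k\<close>-loop does
  not terminate on level \<open>\<ell>\<close>; the components belonging to later levels are then meaningless.
\<close>
record ('d::finite) execution =
  msh :: "nat \<Rightarrow> 'd mesh"
  marked :: "nat \<Rightarrow> 'd mesh"
  iter :: "nat \<Rightarrow> nat \<Rightarrow> nat \<Rightarrow> real^'d \<Rightarrow> real"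
  iter_star :: "nat \<Rightarrow> nat \<Rightarrow> real^'d \<Rightarrow> real"
  jmax :: "nat \<Rightarrow> nat \<Rightarrow> nat"
  kmax :: "nat \<Rightarrow> enat"

definition final_iter :: "('d::finite) execution \<Rightarrow> nat \<Rightarrow> nat \<Rightarrow> real^'d \<Rightarrow> real" where
  "final_iter R l k = iter R l k (jmax R l k)"

definition reached :: "('d::finite) execution \<Rightarrow> nat \<Rightarrow> bool" where
  "reached R l \<longleftrightarrow> (\<forall>l'<l. kmax R l' \<noteq> \<infinity>)"

definition stop_alg :: "('d::finite) problem \<Rightarrow> real \<Rightarrow> real \<Rightarrow> 'd execution \<Rightarrow> nat \<Rightarrow> nat \<Rightarrow> nat \<Rightarrow> bool" where
  "stop_alg P lsym lalg R l k j \<longleftrightarrow>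
     edist P (iter R l k j) (iter R l k (j - 1)) \<le>
     lalg * (lsym * eta P (msh R l) (iter R l k j) + edist P (iter R l k j) (final_iter R l (k - 1)))"

definition stop_sym :: "('d::finite) problem \<Rightarrow> real \<Rightarrow> 'd execution \<Rightarrow> nat \<Rightarrow> nat \<Rightarrow> bool" where
  "stop_sym P lsym R l k \<longleftrightarrow>
     edist P (final_iter R l k) (final_iter R l (k - 1)) \<le>
     lsym * eta P (msh R l) (final_iter R l k)"

definition j_loop :: "('d::finite) problem \<Rightarrow> real \<Rightarrow> real \<Rightarrow>
    ('d mesh \<Rightarrow> (real^'d \<Rightarrow> real) \<Rightarrow> (real^'d \<Rightarrow> real)) \<Rightarrow>
    ('d mesh \<Rightarrow> (real^'d \<Rightarrow> real) \<Rightarrow> (real^'d \<Rightarrow> real) \<Rightarrow> (real^'d \<Rightarrow> real)) \<Rightarrow>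
    'd execution \<Rightarrow> nat \<Rightarrow> nat \<Rightarrow> bool" where
  "j_loop P lsym lalg \<Phi> \<Psi> R l k \<longleftrightarrow>
     iter R l k 0 = final_iter R l (k - 1) \<and>
     iter_star R l k = \<Phi> (msh R l) (final_iter R l (k - 1)) \<and>
     1 \<le> jmax R l k \<and>
     (\<forall>j\<in>{1..jmax R l k}.
        iter R l k j = \<Psi> (msh R l) (iter_star R l k) (iter R l k (j - 1)) \<and>
        (stop_alg P lsym lalg R l k j \<longleftrightarrow> j = jmax R l k))"

definition k_loop :: "('d::finite) problem \<Rightarrow> real \<Rightarrow> real \<Rightarrow>
    ('d mesh \<Rightarrow> (real^'d \<Rightarrow> real) \<Rightarrow> (real^'d \<Rightarrow> real)) \<Rightarrow>
    ('d mesh \<Rightarrow> (real^'d \<Rightarrow> real) \<Rightarrow> (real^'d \<Rightarrow> real) \<Rightarrow> (real^'d \<Rightarrow> real)) \<Rightarrow>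
    'd execution \<Rightarrow> nat \<Rightarrow> bool" where
  "k_loop P lsym lalg \<Phi> \<Psi> R l \<longleftrightarrow>
     jmax R l 0 = 0 \<and> iter_star R l 0 = iter R l 0 0 \<and> 1 \<le> kmax R l \<and>
     (\<forall>k. 1 \<le> k \<and> enat k \<le> kmax R l \<longrightarrow>
        j_loop P lsym lalg \<Phi> \<Psi> R l k \<and> (stop_sym P lsym R l k \<longleftrightarrow> enat k = kmax R l))"

definition mark_and_refine :: "('d::finite) problem \<Rightarrow> real \<Rightarrow> real \<Rightarrow> 'd execution \<Rightarrow> nat \<Rightarrow> bool" where
  "mark_and_refine P \<theta> Cmark R l \<longleftrightarrow>
     (let w = final_iter R l (the_enat (kmax R l)); \<D> = doerfler_sets P \<theta> (msh R l) w in
        marked R l \<in> \<D> \<and> real (card (marked R l)) \<le> Cmark * real (Min (card ` \<D>)) \<and>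
        is_refine (msh R l) (marked R l) (msh R (Suc l)) \<and>
        iter R (Suc l) 0 0 = w)"

definition afem_execution :: "('d::finite) problem \<Rightarrow> 'd mesh \<Rightarrow> real \<Rightarrow> real \<Rightarrow> real \<Rightarrow> real \<Rightarrow>
    ('d mesh \<Rightarrow> (real^'d \<Rightarrow> real) \<Rightarrow> (real^'d \<Rightarrow> real)) \<Rightarrow>
    ('d mesh \<Rightarrow> (real^'d \<Rightarrow> real) \<Rightarrow> (real^'d \<Rightarrow> real) \<Rightarrow> (real^'d \<Rightarrow> real)) \<Rightarrow>
    (real^'d \<Rightarrow> real) \<Rightarrow> 'd execution \<Rightarrow> bool" where
  "afem_execution P \<T>0 \<theta> Cmark lsym lalg \<Phi> \<Psi> u0 R \<longleftrightarrow>
     msh R 0 = \<T>0 \<and> iter R 0 0 0 = u0 \<and>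
     (\<forall>l. reached R l \<longrightarrow> k_loop P lsym lalg \<Phi> \<Psi> R l \<and>
        (kmax R l \<noteq> \<infinity> \<longrightarrow> mark_and_refine P \<theta> Cmark R l))"

definition index_set :: "('d::finite) execution \<Rightarrow> (nat \<times> nat \<times> nat) set" where
  "index_set R = {(l, k, j). reached R l \<and> enat k \<le> kmax R l \<and> j \<le> jmax R l k}"

definition index_le :: "nat \<times> nat \<times> nat \<Rightarrow> nat \<times> nat \<times> nat \<Rightarrow> bool" where
  "index_le = (\<lambda>(l', k', j') (l, k, j).
     l' < l \<or> l' = l \<and> (k' < k \<or> k' = k \<and> j' \<le> j))"

definition step_count :: "('d::finite) execution \<Rightarrow> nat \<times> nat \<times> nat \<Rightarrow> nat" where
  "step_count R i = card {i' \<in> index_set R. index_le i' i}"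

definition quasi_error :: "('d::finite) problem \<Rightarrow> ('d mesh \<Rightarrow> real^'d \<Rightarrow> real) \<Rightarrow> 'd execution \<Rightarrow>
    nat \<times> nat \<times> nat \<Rightarrow> real" where
  "quasi_error P ug R = (\<lambda>(l, k, j).
     edist P (ug (msh R l)) (iter R l k j) + edist P (iter_star R l k) (iter R l k j) +
     eta P (msh R l) (iter R l k j))"

end

theory Submission
  imports Defs
begin

text \<open>
  Each of the three nested loops contracts the quasi-error up to a constant factor, and geometric
  decay in each of the three indices makes the sum of all later quasi-errors comparable to the
  current one. The latter is equivalent to geometric decay in the number of steps.

  \<^item> Algebraic loop (\<open>quasi_inner_loop\<close>). As long as this loop is not stopped, its stopping criterion is
  violated, so estimator and Zarantonello increment are dominated by the algebraic increment. Hence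
  the whole quasi-error is dominated by the algebraic error, which the solver contracts.

  \<^item> Symmetrization loop (\<open>quasi_middle_loop\<close>). The exact Zarantonello iteration contracts the
  distance to the Galerkin solution, because the bilinear form is elliptic and bounded
  (\<open>zarantonello_contraction\<close>). While the loop runs, the algebraic error left by the inner loop is
  small relative to the increment, and the inexact iteration still contracts, with factor
  \<open>q\<^sub>s\<^sub>y\<^sub>m\<close> (\<open>inexact_contraction\<close>).

  \<^item> Mesh refinement (\<open>quasi_outer_loop\<close>). Doerfler marking and the reduction property contract the
  estimator (\<open>estimator_reduction\<close>). Since \<open>\<lambda>\<^sub>a\<^sub>l\<^sub>g \<lambda>\<^sub>s\<^sub>y\<^sub>m\<close> is small, a weighted sum \<open>a\<^sub>l\<close> of the error and the
  estimator of the final iterate satisfies \<open>a\<^sub>l\<^sub>+\<^sub>1 \<le> q a\<^sub>l + d\<^sub>l\<close>, where \<open>d\<^sub>l\<close> is the distance of consecutive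
  Galerkin solutions (\<open>err_step\<close>). Quasi-orthogonality bounds the sum of \<open>N\<close> consecutive
  \<open>d\<^sub>i\<^sup>2\<close> by \<open>N\<^sup>1\<^sup>-\<^sup>\<delta> a\<^sub>l\<^sup>2\<close> up to a constant, and \<open>a\<close> is quasi-monotone; so \<open>N a\<^sub>l\<^sub>+\<^sub>N\<^sup>2\<close> has the same bound,
  and \<open>a\<^sub>l\<^sub>+\<^sub>N \<le> a\<^sub>l / 2\<close> for a fixed large \<open>N\<close> (\<open>level_convergence\<close>).

  These arguments use the energy norm only as a seminorm and are carried out in an abstract setting
  (\<open>nested_solver_run\<close>). To apply them, the energy norm has to be shown to be a seminorm on
  \<open>H\<^sup>1\<^sub>0\<close>. As the gradient of a function is an arbitrarily chosen weak gradient, already its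
  linearity rests on the uniqueness of weak gradients, that is, on the fundamental lemma of the
  calculus of variations, and hence on a sufficiently rich explicit family of test functions.
  Quasi-orthogonality moreover requires the finite element spaces to be nested and of finite
  dimension, which follows from the geometry of bisection.
\<close>

section \<open>Smooth bump functions on boxes\<close>

lemma exp_neg_inverse_le_power:
  fixes \<epsilon> w :: real
  assumes "0 < \<epsilon>" "0 < w"
  shows "exp (- \<epsilon> / w) \<le> fact n / \<epsilon> ^ n * w ^ n"
proof -
  have "(\<epsilon> / w) ^ n / fact n \<le> exp (\<epsilon> / w)"
  proof -
    have "(\<epsilon> / w) ^ n / fact n = (\<Sum>k\<in>{n}. (\<epsilon> / w) ^ k / fact k)" by simp
    also have "\<dots> \<le> (\<Sum>k. (\<epsilon> / w) ^ k / fact k)"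
      using assms summable_exp[of "\<epsilon> / w"]
      by (intro sum_le_suminf) (auto simp: divide_inverse mult.commute)
    also have "\<dots> = exp (\<epsilon> / w)"
      by (simp add: exp_def divide_inverse mult.commute)
    finally show ?thesis .
  qed
  hence "exp (- (\<epsilon> / w)) \<le> fact n / (\<epsilon> / w) ^ n"
    using assms by (simp add: exp_minus field_simps)
  thus ?thesis using assms by (simp add: power_divide)
qed

text \<open>The functions \<open>p exp (- \<epsilon> / w) / w\<^sup>m\<close> with \<open>w = (x - a) (b - x)\<close> and a polynomial \<open>p\<close>, extended by zero.
  The weights \<open>p\<close> and \<open>m\<close> make this family closed under differentiation, so that smoothness follows
  from a single differentiation rule; \<open>\<epsilon>\<close> will tend to zero.\<close>
definition wbump :: "real \<Rightarrow> real \<Rightarrow> real \<Rightarrow> nat \<Rightarrow> real poly \<Rightarrow> real \<Rightarrow> real" where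
  "wbump \<epsilon> a b m p x = (if a < x \<and> x < b
     then poly p x * exp (- \<epsilon> / ((x - a) * (b - x))) / ((x - a) * (b - x)) ^ m else 0)"

definition wbump_deriv :: "real \<Rightarrow> real \<Rightarrow> real \<Rightarrow> nat \<Rightarrow> real poly \<Rightarrow> real poly" where
  "wbump_deriv \<epsilon> a b m p = (let W = [:- a, 1:] * [:b, - 1:] in
     pderiv p * W\<^sup>2 + p * (smult \<epsilon> (pderiv W) - of_nat m * W * pderiv W))"

text \<open>The exponential beats every power of \<open>1 / w\<close>, and \<open>w \<le> (b - a) \<bar>y - x\<bar>\<close> for every \<open>x\<close> outside of
  the interval. The quadratic rate forces the derivative to vanish at the end points.\<close>
lemma wbump_quadratic_bound:
  assumes "0 < \<epsilon>"
  obtains C where "0 \<le> C" and "\<And>x y. \<not> (a < x \<and> x < b) \<Longrightarrow> \<bar>wbump \<epsilon> a b m p y\<bar> \<le> C * (y - x)\<^sup>2"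
proof -
  have "bounded (poly p ` {a..b})"
    by (intro compact_imp_bounded compact_continuous_image continuous_intros compact_Icc)
  then obtain B where B: "\<And>y. y \<in> {a..b} \<Longrightarrow> \<bar>poly p y\<bar> \<le> B"
    unfolding bounded_iff by (metis imageI real_norm_def)
  define K where "K = fact (m + 2) / \<epsilon> ^ (m + 2)"
  have K: "K \<ge> 0" using assms by (simp add: K_def)
  define C where "C = \<bar>B\<bar> * K * (b - a)\<^sup>2"
  show ?thesis
  proof (rule that)
    show "0 \<le> C" using K by (simp add: C_def)
    fix x y assume x: "\<not> (a < x \<and> x < b)"
    show "\<bar>wbump \<epsilon> a b m p y\<bar> \<le> C * (y - x)\<^sup>2"
    proof (cases "a < y \<and> y < b")
      case False
      thus ?thesis using \<open>0 \<le> C\<close> by (auto simp: wbump_def)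
    next
      case True
      define w where "w = (y - a) * (b - y)"
      have w0: "0 < w" using True by (simp add: w_def)
      have "w \<le> (b - a) * \<bar>y - x\<bar>"
      proof (cases "x \<le> a")
        case t: True
        have "(y - a) * (b - y) \<le> \<bar>y - x\<bar> * (b - a)"
          using True t by (intro mult_mono) auto
        thus ?thesis by (simp add: w_def mult.commute)
      next
        case f: False
        hence "(y - a) * (b - y) \<le> (b - a) * \<bar>y - x\<bar>"
          using True x by (intro mult_mono) auto
        thus ?thesis by (simp add: w_def)
      qed
      hence w2: "w\<^sup>2 \<le> (b - a)\<^sup>2 * (y - x)\<^sup>2"
        using w0 power_mono[of w "(b - a) * \<bar>y - x\<bar>" 2] by (simp add: power_mult_distrib)
      have "exp (- \<epsilon> / w) / w ^ m \<le> K * w\<^sup>2"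
        using exp_neg_inverse_le_power[OF assms w0, of "m + 2"] w0
        unfolding K_def power_add by (simp only: pos_divide_le_eq zero_less_power mult_ac)
      also have "\<dots> \<le> K * ((b - a)\<^sup>2 * (y - x)\<^sup>2)"
        using w2 K by (intro mult_left_mono) auto
      finally have 1: "exp (- \<epsilon> / w) / w ^ m \<le> K * ((b - a)\<^sup>2 * (y - x)\<^sup>2)" .
      have "\<bar>wbump \<epsilon> a b m p y\<bar> = \<bar>poly p y\<bar> * (exp (- \<epsilon> / w) / w ^ m)"
        using True w0 by (simp add: wbump_def w_def abs_mult)
      also have "\<dots> \<le> \<bar>B\<bar> * (K * ((b - a)\<^sup>2 * (y - x)\<^sup>2))"
        using B[of y] True w0 by (intro mult_mono 1) auto
      finally show ?thesis by (simp add: C_def mult.assoc)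
    qed
  qed
qed

lemma has_real_derivative_wbump:
  assumes "0 < \<epsilon>"
  shows "(wbump \<epsilon> a b m p has_real_derivative wbump \<epsilon> a b (m + 2) (wbump_deriv \<epsilon> a b m p) x) (at x)"
proof (cases "a < x \<and> x < b")
  case True
  define w where "w = (\<lambda>x. (x - a) * (b - x))"
  have w0: "w x \<noteq> 0" using True by (simp add: w_def)
  have dw: "(w has_real_derivative (a + b - 2 * x)) (at x)"
    unfolding w_def by (auto intro!: derivative_eq_intros simp: algebra_simps)
  have D: "((\<lambda>x. poly p x * exp (- \<epsilon> / w x) / (w x) ^ m) has_real_derivative
      poly (wbump_deriv \<epsilon> a b m p) x * exp (- \<epsilon> / w x) / (w x) ^ (m + 2)) (at x)"
  proof -
    define W where "W = [:- a, 1:] * [:b, - 1:]"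
    have W: "poly W x = w x" "poly (pderiv W) x = a + b - 2 * x"
      by (simp_all add: W_def w_def algebra_simps pderiv_mult pderiv_pCons)
    have P: "poly (wbump_deriv \<epsilon> a b m p) x =
        poly (pderiv p) x * (w x)\<^sup>2 + poly p x * (\<epsilon> * (a + b - 2 * x) - real m * w x * (a + b - 2 * x))"
      unfolding wbump_deriv_def Let_def W_def[symmetric] poly_add poly_mult poly_power poly_diff poly_smult W
        of_nat_poly by simp
    show ?thesis unfolding P
      apply (rule derivative_eq_intros refl dw poly_DERIV w0)+
      using w0 apply simp
      using w0 apply (cases m)
       apply (simp_all add: field_simps power2_eq_square)
      done
  qed
  have "eventually (\<lambda>y. y \<in> {a<..<b}) (nhds x)"
    using True by (intro eventually_nhds_in_open) auto
  hence "eventually (\<lambda>y. wbump \<epsilon> a b m p y = poly p y * exp (- \<epsilon> / w y) / (w y) ^ m) (nhds x)"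
    by (rule eventually_mono) (auto simp: wbump_def w_def)
  hence "(wbump \<epsilon> a b m p has_real_derivative
      poly (wbump_deriv \<epsilon> a b m p) x * exp (- \<epsilon> / w x) / (w x) ^ (m + 2)) (at x)"
    using D by (subst DERIV_cong_ev[OF refl _ refl])
  thus ?thesis
    using True unfolding wbump_def[of _ _ _ "m + 2"] w_def by simp
next
  case False
  obtain C where C: "0 \<le> C" "\<And>x y. \<not> (a < x \<and> x < b) \<Longrightarrow> \<bar>wbump \<epsilon> a b m p y\<bar> \<le> C * (y - x)\<^sup>2"
    using wbump_quadratic_bound[OF assms] by blast
  have "((\<lambda>y. (wbump \<epsilon> a b m p y - wbump \<epsilon> a b m p x) / (y - x)) \<longlongrightarrow> 0) (at x)"
  proof (rule Lim_null_comparison)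
    show "\<forall>\<^sub>F y in at x. norm ((wbump \<epsilon> a b m p y - wbump \<epsilon> a b m p x) / (y - x)) \<le> C * \<bar>y - x\<bar>"
    proof (rule eventually_at_topological[THEN iffD2], intro exI[of _ UNIV] conjI ballI impI)
      fix y assume "y \<noteq> x"
      have "\<bar>wbump \<epsilon> a b m p y\<bar> \<le> C * \<bar>y - x\<bar> * \<bar>y - x\<bar>" using C(2)[OF False, of y]
        by (simp add: power2_eq_square abs_mult_self mult.assoc)
      thus "norm ((wbump \<epsilon> a b m p y - wbump \<epsilon> a b m p x) / (y - x)) \<le> C * \<bar>y - x\<bar>"
        using False \<open>y \<noteq> x\<close> by (auto simp: wbump_def[of _ _ _ _ _ x] abs_divide field_simps)
    qed auto
    have "((\<lambda>y. C * \<bar>y - x\<bar>) \<longlongrightarrow> C * \<bar>x - x\<bar>) (at x)" by (intro tendsto_intros)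
    thus "((\<lambda>y. C * \<bar>y - x\<bar>) \<longlongrightarrow> 0) (at x)" by simp
  qed
  thus ?thesis using False by (auto simp: has_field_derivative_iff wbump_def[of _ _ _ _ _ x])
qed

definition box_bump :: "real \<Rightarrow> real^'d \<Rightarrow> real^'d \<Rightarrow> ('d \<Rightarrow> nat) \<Rightarrow> ('d \<Rightarrow> real poly) \<Rightarrow> real^'d::finite \<Rightarrow> real"
  where "box_bump \<epsilon> a b m p x = (\<Prod>i\<in>UNIV. wbump \<epsilon> (a $ i) (b $ i) (m i) (p i) (x $ i))"

lemma has_derivative_box_bump:
  assumes "0 < \<epsilon>"
  shows "(box_bump \<epsilon> a b m p has_derivative (\<lambda>h. \<Sum>i\<in>UNIV.
     h $ i * box_bump \<epsilon> a b (m(i := m i + 2)) (p(i := wbump_deriv \<epsilon> (a $ i) (b $ i) (m i) (p i))) x)) (at x)"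
proof -
  have "((\<lambda>x. wbump \<epsilon> (a $ i) (b $ i) (m i) (p i) (x $ i)) has_derivative
      (\<lambda>h. h $ i * wbump \<epsilon> (a $ i) (b $ i) (m i + 2) (wbump_deriv \<epsilon> (a $ i) (b $ i) (m i) (p i)) (x $ i))) (at x)"
    for i
  proof -
    have "((\<lambda>x. x $ i) has_derivative (\<lambda>h. h $ i)) (at x)"
      by (rule bounded_linear_imp_has_derivative[OF bounded_linear_vec_nth])
    from has_derivative_compose[OF this has_real_derivative_wbump[OF assms, THEN has_field_derivative_imp_has_derivative]]
    show ?thesis by (simp add: mult.commute o_def)
  qed
  from has_derivative_prod[of UNIV, OF this]
  have D: "(box_bump \<epsilon> a b m p has_derivative (\<lambda>h. \<Sum>i\<in>UNIV.
      h $ i * wbump \<epsilon> (a $ i) (b $ i) (m i + 2) (wbump_deriv \<epsilon> (a $ i) (b $ i) (m i) (p i)) (x $ i) *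
      (\<Prod>j\<in>UNIV - {i}. wbump \<epsilon> (a $ j) (b $ j) (m j) (p j) (x $ j)))) (at x)"
    by (simp add: box_bump_def[abs_def])
  have "box_bump \<epsilon> a b (m(i := m i + 2)) (p(i := wbump_deriv \<epsilon> (a $ i) (b $ i) (m i) (p i))) x =
      wbump \<epsilon> (a $ i) (b $ i) (m i + 2) (wbump_deriv \<epsilon> (a $ i) (b $ i) (m i) (p i)) (x $ i) *
      (\<Prod>j\<in>UNIV - {i}. wbump \<epsilon> (a $ j) (b $ j) (m j) (p j) (x $ j))" for i
    unfolding box_bump_def by (subst prod.remove[of UNIV i]) (auto intro!: prod.cong)
  with D show ?thesis by (simp add: mult.assoc)
qed

lemma pderiv_at_box_bump:
  assumes "0 < \<epsilon>"
  shows "pderiv_at i (box_bump \<epsilon> a b m p) =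
    box_bump \<epsilon> a b (m(i := m i + 2)) (p(i := wbump_deriv \<epsilon> (a $ i) (b $ i) (m i) (p i)))"
proof
  fix x
  let ?D = "\<lambda>i. box_bump \<epsilon> a b (m(i := m i + 2)) (p(i := wbump_deriv \<epsilon> (a $ i) (b $ i) (m i) (p i))) x"
  have "frechet_derivative (box_bump \<epsilon> a b m p) (at x) = (\<lambda>h. \<Sum>i\<in>UNIV. h $ i * ?D i)"
    by (rule frechet_derivative_at[symmetric, OF has_derivative_box_bump[OF assms]])
  moreover have "axis i 1 $ j * ?D j = (if j = i then ?D j else 0)" for j
    by (simp add: axis_def)
  ultimately show "pderiv_at i (box_bump \<epsilon> a b m p) x = ?D i"
    unfolding pderiv_at_def by (simp only: sum.delta' finite_class.finite_UNIV UNIV_I if_True sum.delta)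
qed

text \<open>Partial differentiation only changes the exponent and the polynomial of one factor, so the family
  of products is closed under it.\<close>
lemma Ck_box_bump:
  assumes "0 < \<epsilon>"
  shows "Ck n (box_bump \<epsilon> a b m p)"
proof (induction n arbitrary: m p)
  case 0
  have "box_bump \<epsilon> a b m p differentiable (at x)" for x
    by (rule differentiableI[OF has_derivative_box_bump[OF assms]])
  thus ?case
    by (auto intro!: continuous_at_imp_continuous_on differentiable_imp_continuous_within)
next
  case (Suc n)
  thus ?case
    unfolding Ck.simps pderiv_at_box_bump[OF assms]
    using differentiableI[OF has_derivative_box_bump[OF assms]] by blast
qed

lemma box_bump_eq_0:
  assumes "x \<notin> box a b"
  shows "box_bump \<epsilon> a b m p x = 0"
  using assms by (auto simp: box_bump_def wbump_def mem_box_cart)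

lemma test_function_box_bump:
  assumes "0 < \<epsilon>" "cbox a b \<subseteq> U"
  shows "test_function U (box_bump \<epsilon> a b m p)"
  unfolding test_function_def
proof (intro conjI allI exI[of _ "cbox a b"] impI)
  show "Ck n (box_bump \<epsilon> a b m p)" for n by (rule Ck_box_bump[OF assms(1)])
  show "box_bump \<epsilon> a b m p x = 0" if "x \<notin> cbox a b" for x
    using that box_subset_cbox[of a b] by (intro box_bump_eq_0) auto
qed (use assms in auto)

section \<open>The fundamental lemma of the calculus of variations\<close>

text \<open>For \<open>\<epsilon> \<rightarrow> 0\<close>, the bumps \<open>exp (- \<epsilon> / w)\<close> converge boundedly to the indicator function of the box.\<close>
lemma integral_fun_box_eq_0:
  fixes f :: "real^'d::finite \<Rightarrow> real"
  assumes U: "U \<in> sets lebesgue" and f: "integrable (lebesgue_on U) f"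
    and orth: "\<And>\<phi>. test_function U \<phi> \<Longrightarrow> (LINT x|lebesgue_on U. f x * \<phi> x) = 0"
    and ab: "cbox a b \<subseteq> U"
  shows "(LINT x|lebesgue_on U. f x * indicator (box a b) x) = 0"
proof -
  let ?e = "\<lambda>n. inverse (real (Suc n))"
  let ?\<phi> = "\<lambda>n. box_bump (?e n) a b (\<lambda>_. 0) (\<lambda>_. 1)"
  have lim: "(\<lambda>n. ?\<phi> n x) \<longlonglongrightarrow> indicator (box a b) x" for x
  proof (cases "x \<in> box a b")
    case True
    have "(\<lambda>n. \<Prod>i\<in>UNIV. exp (- ?e n / ((x $ i - a $ i) * (b $ i - x $ i)))) \<longlonglongrightarrow>
        (\<Prod>i\<in>(UNIV::'d set). exp (- 0 / ((x $ i - a $ i) * (b $ i - x $ i))))"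
      using True by (intro tendsto_prod tendsto_intros LIMSEQ_inverse_real_of_nat)
        (auto simp: mem_box_cart less_imp_neq[symmetric] less_imp_neq)
    thus ?thesis using True by (simp add: box_bump_def wbump_def mem_box_cart)
  qed (simp add: box_bump_eq_0)
  have bound: "\<bar>?\<phi> n x\<bar> \<le> 1" for n x
  proof -
    have "\<bar>wbump (?e n) (a $ i) (b $ i) 0 1 (x $ i)\<bar> \<le> 1" for i
      by (auto simp: wbump_def divide_nonneg_nonneg)
    thus ?thesis unfolding box_bump_def abs_prod by (intro prod_le_1) auto
  qed
  have meas: "(\<lambda>x. ?\<phi> n x) \<in> borel_measurable (lebesgue_on U)" for n
  proof -
    have "continuous_on UNIV (?\<phi> n)" using Ck_box_bump[of "?e n" 0 a b] by simp
    hence "?\<phi> n \<in> borel_measurable borel" by (rule borel_measurable_continuous_onI)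
    thus ?thesis by (intro measurable_restrict_space1 measurable_completion) simp
  qed
  have ind: "indicat_real (box a b) \<in> borel_measurable (lebesgue_on U)"
    by (intro measurable_restrict_space1 borel_measurable_indicator) auto
  have "(\<lambda>n. LINT x|lebesgue_on U. f x * ?\<phi> n x) \<longlonglongrightarrow>
      (LINT x|lebesgue_on U. f x * indicator (box a b) x)"
  proof (rule integral_dominated_convergence)
    show "integrable (lebesgue_on U) (\<lambda>x. \<bar>f x\<bar>)" using f by simp
    show "(\<lambda>x. f x * indicator (box a b) x) \<in> borel_measurable (lebesgue_on U)"
      using borel_measurable_integrable[OF f] ind by (intro borel_measurable_times)
    show "(\<lambda>x. f x * ?\<phi> n x) \<in> borel_measurable (lebesgue_on U)" for n
      using f meas by (intro borel_measurable_times) auto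
    show "AE x in lebesgue_on U. (\<lambda>n. f x * ?\<phi> n x) \<longlonglongrightarrow> f x * indicator (box a b) x"
      by (intro AE_I2 tendsto_mult lim tendsto_const)
    show "AE x in lebesgue_on U. norm (f x * ?\<phi> n x) \<le> \<bar>f x\<bar>" for n
      using bound[of n] by (intro AE_I2) (auto simp: abs_mult intro!: mult_left_le)
  qed
  moreover have "(LINT x|lebesgue_on U. f x * ?\<phi> n x) = 0" for n
    by (intro orth test_function_box_bump ab) simp
  ultimately show ?thesis by (simp add: LIMSEQ_const_iff)
qed

text \<open>Extended by zero, \<open>f\<close> has vanishing integral over all small cubes at a given point of \<open>U\<close>. By the
  Lebesgue differentiation theorem, \<open>f\<close> is almost everywhere the limit of its averages over such
  cubes.\<close>
lemma fundamental_lemma_calculus_of_variations: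
  fixes f :: "real^'d::finite \<Rightarrow> real"
  assumes U: "open U" and f: "integrable (lebesgue_on U) f"
    and orth: "\<And>\<phi>. test_function U \<phi> \<Longrightarrow> (LINT x|lebesgue_on U. f x * \<phi> x) = 0"
  shows "AE x in lebesgue_on U. f x = 0"
proof -
  have Us: "U \<in> sets lebesgue" using U by auto
  define F where "F = (\<lambda>x. indicator U x *\<^sub>R f x)"
  have F: "integrable lebesgue F"
    using f Us by (simp add: integrable_restrict_space F_def)
  hence FI: "F integrable_on S" if "S \<in> sets lebesgue" for S
    using that integrable_mult_indicator[OF that F]
    by (intro integrable_on_lebesgue_on integrable_restrict_space[THEN iffD2]) auto
  have Fbox: "integral (cbox a b) F = 0" if ab: "cbox a b \<subseteq> U" for a b
  proof -
    have bU: "box a b \<subseteq> U" using ab box_subset_cbox[of a b] by blast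
    have "integral (cbox a b) F = integral (box a b) F"
      by (simp add: integral_open_interval)
    also have "\<dots> = (LINT x|lebesgue_on (box a b). F x)"
      using integrable_mult_indicator[OF _ F, of "box a b"]
      by (intro lebesgue_integral_eq_integral[symmetric] integrable_restrict_space[THEN iffD2]) auto
    also have "\<dots> = (LINT x|lebesgue. indicator (box a b) x *\<^sub>R F x)"
      by (intro integral_restrict_space) auto
    also have "\<dots> = (LINT x|lebesgue. indicator U x *\<^sub>R (f x * indicator (box a b) x))"
      using bU by (intro Bochner_Integration.integral_cong) (auto simp: F_def indicator_def)
    also have "\<dots> = (LINT x|lebesgue_on U. f x * indicator (box a b) x)"
      using Us by (intro integral_restrict_space[symmetric]) auto
    also have "\<dots> = 0" using integral_fun_box_eq_0[OF Us f orth ab] by simp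
    finally show ?thesis .
  qed
  \<comment> \<open>Lebesgue differentiation theorem for cubes with corner \<open>x\<close>\<close>
  obtain N where N: "negligible N" and NF: "\<And>x e. \<lbrakk>x \<notin> N; 0 < e\<rbrakk> \<Longrightarrow> \<exists>d>0. \<forall>h. 0 < h \<and> h < d \<longrightarrow>
      norm (integral (cbox x (x + h *\<^sub>R One)) F /\<^sub>R h ^ DIM(real^'d) - F x) < e"
    using integrable_ccontinuous_explicit[of F] FI by (metis lmeasurable_cbox fmeasurableD)
  have zero: "f x = 0" if x: "x \<in> U" "x \<notin> N" for x
  proof (rule ccontr)
    assume "f x \<noteq> 0"
    hence "0 < \<bar>F x\<bar>" using x by (simp add: F_def)
    from NF[OF x(2) this] obtain d where d: "0 < d" "\<And>h. 0 < h \<Longrightarrow> h < d \<Longrightarrow>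
      norm (integral (cbox x (x + h *\<^sub>R One)) F /\<^sub>R h ^ DIM(real^'d) - F x) < \<bar>F x\<bar>" by blast
    obtain r where r: "0 < r" "cball x r \<subseteq> U" using U x open_contains_cball by metis
    define K where "K = norm (One :: real^'d)"
    define h where "h = min (d / 2) (r / (K + 1))"
    have K: "0 \<le> K" by (simp add: K_def)
    have h: "0 < h" "h < d" using d r K by (auto simp: h_def)
    have "cbox x (x + h *\<^sub>R One) \<subseteq> cball x r"
    proof
      fix y assume y: "y \<in> cbox x (x + h *\<^sub>R One)"
      have "norm (y - x) \<le> norm (h *\<^sub>R One :: real^'d)"
        using y h by (intro norm_le_componentwise) (auto simp: mem_box inner_diff_left inner_add_left)
      also have "\<dots> = h * K" using h by (simp add: K_def)
      also have "\<dots> \<le> r / (K + 1) * (K + 1)" using h K r by (intro mult_mono) (auto simp: h_def)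
      finally show "y \<in> cball x r" using K by (simp add: dist_norm norm_minus_commute)
    qed
    with r have "integral (cbox x (x + h *\<^sub>R One)) F = 0" by (intro Fbox) auto
    thus False using d(2)[OF h] by simp
  qed
  have "N \<in> null_sets lebesgue" using N by (simp add: negligible_iff_null_sets)
  hence "AE x in lebesgue. x \<in> U \<longrightarrow> f x = 0"
    using zero by (intro AE_I'[of N]) auto
  thus ?thesis using Us by (simp add: AE_restrict_space_iff)
qed

section \<open>Semi-inner products on spaces of functions\<close>

text \<open>Functions that agree almost everywhere are not identified. Hence the \<open>H\<^sup>1\<close> inner product and the
  energy product are only semidefinite, and both are treated as instances of one notion.\<close>
locale semi_inner =
  fixes V :: "('x \<Rightarrow> real) set" and B :: "('x \<Rightarrow> real) \<Rightarrow> ('x \<Rightarrow> real) \<Rightarrow> real"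
  assumes zero_mem: "(\<lambda>x. 0) \<in> V"
    and comb_mem: "\<lbrakk>u \<in> V; v \<in> V\<rbrakk> \<Longrightarrow> (\<lambda>x. u x + c * v x) \<in> V"
    and comm: "\<lbrakk>u \<in> V; v \<in> V\<rbrakk> \<Longrightarrow> B u v = B v u"
    and lin: "\<lbrakk>u \<in> V; v \<in> V; w \<in> V\<rbrakk> \<Longrightarrow> B (\<lambda>x. u x + c * v x) w = B u w + c * B v w"
    and nonneg: "u \<in> V \<Longrightarrow> 0 \<le> B u u"
begin

lemma diff_mem: "\<lbrakk>u \<in> V; v \<in> V\<rbrakk> \<Longrightarrow> (\<lambda>x. u x - v x) \<in> V"
  using comb_mem[of u v "-1"] by simp

lemma lin_diff: "\<lbrakk>u \<in> V; v \<in> V; w \<in> V\<rbrakk> \<Longrightarrow> B (\<lambda>x. u x - v x) w = B u w - B v w"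
  using lin[of u v w "-1"] by simp

lemma square_comb:
  assumes "u \<in> V" "v \<in> V"
  shows "B (\<lambda>x. u x + c * v x) (\<lambda>x. u x + c * v x) = B u u + 2 * c * B u v + c\<^sup>2 * B v v"
proof -
  let ?w = "\<lambda>x. u x + c * v x"
  have w: "?w \<in> V" by (rule comb_mem[OF assms])
  have "B ?w ?w = B u ?w + c * B v ?w" by (rule lin[OF assms w])
  also have "B u ?w = B u u + c * B u v"
    using comm[OF assms(1) w] lin[OF assms assms(1)] comm[OF assms] by simp
  also have "B v ?w = B u v + c * B v v"
    using comm[OF assms(2) w] lin[OF assms assms(2)] by simp
  finally show ?thesis by (simp add: algebra_simps power2_eq_square)
qed

lemma square_diff:
  assumes "u \<in> V" "v \<in> V"
  shows "B (\<lambda>x. u x - v x) (\<lambda>x. u x - v x) = B u u - 2 * B u v + B v v"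
  using square_comb[OF assms, of "-1"] by simp

lemma Cauchy_Schwarz:
  assumes "u \<in> V" "v \<in> V"
  shows "\<bar>B u v\<bar> \<le> sqrt (B u u) * sqrt (B v v)"
proof -
  have pos: "0 \<le> B u u + 2 * c * B u v + c\<^sup>2 * B v v" for c
    using nonneg[OF comb_mem[OF assms, of c]] square_comb[OF assms, of c] by simp
  have "(B u v)\<^sup>2 \<le> B u u * B v v"
  proof (cases "B v v = 0")
    case True
    have "B u v = 0"
    proof (rule ccontr)
      assume "B u v \<noteq> 0"
      with pos[of "- (B u u + 1) / (2 * B u v)"] True show False by (simp add: field_simps)
    qed
    thus ?thesis using True by simp
  next
    case False
    hence v: "B v v > 0" using nonneg[OF assms(2)] by simp
    have "0 \<le> B v v * (B u u + 2 * (- B u v / B v v) * B u v + (- B u v / B v v)\<^sup>2 * B v v)"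
      by (intro mult_nonneg_nonneg pos less_imp_le[OF v])
    also have "\<dots> = B u u * B v v - (B u v)\<^sup>2"
      using v by (simp add: field_simps power2_eq_square)
    finally show ?thesis by simp
  qed
  thus ?thesis
    by (metis real_sqrt_le_mono real_sqrt_abs real_sqrt_mult)
qed

lemma norm_comb_le:
  fixes c :: real
  assumes "u \<in> V" "v \<in> V"
  defines "w \<equiv> \<lambda>x. u x + c * v x"
  shows "sqrt (B w w) \<le> sqrt (B u u) + \<bar>c\<bar> * sqrt (B v v)"
proof -
  have "c * B u v \<le> \<bar>c\<bar> * (sqrt (B u u) * sqrt (B v v))"
    using Cauchy_Schwarz[OF assms(1,2)]
    by (metis abs_ge_self abs_ge_zero abs_mult mult_left_mono order_trans)
  hence "B w w \<le> (sqrt (B u u) + \<bar>c\<bar> * sqrt (B v v))\<^sup>2"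
    using nonneg[OF assms(1)] nonneg[OF assms(2)] square_comb[OF assms(1,2), of c]
    unfolding w_def by (simp add: power2_sum power_mult_distrib mult_ac)
  thus ?thesis
    using nonneg[OF assms(1)] nonneg[OF assms(2)] by (intro real_le_lsqrt) auto
qed

lemma dist_self: "u \<in> V \<Longrightarrow> B (\<lambda>x. u x - u x) (\<lambda>x. u x - u x) = 0"
  using square_diff[of u u] by simp

lemma dist_comm:
  "\<lbrakk>u \<in> V; v \<in> V\<rbrakk> \<Longrightarrow> B (\<lambda>x. u x - v x) (\<lambda>x. u x - v x) = B (\<lambda>x. v x - u x) (\<lambda>x. v x - u x)"
  using square_diff[of u v] square_diff[of v u] comm[of u v] by simp

lemma dist_triangle:
  assumes "u \<in> V" "v \<in> V" "w \<in> V"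
  shows "sqrt (B (\<lambda>x. u x - w x) (\<lambda>x. u x - w x)) \<le>
    sqrt (B (\<lambda>x. u x - v x) (\<lambda>x. u x - v x)) + sqrt (B (\<lambda>x. v x - w x) (\<lambda>x. v x - w x))"
  using norm_comb_le[OF diff_mem[OF assms(1,2)] diff_mem[OF assms(2,3)], of 1] by simp

end

section \<open>Square-integrable functions\<close>

lemma L2_measurable: "L2 U f \<Longrightarrow> f \<in> borel_measurable (lebesgue_on U)"
  by (simp add: L2_def)

lemma L2_component:
  fixes f :: "real^'d::finite \<Rightarrow> real^'n::finite"
  assumes "L2 U f"
  shows "L2 U (\<lambda>x. f x $ i)"
  unfolding L2_def
proof
  show m: "(\<lambda>x. f x $ i) \<in> borel_measurable (lebesgue_on U)"
    by (rule borel_measurable_continuous_on[where f = "\<lambda>y. y $ i"])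
      (use L2_measurable[OF assms] in \<open>auto intro!: continuous_intros\<close>)
  show "integrable (lebesgue_on U) (\<lambda>x. (norm (f x $ i))\<^sup>2)"
  proof (rule Bochner_Integration.integrable_bound)
    show "integrable (lebesgue_on U) (\<lambda>x. (norm (f x))\<^sup>2)" using assms by (simp add: L2_def)
    have "(norm (f x $ i))\<^sup>2 \<le> (norm (f x))\<^sup>2" for x
      by (intro power_mono Finite_Cartesian_Product.norm_nth_le norm_ge_zero)
    thus "AE x in lebesgue_on U. norm ((norm (f x $ i))\<^sup>2) \<le> norm ((norm (f x))\<^sup>2)"
      by (intro AE_I2) simp
  qed (use m in measurable)
qed

lemma L2_comb:
  fixes f g :: "real^'d::finite \<Rightarrow> 'b::{second_countable_topology,real_normed_vector}"
  assumes "L2 U f" "L2 U g"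
  shows "L2 U (\<lambda>x. f x + c *\<^sub>R g x)"
  unfolding L2_def
proof
  have [measurable]: "f \<in> borel_measurable (lebesgue_on U)" "g \<in> borel_measurable (lebesgue_on U)"
    using assms by (simp_all add: L2_def)
  show [measurable]: "(\<lambda>x. f x + c *\<^sub>R g x) \<in> borel_measurable (lebesgue_on U)" by measurable
  show "integrable (lebesgue_on U) (\<lambda>x. (norm (f x + c *\<^sub>R g x))\<^sup>2)"
  proof (rule Bochner_Integration.integrable_bound)
    show "integrable (lebesgue_on U) (\<lambda>x. 2 * (norm (f x))\<^sup>2 + 2 * c\<^sup>2 * (norm (g x))\<^sup>2)"
      using assms by (simp add: L2_def)
    have "(norm (f x + c *\<^sub>R g x))\<^sup>2 \<le> 2 * (norm (f x))\<^sup>2 + 2 * c\<^sup>2 * (norm (g x))\<^sup>2" for x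
    proof -
      have "(norm (f x + c *\<^sub>R g x))\<^sup>2 \<le> (norm (f x) + \<bar>c\<bar> * norm (g x))\<^sup>2"
        using norm_triangle_ineq[of "f x" "c *\<^sub>R g x"] by (intro power_mono) auto
      also have "\<dots> \<le> 2 * (norm (f x))\<^sup>2 + 2 * (\<bar>c\<bar> * norm (g x))\<^sup>2"
        using sum_squares_bound[of "norm (f x)" "\<bar>c\<bar> * norm (g x)"] by (simp add: power2_sum)
      finally show ?thesis by (simp add: power_mult_distrib mult.assoc)
    qed
    thus "AE x in lebesgue_on U. norm ((norm (f x + c *\<^sub>R g x))\<^sup>2) \<le>
        norm (2 * (norm (f x))\<^sup>2 + 2 * c\<^sup>2 * (norm (g x))\<^sup>2)"
      by (intro AE_I2) auto
  qed measurable
qed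

lemma L2_mult_integrable:
  fixes f g :: "real^'d::finite \<Rightarrow> real"
  assumes "L2 U f" "L2 U g"
  shows "integrable (lebesgue_on U) (\<lambda>x. f x * g x)"
proof (rule Bochner_Integration.integrable_bound)
  have [measurable]: "f \<in> borel_measurable (lebesgue_on U)" "g \<in> borel_measurable (lebesgue_on U)"
    using assms by (simp_all add: L2_def)
  show "integrable (lebesgue_on U) (\<lambda>x. (norm (f x))\<^sup>2 + (norm (g x))\<^sup>2)"
    using assms by (simp add: L2_def)
  have "\<bar>f x * g x\<bar> \<le> (f x)\<^sup>2 + (g x)\<^sup>2" for x
  proof -
    have "2 * \<bar>f x\<bar> * \<bar>g x\<bar> \<le> (f x)\<^sup>2 + (g x)\<^sup>2"
      using sum_squares_bound[of "\<bar>f x\<bar>" "\<bar>g x\<bar>"] by simp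
    moreover have "0 \<le> \<bar>f x\<bar> * \<bar>g x\<bar>" by simp
    ultimately show ?thesis unfolding abs_mult by linarith
  qed
  thus "AE x in lebesgue_on U. norm (f x * g x) \<le> norm ((norm (f x))\<^sup>2 + (norm (g x))\<^sup>2)"
    by (intro AE_I2) auto
  show "(\<lambda>x. f x * g x) \<in> borel_measurable (lebesgue_on U)" by measurable
qed

lemma Linf_L2_mult:
  fixes f g :: "real^'d::finite \<Rightarrow> real"
  assumes "Linf U f" "L2 U g"
  shows "L2 U (\<lambda>x. f x * g x)"
  unfolding L2_def
proof
  have [measurable]: "f \<in> borel_measurable (lebesgue_on U)" "g \<in> borel_measurable (lebesgue_on U)"
    using assms by (simp_all add: L2_def Linf_def)
  show "(\<lambda>x. f x * g x) \<in> borel_measurable (lebesgue_on U)" by measurable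
  obtain C where C: "AE x in lebesgue_on U. norm (f x) \<le> C" using assms by (auto simp: Linf_def)
  show "integrable (lebesgue_on U) (\<lambda>x. (norm (f x * g x))\<^sup>2)"
  proof (rule Bochner_Integration.integrable_bound)
    show "integrable (lebesgue_on U) (\<lambda>x. C\<^sup>2 * (norm (g x))\<^sup>2)"
      using assms by (simp add: L2_def)
    show "AE x in lebesgue_on U. norm ((norm (f x * g x))\<^sup>2) \<le> norm (C\<^sup>2 * (norm (g x))\<^sup>2)"
      using C
    proof eventually_elim
      case (elim x)
      have "(norm (f x) * norm (g x))\<^sup>2 \<le> (C * norm (g x))\<^sup>2"
        using elim by (intro power_mono mult_right_mono) auto
      thus ?case by (simp add: power_mult_distrib norm_mult)
    qed
  qed measurable
qed

lemma Linf_component: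
  fixes f :: "real^'d::finite \<Rightarrow> 'b::euclidean_space^'n::finite"
  assumes "Linf U f"
  shows "Linf U (\<lambda>x. f x $ i)"
proof -
  obtain C where C: "AE x in lebesgue_on U. norm (f x) \<le> C" using assms by (auto simp: Linf_def)
  have "AE x in lebesgue_on U. norm (f x $ i) \<le> C"
    using C by eventually_elim (rule order_trans[OF Finite_Cartesian_Product.norm_nth_le])
  moreover have "(\<lambda>x. f x $ i) \<in> borel_measurable (lebesgue_on U)"
    by (rule borel_measurable_continuous_on[where f = "\<lambda>y. y $ i"])
      (use assms in \<open>auto simp: Linf_def intro!: continuous_intros\<close>)
  ultimately show ?thesis by (auto simp: Linf_def)
qed

lemma L2_sum:
  fixes f :: "'i \<Rightarrow> real^'d::finite \<Rightarrow> real"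
  assumes "\<And>i. i \<in> I \<Longrightarrow> L2 U (f i)" "finite I"
  shows "L2 U (\<lambda>x. \<Sum>i\<in>I. f i x)"
  using assms(2,1)
proof (induction I)
  case empty
  thus ?case by (simp add: L2_def)
next
  case (insert i I)
  thus ?case using L2_comb[of U "f i" "\<lambda>x. \<Sum>i\<in>I. f i x" 1] by simp
qed

lemma L2_inner_integrable:
  fixes f g :: "real^'d::finite \<Rightarrow> real^'n::finite"
  assumes "L2 U f" "L2 U g"
  shows "integrable (lebesgue_on U) (\<lambda>x. f x \<bullet> g x)"
  unfolding inner_vec_def inner_real_def
  by (intro Bochner_Integration.integrable_sum L2_mult_integrable L2_component assms)

lemma L2_continuous:
  fixes f :: "real^'d::finite \<Rightarrow> 'b::{second_countable_topology,real_normed_vector}"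
  assumes "open U" "bounded U" "continuous_on UNIV f"
  shows "L2 U f"
  unfolding L2_def
proof
  have "f \<in> borel_measurable borel" using assms(3) by (rule borel_measurable_continuous_onI)
  thus [measurable]: "f \<in> borel_measurable (lebesgue_on U)"
    by (intro measurable_restrict_space1 measurable_completion) simp
  have "compact (closure U)" using assms(2) by simp
  hence "bounded (f ` closure U)"
    by (intro compact_imp_bounded compact_continuous_image continuous_on_subset[OF assms(3)]) auto
  then obtain C where C: "\<And>x. x \<in> closure U \<Longrightarrow> norm (f x) \<le> C"
    unfolding bounded_iff by (metis imageI)
  have "U \<in> lmeasurable" using assms by (simp add: lmeasurable_open)
  then interpret finite_measure "lebesgue_on U" by (rule finite_measure_lebesgue_on)
  show "integrable (lebesgue_on U) (\<lambda>x. (norm (f x))\<^sup>2)"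
  proof (rule integrable_const_bound)
    show "AE x in lebesgue_on U. norm ((norm (f x))\<^sup>2) \<le> C\<^sup>2"
      using C closure_subset by (intro AE_I2) (auto intro!: power_mono)
  qed measurable
qed

section \<open>Test functions and integration by parts\<close>

lemma Ck_differentiable: "Ck (Suc n) \<phi> \<Longrightarrow> \<phi> differentiable (at x)"
  by simp

lemma Ck_comb: "\<lbrakk>Ck n \<phi>; Ck n \<psi>\<rbrakk> \<Longrightarrow> Ck n (\<lambda>x. \<phi> x + c * \<psi> x)"
proof (induction n arbitrary: \<phi> \<psi>)
  case 0
  thus ?case by (auto intro!: continuous_intros)
next
  case (Suc n)
  have "pderiv_at i (\<lambda>x. \<phi> x + c * \<psi> x) = (\<lambda>x. pderiv_at i \<phi> x + c * pderiv_at i \<psi> x)" for i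
  proof
    fix x
    have "((\<lambda>x. \<phi> x + c * \<psi> x) has_derivative
      (\<lambda>h. frechet_derivative \<phi> (at x) h + c * frechet_derivative \<psi> (at x) h)) (at x)"
      using Suc.prems by (intro derivative_intros frechet_derivative_works[THEN iffD1]) auto
    thus "pderiv_at i (\<lambda>x. \<phi> x + c * \<psi> x) x = pderiv_at i \<phi> x + c * pderiv_at i \<psi> x"
      unfolding pderiv_at_def by (subst frechet_derivative_at[symmetric]) auto
  qed
  thus ?case using Suc by (simp add: differentiable_add differentiable_mult)
qed

lemma test_function_comb:
  assumes "test_function U \<phi>" "test_function U \<psi>"
  shows "test_function U (\<lambda>x. \<phi> x + c * \<psi> x)"
proof -
  obtain K where K: "compact K" "K \<subseteq> U" "\<And>x. x \<notin> K \<Longrightarrow> \<phi> x = 0"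
    using assms by (auto simp: test_function_def)
  obtain K' where K': "compact K'" "K' \<subseteq> U" "\<And>x. x \<notin> K' \<Longrightarrow> \<psi> x = 0"
    using assms by (auto simp: test_function_def)
  show ?thesis unfolding test_function_def
  proof (intro conjI allI exI[of _ "K \<union> K'"])
    show "Ck n (\<lambda>x. \<phi> x + c * \<psi> x)" for n
      using assms by (intro Ck_comb) (auto simp: test_function_def)
  qed (use K K' in \<open>auto intro: compact_Un\<close>)
qed

lemma test_function_differentiable: "test_function U \<phi> \<Longrightarrow> \<phi> differentiable (at x)"
  using Ck_differentiable[of 0 \<phi>] by (simp add: test_function_def)

lemma test_function_continuous:
  assumes "test_function U \<phi>"
  shows "continuous_on UNIV \<phi>" "continuous_on UNIV (pderiv_at i \<phi>)"
proof -
  have "Ck 0 \<phi>" "Ck (Suc 0) \<phi>" using assms by (auto simp: test_function_def)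
  thus "continuous_on UNIV \<phi>" "continuous_on UNIV (pderiv_at i \<phi>)" by simp_all
qed

lemma integral_lborel_translate:
  fixes f :: "real^'d::finite \<Rightarrow> real"
  assumes "f \<in> borel_measurable borel"
  shows "(LINT x|lborel. f (x + c)) = (LINT x|lborel. f x)"
proof -
  have "(LINT x|lborel. f x) = (LINT x|distr lborel borel (\<lambda>x. c + x). f x)"
    by (simp add: lborel_distr_plus)
  also have "\<dots> = (LINT x|lborel. f (c + x))"
    using assms by (intro integral_distr) auto
  finally show ?thesis by (simp add: add.commute)
qed

lemma integrable_lborel_translate:
  fixes f :: "real^'d::finite \<Rightarrow> real"
  assumes "integrable lborel f"
  shows "integrable lborel (\<lambda>x. f (x + c))"
proof -
  have m: "f \<in> borel_measurable borel" using borel_measurable_integrable[OF assms] by simp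
  have "integrable (distr lborel borel (\<lambda>x. c + x)) f" using assms by (simp add: lborel_distr_plus)
  hence "integrable lborel (\<lambda>x. f (c + x))" using m by (subst (asm) integrable_distr_eq) auto
  thus ?thesis by (simp add: add.commute)
qed

lemma integrable_continuous_compact_support:
  fixes f :: "real^'d::finite \<Rightarrow> real"
  assumes "continuous_on UNIV f" "compact K" "\<And>x. x \<notin> K \<Longrightarrow> f x = 0"
  shows "integrable lborel f"
proof -
  have "integrable lborel (\<lambda>x. indicator K x *\<^sub>R f x)"
    using assms by (intro borel_integrable_compact) (auto intro: continuous_on_subset)
  also have "(\<lambda>x. indicator K x *\<^sub>R f x) = f"
    using assms(3) by (fastforce simp: indicator_def)
  finally show ?thesis .
qed

lemma pderiv_at_line:
  assumes "\<phi> differentiable (at (x + t *\<^sub>R axis i 1))"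
  shows "((\<lambda>t. \<phi> (x + t *\<^sub>R axis i 1)) has_real_derivative pderiv_at i \<phi> (x + t *\<^sub>R axis i 1)) (at t)"
proof -
  let ?D = "frechet_derivative \<phi> (at (x + t *\<^sub>R axis i 1))"
  have D: "(\<phi> has_derivative ?D) (at (x + t *\<^sub>R axis i 1))"
    using assms by (rule frechet_derivative_works[THEN iffD1])
  have "((\<lambda>t. x + t *\<^sub>R axis i 1) has_derivative (\<lambda>h. h *\<^sub>R axis i 1)) (at t)"
    by (auto intro!: derivative_eq_intros)
  from has_derivative_compose[OF this D]
  have "((\<lambda>t. \<phi> (x + t *\<^sub>R axis i 1)) has_derivative (\<lambda>h. ?D (h *\<^sub>R axis i 1))) (at t)" .
  moreover have "?D (h *\<^sub>R axis i 1) = h * ?D (axis i 1)" for h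
    using has_derivative_linear[OF D] by (simp add: linear_cmul)
  ultimately show ?thesis
    by (simp add: has_field_derivative_def pderiv_at_def mult.commute[of _ "?D (axis i 1)"])
qed

text \<open>By translation invariance, the difference quotients of \<open>f\<close> have integral zero. They converge
  pointwise to the partial derivative and are bounded, by the mean value theorem, on a fixed ball
  outside of which they vanish.\<close>
lemma integral_pderiv_at_eq_0:
  fixes f :: "real^'d::finite \<Rightarrow> real"
  assumes d: "\<And>x. f differentiable (at x)" and c: "continuous_on UNIV (pderiv_at i f)"
    and K: "compact K" "\<And>x. x \<notin> K \<Longrightarrow> f x = 0"
  shows "(LINT x|lborel. pderiv_at i f x) = 0"
proof -
  let ?e = "axis i 1 :: real^'d"
  let ?h = "\<lambda>n. inverse (real (Suc n))"
  let ?D = "\<lambda>n x. (f (x + ?h n *\<^sub>R ?e) - f x) / ?h n"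
  have fc: "continuous_on UNIV f"
    using d by (auto intro!: continuous_at_imp_continuous_on differentiable_imp_continuous_within)
  have fi: "integrable lborel f" by (rule integrable_continuous_compact_support[OF fc K])
  have fm[measurable]: "f \<in> borel_measurable borel" using fc by (rule borel_measurable_continuous_onI)
  have gm[measurable]: "pderiv_at i f \<in> borel_measurable borel" using c by (rule borel_measurable_continuous_onI)
  have zero: "(LINT x|lborel. ?D n x) = 0" for n
    using fi integrable_lborel_translate[OF fi] integral_lborel_translate[OF fm] by simp
  obtain r where r: "K \<subseteq> cball 0 r" using compact_imp_bounded[OF K(1)] unfolding bounded_iff by (auto simp: subset_iff)
  have "bounded (pderiv_at i f ` cball 0 (r + 2))"
    by (intro compact_imp_bounded compact_continuous_image continuous_on_subset[OF c]) auto
  then obtain C where C: "\<And>x. x \<in> cball 0 (r + 2) \<Longrightarrow> norm (pderiv_at i f x) \<le> C"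
    unfolding bounded_iff by (metis imageI)
  have h: "0 < ?h n" "?h n \<le> 1" for n by (auto simp: inverse_le_1_iff)
  have bound: "norm (?D n x) \<le> indicator (cball 0 (r + 1)) x *\<^sub>R C" for n x
  proof (cases "x \<in> cball 0 (r + 1)")
    case True
    have "\<exists>t. 0 < t \<and> t < ?h n \<and> f (x + ?h n *\<^sub>R ?e) - f (x + 0 *\<^sub>R ?e) =
        (?h n - 0) * pderiv_at i f (x + t *\<^sub>R ?e)"
      using h[of n] d by (intro MVT2 pderiv_at_line) auto
    then obtain t where t: "0 < t" "t < ?h n"
      "f (x + ?h n *\<^sub>R ?e) - f (x + 0 *\<^sub>R ?e) = (?h n - 0) * pderiv_at i f (x + t *\<^sub>R ?e)" by blast
    have "norm (x + t *\<^sub>R ?e) \<le> norm x + \<bar>t\<bar>"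
      using norm_triangle_ineq[of x "t *\<^sub>R ?e"] by (simp add: norm_axis_1)
    hence "x + t *\<^sub>R ?e \<in> cball 0 (r + 2)" using True t h[of n] by simp
    from C[OF this] True t(3) h[of n] show ?thesis by simp
  next
    case False
    have "norm x \<le> norm (x + ?h n *\<^sub>R ?e) + \<bar>?h n\<bar>"
      using norm_triangle_ineq4[of "x + ?h n *\<^sub>R ?e" "?h n *\<^sub>R ?e"] by (simp add: norm_axis_1 del: inverse_eq_divide)
    hence "norm (x + ?h n *\<^sub>R ?e) > r" using False h[of n] by auto
    hence "x + ?h n *\<^sub>R ?e \<notin> K" using r by auto
    moreover have "x \<notin> K" using False r by auto
    ultimately show ?thesis using K(2) False by simp
  qed
  have "(\<lambda>n. LINT x|lborel. ?D n x) \<longlonglongrightarrow> (LINT x|lborel. pderiv_at i f x)"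
  proof (rule integral_dominated_convergence)
    show "integrable lborel (\<lambda>x. indicator (cball (0::real^'d) (r + 1)) x *\<^sub>R C)"
      by (intro borel_integrable_compact) auto
    show "AE x in lborel. (\<lambda>n. ?D n x) \<longlonglongrightarrow> pderiv_at i f x"
    proof (rule AE_I2)
      fix x
      have "((\<lambda>t. f (x + t *\<^sub>R ?e)) has_real_derivative pderiv_at i f (x + 0 *\<^sub>R ?e)) (at 0)"
        using d by (intro pderiv_at_line)
      hence "((\<lambda>h. (f (x + h *\<^sub>R ?e) - f x) / h) \<longlongrightarrow> pderiv_at i f x) (at 0)"
        by (simp add: DERIV_def)
      moreover have "filterlim ?h (at 0) sequentially"
        unfolding filterlim_at using LIMSEQ_inverse_real_of_nat by (simp add: eventually_sequentially)
      ultimately show "(\<lambda>n. ?D n x) \<longlonglongrightarrow> pderiv_at i f x"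
        by (rule filterlim_compose)
    qed
    show "AE x in lborel. norm (?D n x) \<le> indicator (cball 0 (r + 1)) x *\<^sub>R C" for n
      by (intro AE_I2 bound)
  qed measurable
  thus ?thesis unfolding zero by (simp add: LIMSEQ_const_iff)
qed

lemma pderiv_at_mult:
  assumes "\<phi> differentiable (at x)" "\<psi> differentiable (at x)"
  shows "pderiv_at i (\<lambda>x. \<phi> x * \<psi> x) x = \<phi> x * pderiv_at i \<psi> x + pderiv_at i \<phi> x * \<psi> x"
proof -
  have "((\<lambda>x. \<phi> x * \<psi> x) has_derivative (\<lambda>h. \<phi> x * frechet_derivative \<psi> (at x) h +
      frechet_derivative \<phi> (at x) h * \<psi> x)) (at x)"
    using assms by (intro derivative_intros frechet_derivative_works[THEN iffD1])
  thus ?thesis unfolding pderiv_at_def by (subst frechet_derivative_at[symmetric]) auto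
qed

lemma integral_by_parts_test_functions:
  assumes \<phi>: "test_function U \<phi>" and \<psi>: "test_function U \<psi>"
  shows "(LINT x|lborel. \<phi> x * pderiv_at i \<psi> x) = - (LINT x|lborel. pderiv_at i \<phi> x * \<psi> x)"
proof -
  obtain K where K: "compact K" "\<And>x. x \<notin> K \<Longrightarrow> \<phi> x = 0"
    using \<phi> by (auto simp: test_function_def)
  obtain K' where K': "compact K'" "\<And>x. x \<notin> K' \<Longrightarrow> \<psi> x = 0"
    using \<psi> by (auto simp: test_function_def)
  note cont = test_function_continuous[OF \<phi>] test_function_continuous[OF \<psi>]
  note d = test_function_differentiable[OF \<phi>] test_function_differentiable[OF \<psi>]
  have P: "pderiv_at i (\<lambda>x. \<phi> x * \<psi> x) = (\<lambda>x. \<phi> x * pderiv_at i \<psi> x + pderiv_at i \<phi> x * \<psi> x)"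
    by (intro ext pderiv_at_mult d)
  have i1: "integrable lborel (\<lambda>x. \<phi> x * pderiv_at i \<psi> x)"
    using K by (intro integrable_continuous_compact_support[of _ K] continuous_intros cont) auto
  have i2: "integrable lborel (\<lambda>x. pderiv_at i \<phi> x * \<psi> x)"
    using K' by (intro integrable_continuous_compact_support[of _ K'] continuous_intros cont) auto
  have "(LINT x|lborel. pderiv_at i (\<lambda>x. \<phi> x * \<psi> x) x) = 0"
  proof (rule integral_pderiv_at_eq_0)
    show "(\<lambda>x. \<phi> x * \<psi> x) differentiable (at x)" for x
      using d by (intro differentiable_mult)
    show "continuous_on UNIV (pderiv_at i (\<lambda>x. \<phi> x * \<psi> x))"
      unfolding P by (intro continuous_intros cont)
  qed (use K in auto)
  thus ?thesis unfolding P using i1 i2 by simp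
qed

lemma lebesgue_on_integral_eq_lborel:
  fixes f :: "real^'d::finite \<Rightarrow> real"
  assumes "U \<in> sets lebesgue" "continuous_on UNIV f" "\<And>x. x \<notin> U \<Longrightarrow> f x = 0"
  shows "(LINT x|lebesgue_on U. f x) = (LINT x|lborel. f x)"
proof -
  have "(LINT x|lebesgue_on U. f x) = (LINT x|lebesgue. indicator U x *\<^sub>R f x)"
    using assms by (intro integral_restrict_space) auto
  also have "(\<lambda>x. indicator U x *\<^sub>R f x) = f"
    using assms(3) by (fastforce simp: indicator_def)
  also have "(LINT x|lebesgue. f x) = (LINT x|lborel. f x)"
    using borel_measurable_continuous_onI[OF assms(2)] by (intro integral_completion) simp
  finally show ?thesis .
qed

section \<open>The Sobolev spaces of a bounded domain\<close>

locale bounded_domain =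
  fixes U :: "(real^'d::finite) set"
  assumes open_dom: "open U" and bounded_dom: "bounded U"
begin

lemma dom_sets: "U \<in> sets lebesgue"
  using open_dom by auto

lemma L2_test_function:
  assumes "test_function U \<phi>"
  shows "L2 U \<phi>" "L2 U (pderiv_at i \<phi>)"
  using test_function_continuous[OF assms] by (auto intro: L2_continuous[OF open_dom bounded_dom])

text \<open>This ensures that \<open>wgrad U (\<phi> - u)\<close>, which enters the definition of \<open>H\<^sup>1\<^sub>0\<close>, is a genuine weak gradient
  whenever \<open>u\<close> belongs to \<open>H\<^sup>1\<close>.\<close>
lemma test_function_in_H1:
  assumes \<phi>: "test_function U \<phi>"
  shows "\<phi> \<in> H1 U"
proof -
  have "L2 U (\<lambda>x. \<chi> i. pderiv_at i \<phi> x)"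
    by (intro L2_continuous[OF open_dom bounded_dom] continuous_on_vec_lambda
        test_function_continuous[OF \<phi>])
  moreover have "has_weak_grad U \<phi> (\<lambda>x. \<chi> i. pderiv_at i \<phi> x)"
    unfolding has_weak_grad_def vec_lambda_beta
  proof (intro allI impI)
    fix \<psi> i assume \<psi>: "test_function U \<psi>"
    have z: "\<phi> x = 0" "\<psi> x = 0" if "x \<notin> U" for x
      using \<phi> \<psi> that by (auto simp: test_function_def)
    have "(LINT x|lebesgue_on U. \<phi> x * pderiv_at i \<psi> x) = (LINT x|lborel. \<phi> x * pderiv_at i \<psi> x)"
      by (intro lebesgue_on_integral_eq_lborel dom_sets continuous_intros
          test_function_continuous[OF \<phi>] test_function_continuous[OF \<psi>]) (simp add: z)
    also have "\<dots> = - (LINT x|lborel. pderiv_at i \<phi> x * \<psi> x)"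
      by (rule integral_by_parts_test_functions[OF \<phi> \<psi>])
    also have "(LINT x|lborel. pderiv_at i \<phi> x * \<psi> x) = (LINT x|lebesgue_on U. pderiv_at i \<phi> x * \<psi> x)"
      by (intro lebesgue_on_integral_eq_lborel[symmetric] dom_sets continuous_intros
          test_function_continuous[OF \<phi>] test_function_continuous[OF \<psi>]) (simp add: z)
    finally show "(LINT x|lebesgue_on U. \<phi> x * pderiv_at i \<psi> x) =
      - (LINT x|lebesgue_on U. pderiv_at i \<phi> x * \<psi> x)" .
  qed
  ultimately show ?thesis using L2_test_function[OF \<phi>] by (auto simp: H1_def)
qed

lemma L2_imp_integrable:
  fixes f :: "real^'d \<Rightarrow> real"
  assumes "L2 U f"
  shows "integrable (lebesgue_on U) f"
  using L2_mult_integrable[OF assms, of "\<lambda>_. 1"] L2_continuous[OF open_dom bounded_dom, of "\<lambda>_. 1::real"]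
  by simp

lemma weak_grad_unique:
  assumes "L2 U g" "L2 U g'" "has_weak_grad U u g" "has_weak_grad U u g'"
  shows "AE x in lebesgue_on U. g x = g' x"
proof -
  have "AE x in lebesgue_on U. g x $ i - g' x $ i = 0" for i
  proof (rule fundamental_lemma_calculus_of_variations[OF open_dom])
    have L: "L2 U (\<lambda>x. g x $ i)" "L2 U (\<lambda>x. g' x $ i)"
      using assms by (auto intro: L2_component)
    thus "integrable (lebesgue_on U) (\<lambda>x. g x $ i - g' x $ i)"
      by (intro Bochner_Integration.integrable_diff L2_imp_integrable)
    fix \<phi> assume \<phi>: "test_function U \<phi>"
    show "(LINT x|lebesgue_on U. (g x $ i - g' x $ i) * \<phi> x) = 0"
      using assms(3,4) \<phi> L2_mult_integrable[OF L(1) L2_test_function(1)[OF \<phi>]]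
        L2_mult_integrable[OF L(2) L2_test_function(1)[OF \<phi>]]
      unfolding has_weak_grad_def left_diff_distrib by simp
  qed
  hence "AE x in lebesgue_on U. \<forall>i. g x $ i - g' x $ i = 0"
    by (simp add: AE_all_countable)
  thus ?thesis by eventually_elim (simp add: vec_eq_iff)
qed

lemma has_weak_grad_comb:
  assumes "L2 U u" "L2 U v" "L2 U g" "L2 U g'" "has_weak_grad U u g" "has_weak_grad U v g'"
  shows "has_weak_grad U (\<lambda>x. u x + c * v x) (\<lambda>x. g x + c *\<^sub>R g' x)"
  unfolding has_weak_grad_def
proof (intro allI impI)
  fix \<phi> i assume \<phi>: "test_function U \<phi>"
  note i = L2_mult_integrable[OF assms(1) L2_test_function(2)[OF \<phi>, of i]]
     L2_mult_integrable[OF assms(2) L2_test_function(2)[OF \<phi>, of i]]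
     L2_mult_integrable[OF L2_component[OF assms(3)] L2_test_function(1)[OF \<phi>], of i]
     L2_mult_integrable[OF L2_component[OF assms(4)] L2_test_function(1)[OF \<phi>], of i]
  show "(LINT x|lebesgue_on U. (u x + c * v x) * pderiv_at i \<phi> x) =
      - (LINT x|lebesgue_on U. (g x + c *\<^sub>R g' x) $ i * \<phi> x)"
    using assms(5,6) \<phi> i unfolding has_weak_grad_def by (simp add: distrib_right mult.assoc)
qed

lemma H1_L2: "u \<in> H1 U \<Longrightarrow> L2 U u"
  by (simp add: H1_def)

lemma wgrad_works:
  assumes "u \<in> H1 U"
  shows "L2 U (wgrad U u)" "has_weak_grad U u (wgrad U u)"
proof -
  have "\<exists>g. L2 U g \<and> has_weak_grad U u g" using assms by (simp add: H1_def)
  from someI_ex[OF this] show "L2 U (wgrad U u)" "has_weak_grad U u (wgrad U u)"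
    by (auto simp: wgrad_def)
qed

lemma L2_comb_real: "\<lbrakk>L2 U u; L2 U v\<rbrakk> \<Longrightarrow> L2 U (\<lambda>x. u x + c * (v x :: real))"
  using L2_comb[of U u v c] by simp

lemma H1_comb:
  assumes "u \<in> H1 U" "v \<in> H1 U"
  shows "(\<lambda>x. u x + c * v x) \<in> H1 U"
    and "AE x in lebesgue_on U. wgrad U (\<lambda>x. u x + c * v x) x = wgrad U u x + c *\<^sub>R wgrad U v x"
proof -
  note w = wgrad_works[OF assms(1)] wgrad_works[OF assms(2)]
  have h: "has_weak_grad U (\<lambda>x. u x + c * v x) (\<lambda>x. wgrad U u x + c *\<^sub>R wgrad U v x)"
    by (intro has_weak_grad_comb H1_L2 assms w)
  have l: "L2 U (\<lambda>x. wgrad U u x + c *\<^sub>R wgrad U v x)"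
    by (intro L2_comb w)
  show m: "(\<lambda>x. u x + c * v x) \<in> H1 U"
    using h l L2_comb_real[OF H1_L2[OF assms(1)] H1_L2[OF assms(2)]] by (auto simp: H1_def)
  show "AE x in lebesgue_on U. wgrad U (\<lambda>x. u x + c * v x) x = wgrad U u x + c *\<^sub>R wgrad U v x"
    by (intro weak_grad_unique[OF _ l _ h] wgrad_works m)
qed

lemma zero_test_function: "test_function U (\<lambda>x. 0)"
proof -
  have "pderiv_at i (\<lambda>x::real^'d. 0::real) = (\<lambda>x. 0)" for i
    by (auto simp: pderiv_at_def fun_eq_iff)
  hence "Ck n (\<lambda>x::real^'d. 0)" for n by (induction n) auto
  thus ?thesis by (auto simp: test_function_def intro!: exI[of _ "{}"])
qed

text \<open>Linearity of the second-order part of the bilinear forms in its first argument. With the identity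
  matrix it also covers the \<open>H\<^sup>1\<close> inner product.\<close>
lemma grad_form_comb:
  assumes u: "u \<in> H1 U" "v \<in> H1 U" and A: "Linf U (A :: real^'d \<Rightarrow> real^'d^'d)" and g: "L2 U g"
  shows "integrable (lebesgue_on U) (\<lambda>x. (A x *v wgrad U u x) \<bullet> g x)"
    and "(LINT x|lebesgue_on U. (A x *v wgrad U (\<lambda>x. u x + c * v x) x) \<bullet> g x) =
      (LINT x|lebesgue_on U. (A x *v wgrad U u x) \<bullet> g x) +
      c * (LINT x|lebesgue_on U. (A x *v wgrad U v x) \<bullet> g x)"
proof -
  have i: "integrable (lebesgue_on U) (\<lambda>x. (A x *v w x) \<bullet> g x)" if "L2 U w" for w
  proof -
    have eq: "(\<lambda>x. (A x *v w x) \<bullet> g x) = (\<lambda>x. \<Sum>i\<in>UNIV. (\<Sum>j\<in>UNIV. A x $ i $ j * w x $ j) * g x $ i)"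
      by (simp add: inner_vec_def matrix_vector_mult_def)
    show ?thesis unfolding eq
      by (intro Bochner_Integration.integrable_sum L2_mult_integrable L2_sum Linf_L2_mult
          Linf_component L2_component that g A) auto
  qed
  note w = wgrad_works(1)[OF u(1)] wgrad_works(1)[OF u(2)] wgrad_works(1)[OF H1_comb(1)[OF u, of c]]
  show "integrable (lebesgue_on U) (\<lambda>x. (A x *v wgrad U u x) \<bullet> g x)" by (rule i[OF w(1)])
  have "(LINT x|lebesgue_on U. (A x *v wgrad U (\<lambda>x. u x + c * v x) x) \<bullet> g x) =
    (LINT x|lebesgue_on U. (A x *v wgrad U u x) \<bullet> g x + c * ((A x *v wgrad U v x) \<bullet> g x))"
  proof (rule integral_cong_AE)
    show "AE x in lebesgue_on U. (A x *v wgrad U (\<lambda>x. u x + c * v x) x) \<bullet> g x =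
        (A x *v wgrad U u x) \<bullet> g x + c * ((A x *v wgrad U v x) \<bullet> g x)"
      using H1_comb(2)[OF u, of c]
      by eventually_elim (simp add: matrix_vector_right_distrib inner_add_left matrix_vector_mult_scaleR)
  qed (use i[OF w(1)] i[OF w(2)] i[OF w(3)] in auto)
  thus "(LINT x|lebesgue_on U. (A x *v wgrad U (\<lambda>x. u x + c * v x) x) \<bullet> g x) =
      (LINT x|lebesgue_on U. (A x *v wgrad U u x) \<bullet> g x) +
      c * (LINT x|lebesgue_on U. (A x *v wgrad U v x) \<bullet> g x)"
    using i[OF w(1)] i[OF w(2)] by simp
qed

definition H1_inner :: "(real^'d \<Rightarrow> real) \<Rightarrow> (real^'d \<Rightarrow> real) \<Rightarrow> real" where
  "H1_inner u v = (LINT x|lebesgue_on U. u x * v x) + (LINT x|lebesgue_on U. wgrad U u x \<bullet> wgrad U v x)"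

lemma H1_norm_eq: "H1_norm U u = sqrt (H1_inner u u)"
  by (simp add: H1_norm_def H1_inner_def power2_eq_square flip: power2_norm_eq_inner)

sublocale H1: semi_inner "H1 U" H1_inner
proof
  show "(\<lambda>x. 0) \<in> H1 U" by (intro test_function_in_H1 zero_test_function)
  fix u v w c assume u: "u \<in> H1 U"
  have "0 \<le> (LINT x|lebesgue_on U. u x * u x)" "0 \<le> (LINT x|lebesgue_on U. wgrad U u x \<bullet> wgrad U u x)"
    by (auto intro!: integral_nonneg_AE)
  thus "0 \<le> H1_inner u u" by (simp add: H1_inner_def)
  assume v: "v \<in> H1 U"
  show "(\<lambda>x. u x + c * v x) \<in> H1 U" by (rule H1_comb[OF u v])
  show "H1_inner u v = H1_inner v u"
    by (simp add: H1_inner_def mult.commute inner_commute)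
  assume w: "w \<in> H1 U"
  have I: "Linf U (\<lambda>_. mat 1 :: real^'d^'d)" by (auto simp: Linf_def)
  have "(LINT x|lebesgue_on U. (u x + c * v x) * w x) =
      (LINT x|lebesgue_on U. u x * w x) + c * (LINT x|lebesgue_on U. v x * w x)"
    using L2_mult_integrable[OF H1_L2[OF u] H1_L2[OF w]] L2_mult_integrable[OF H1_L2[OF v] H1_L2[OF w]]
    by (simp add: distrib_right mult.assoc)
  moreover have "(LINT x|lebesgue_on U. wgrad U (\<lambda>x. u x + c * v x) x \<bullet> wgrad U w x) =
      (LINT x|lebesgue_on U. wgrad U u x \<bullet> wgrad U w x) + c * (LINT x|lebesgue_on U. wgrad U v x \<bullet> wgrad U w x)"
    using grad_form_comb(2)[OF u v I wgrad_works(1)[OF w], of c] by simp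
  ultimately show "H1_inner (\<lambda>x. u x + c * v x) w = H1_inner u w + c * H1_inner v w"
    unfolding H1_inner_def by (simp only: distrib_left)
qed

lemma H10_subset_H1: "H10 U \<subseteq> H1 U"
  by (auto simp: H10_def)

lemma zero_in_H10: "(\<lambda>x. 0) \<in> H10 U"
  using H1.zero_mem zero_test_function H1.dist_self[OF H1.zero_mem]
  by (auto simp: H10_def H1_norm_eq intro!: exI[of _ "\<lambda>_ _. 0"])

lemma H10_comb:
  assumes u: "u \<in> H10 U" and v: "v \<in> H10 U"
  shows "(\<lambda>x. u x + c * v x) \<in> H10 U"
proof -
  have uv: "u \<in> H1 U" "v \<in> H1 U" using u v H10_subset_H1 by auto
  obtain \<phi> where \<phi>: "\<And>n. test_function U (\<phi> n)" "(\<lambda>n. H1_norm U (\<lambda>x. \<phi> n x - u x)) \<longlonglongrightarrow> 0"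
    using u by (auto simp: H10_def)
  obtain \<psi> where \<psi>: "\<And>n. test_function U (\<psi> n)" "(\<lambda>n. H1_norm U (\<lambda>x. \<psi> n x - v x)) \<longlonglongrightarrow> 0"
    using v by (auto simp: H10_def)
  have le: "norm (H1_norm U (\<lambda>x. (\<phi> n x + c * \<psi> n x) - (u x + c * v x))) \<le>
      H1_norm U (\<lambda>x. \<phi> n x - u x) + \<bar>c\<bar> * H1_norm U (\<lambda>x. \<psi> n x - v x)" for n
  proof -
    have "(\<lambda>x. \<phi> n x - u x) \<in> H1 U" "(\<lambda>x. \<psi> n x - v x) \<in> H1 U"
      by (intro H1.diff_mem test_function_in_H1 \<phi> \<psi> uv)+
    from H1.norm_comb_le[OF this, of c] H1.nonneg[OF H1.comb_mem[OF this, of c]]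
    show ?thesis unfolding H1_norm_eq by (simp add: algebra_simps)
  qed
  have "(\<lambda>n. H1_norm U (\<lambda>x. \<phi> n x - u x) + \<bar>c\<bar> * H1_norm U (\<lambda>x. \<psi> n x - v x)) \<longlonglongrightarrow> 0 + \<bar>c\<bar> * 0"
    by (intro tendsto_intros \<phi> \<psi>)
  hence "(\<lambda>n. H1_norm U (\<lambda>x. \<phi> n x - u x) + \<bar>c\<bar> * H1_norm U (\<lambda>x. \<psi> n x - v x)) \<longlonglongrightarrow> 0"
    by simp
  hence "(\<lambda>n. H1_norm U (\<lambda>x. (\<phi> n x + c * \<psi> n x) - (u x + c * v x))) \<longlonglongrightarrow> 0"
    by (rule Lim_null_comparison[OF always_eventually[OF allI[OF le]]])
  moreover have "test_function U (\<lambda>x. \<phi> n x + c * \<psi> n x)" for n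
    by (intro test_function_comb \<phi> \<psi>)
  ultimately show ?thesis
    unfolding H10_def using H1_comb(1)[OF uv]
    by (intro CollectI conjI exI[of _ "\<lambda>n x. \<phi> n x + c * \<psi> n x"]) auto
qed

end

section \<open>The energy norm and the Zarantonello iteration\<close>
locale elliptic_problem =
  fixes P :: "('d::finite) problem"
  assumes model: "model_problem P"
begin

abbreviation \<Omega> where "\<Omega> \<equiv> dom P"

sublocale bounded_domain \<Omega>
  using model by unfold_locales (auto simp: model_problem_def polyhedral_lipschitz_domain_def)

lemma Linf_coefficients: "Linf \<Omega> (cA P)" "Linf \<Omega> (cb P)" "Linf \<Omega> (cc P)"
  using model by (auto simp: model_problem_def)

lemma H10_H1: "u \<in> H10 \<Omega> \<Longrightarrow> u \<in> H1 \<Omega>"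
  using H10_subset_H1 by blast

lemma a_form_comb:
  assumes "u \<in> H10 \<Omega>" "v \<in> H10 \<Omega>" "w \<in> H10 \<Omega>"
  shows "a_form P (\<lambda>x. u x + c * v x) w = a_form P u w + c * a_form P v w"
  unfolding a_form_def
  by (rule grad_form_comb(2)[OF H10_H1 H10_H1 Linf_coefficients(1)])
    (use assms wgrad_works(1)[OF H10_H1] in auto)

lemma a_form_commute:
  assumes "u \<in> H10 \<Omega>" "v \<in> H10 \<Omega>"
  shows "a_form P u v = a_form P v u"
  unfolding a_form_def
proof (rule integral_cong_AE)
  have i: "integrable (lebesgue_on \<Omega>) (\<lambda>x. (cA P x *v wgrad \<Omega> u x) \<bullet> wgrad \<Omega> v x)"
    if "u \<in> H10 \<Omega>" "v \<in> H10 \<Omega>" for u v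
    using that H10_H1 by (intro grad_form_comb(1)[OF _ _ Linf_coefficients(1)] wgrad_works) auto
  show "(\<lambda>x. (cA P x *v wgrad \<Omega> u x) \<bullet> wgrad \<Omega> v x) \<in> borel_measurable (lebesgue_on \<Omega>)"
    "(\<lambda>x. (cA P x *v wgrad \<Omega> v x) \<bullet> wgrad \<Omega> u x) \<in> borel_measurable (lebesgue_on \<Omega>)"
    by (intro borel_measurable_integrable i assms)+
  have "AE x in lebesgue_on \<Omega>. transpose (cA P x) = cA P x"
    using model by (auto simp: model_problem_def)
  thus "AE x in lebesgue_on \<Omega>. (cA P x *v wgrad \<Omega> u x) \<bullet> wgrad \<Omega> v x =
      (cA P x *v wgrad \<Omega> v x) \<bullet> wgrad \<Omega> u x"
    by eventually_elim (metis dot_lmul_matrix inner_commute transpose_matrix_vector)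
qed

sublocale energy: semi_inner "H10 \<Omega>" "a_form P"
proof
  show "(\<lambda>x. 0) \<in> H10 \<Omega>" by (rule zero_in_H10)
  fix u v w c assume u: "u \<in> H10 \<Omega>"
  show "0 \<le> a_form P u u" unfolding a_form_def
  proof (rule integral_nonneg_AE)
    have "AE x in lebesgue_on \<Omega>. \<forall>\<xi>. \<xi> \<noteq> 0 \<longrightarrow> 0 < \<xi> \<bullet> (cA P x *v \<xi>)"
      using model by (auto simp: model_problem_def)
    thus "AE x in lebesgue_on \<Omega>. 0 \<le> (cA P x *v wgrad \<Omega> u x) \<bullet> wgrad \<Omega> u x"
    proof eventually_elim
      case (elim x)
      thus ?case by (cases "wgrad \<Omega> u x = 0") (auto simp: inner_commute less_imp_le)
    qed
  qed
  assume v: "v \<in> H10 \<Omega>"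
  show "(\<lambda>x. u x + c * v x) \<in> H10 \<Omega>" by (rule H10_comb[OF u v])
  show "a_form P u v = a_form P v u" by (rule a_form_commute[OF u v])
  assume w: "w \<in> H10 \<Omega>"
  show "a_form P (\<lambda>x. u x + c * v x) w = a_form P u w + c * a_form P v w"
    by (rule a_form_comb[OF u v w])
qed

lemma b_form_diff:
  assumes u: "u \<in> H10 \<Omega>" and v: "v \<in> H10 \<Omega>" and w: "w \<in> H10 \<Omega>"
  shows "b_form P (\<lambda>x. u x - v x) w = b_form P u w - b_form P v w"
proof -
  let ?f = "\<lambda>u x. (cb P x \<bullet> wgrad \<Omega> u x + cc P x * u x) * w x"
  have i: "integrable (lebesgue_on \<Omega>) (?f z)" if z: "z \<in> H10 \<Omega>" for z
  proof -
    have "L2 \<Omega> (\<lambda>x. (\<Sum>i\<in>UNIV. cb P x $ i * wgrad \<Omega> z x $ i) + 1 * (cc P x * z x))"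
      by (intro L2_comb_real L2_sum Linf_L2_mult Linf_component L2_component Linf_coefficients
          wgrad_works H10_H1 z H1_L2) auto
    hence "L2 \<Omega> (\<lambda>x. cb P x \<bullet> wgrad \<Omega> z x + cc P x * z x)"
      by (simp add: inner_vec_def)
    thus ?thesis by (intro L2_mult_integrable H1_L2[OF H10_H1[OF w]])
  qed
  have "(LINT x|lebesgue_on \<Omega>. ?f (\<lambda>x. u x - v x) x) = (LINT x|lebesgue_on \<Omega>. ?f u x - ?f v x)"
  proof (rule integral_cong_AE)
    show "AE x in lebesgue_on \<Omega>. ?f (\<lambda>x. u x - v x) x = ?f u x - ?f v x"
      using H1_comb(2)[OF H10_H1[OF u] H10_H1[OF v], of "-1"]
    proof eventually_elim
      case (elim x)
      hence eq: "wgrad \<Omega> (\<lambda>x. u x - v x) x = wgrad \<Omega> u x - wgrad \<Omega> v x" by simp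
      show ?case unfolding eq by (simp add: inner_diff_right algebra_simps)
    qed
    show "?f (\<lambda>x. u x - v x) \<in> borel_measurable (lebesgue_on \<Omega>)"
      using i[OF energy.diff_mem[OF u v]] by (rule borel_measurable_integrable)
    show "(\<lambda>x. ?f u x - ?f v x) \<in> borel_measurable (lebesgue_on \<Omega>)"
      using i[OF u] i[OF v] by (intro borel_measurable_diff borel_measurable_integrable)
  qed
  also have "\<dots> = (LINT x|lebesgue_on \<Omega>. ?f u x) - (LINT x|lebesgue_on \<Omega>. ?f v x)"
    using i[OF u] i[OF v] by (rule Bochner_Integration.integral_diff)
  finally show ?thesis
    unfolding b_form_def energy.lin_diff[OF u v w] by simp
qed

lemma enorm_square: "u \<in> H10 \<Omega> \<Longrightarrow> (enorm P u)\<^sup>2 = a_form P u u"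
  using energy.nonneg by (simp add: enorm_def)

lemma edist_self: "u \<in> H10 \<Omega> \<Longrightarrow> edist P u u = 0"
  using energy.dist_self by (simp add: enorm_def)

lemma edist_commute: "\<lbrakk>u \<in> H10 \<Omega>; v \<in> H10 \<Omega>\<rbrakk> \<Longrightarrow> edist P u v = edist P v u"
  using energy.dist_comm by (simp add: enorm_def)

lemma edist_triangle:
  "\<lbrakk>u \<in> H10 \<Omega>; v \<in> H10 \<Omega>; w \<in> H10 \<Omega>\<rbrakk> \<Longrightarrow> edist P u w \<le> edist P u v + edist P v w"
  using energy.dist_triangle by (simp add: enorm_def)

text \<open>With the error \<open>e\<close> before the step and the increment \<open>d\<close>, Galerkin orthogonality reads
  \<open>a(d, v) = \<delta> b(e, v)\<close> for discrete \<open>v\<close>. Testing with \<open>d\<close> bounds \<open>d\<close> by \<open>\<delta> L e\<close>. Testing with \<open>e\<close>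
  and using ellipticity bounds the mixed term of the expansion of \<open>e - d\<close>.\<close>
lemma zarantonello_contraction:
  assumes V: "V \<subseteq> H10 \<Omega>" "\<And>u v. \<lbrakk>u \<in> V; v \<in> V\<rbrakk> \<Longrightarrow> (\<lambda>x. u x - v x) \<in> V"
    and g: "galerkin_solution P V g" and Z: "zarantonello P \<delta> V \<Phi>"
    and ell: "\<And>v. v \<in> H10 \<Omega> \<Longrightarrow> \<alpha> * (enorm P v)\<^sup>2 \<le> b_form P v v"
    and cont: "\<And>v w. \<lbrakk>v \<in> H10 \<Omega>; w \<in> H10 \<Omega>\<rbrakk> \<Longrightarrow> \<bar>b_form P v w\<bar> \<le> L * enorm P v * enorm P w"
    and \<delta>: "0 < \<delta>" and L: "0 \<le> L"
    and u: "u \<in> V"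
  shows "edist P g (\<Phi> u) \<le> sqrt (1 - \<delta> * (2 * \<alpha> - \<delta> * L\<^sup>2)) * edist P g u"
proof -
  define e where "e = (\<lambda>x. g x - u x)"
  define d where "d = (\<lambda>x. \<Phi> u x - u x)"
  have gV: "g \<in> V" and gal: "\<And>v. v \<in> V \<Longrightarrow> b_form P g v = load P v"
    using g by (auto simp: galerkin_solution_def)
  have \<Phi>V: "\<Phi> u \<in> V" and \<Phi>: "\<And>v. v \<in> V \<Longrightarrow> a_form P (\<Phi> u) v = a_form P u v + \<delta> * (load P v - b_form P u v)"
    using Z u by (auto simp: zarantonello_def)
  have eV: "e \<in> V" "d \<in> V" using V(2) gV \<Phi>V u by (auto simp: e_def d_def)
  have H: "g \<in> H10 \<Omega>" "u \<in> H10 \<Omega>" "\<Phi> u \<in> H10 \<Omega>" "e \<in> H10 \<Omega>" "d \<in> H10 \<Omega>"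
    using V(1) gV u \<Phi>V eV by auto
  have ad: "a_form P d v = \<delta> * b_form P e v" if v: "v \<in> V" for v
  proof -
    have vH: "v \<in> H10 \<Omega>" using v V by auto
    show ?thesis using \<Phi>[OF v] gal[OF v]
      energy.lin_diff[OF H(3,2) vH] b_form_diff[OF H(1,2) vH] by (simp add: d_def e_def)
  qed
  let ?D = "enorm P d" and ?E = "enorm P e"
  have pos: "0 \<le> ?D" "0 \<le> ?E" using energy.nonneg H by (auto simp: enorm_def)
  have "?D\<^sup>2 = \<delta> * b_form P e d" using ad[OF eV(2)] enorm_square[OF H(5)] by simp
  also have "\<dots> \<le> \<delta> * (L * ?E * ?D)"
    using cont[OF H(4,5)] \<delta> by (intro mult_left_mono) auto
  finally have "?D * ?D \<le> (\<delta> * L * ?E) * ?D" by (simp add: power2_eq_square mult_ac)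
  hence D: "?D \<le> \<delta> * L * ?E"
    using pos \<delta> L by (cases "?D = 0") auto
  hence D2: "?D\<^sup>2 \<le> \<delta>\<^sup>2 * L\<^sup>2 * ?E\<^sup>2"
    using power_mono[OF D pos(1), of 2] by (simp add: power_mult_distrib)
  have eq: "(\<lambda>x. g x - \<Phi> u x) = (\<lambda>x. e x - d x)" by (auto simp: e_def d_def)
  have "(edist P g (\<Phi> u))\<^sup>2 = a_form P (\<lambda>x. e x - d x) (\<lambda>x. e x - d x)"
    unfolding eq by (rule enorm_square[OF energy.diff_mem[OF H(4,5)]])
  also have "\<dots> = ?E\<^sup>2 - 2 * a_form P e d + ?D\<^sup>2"
    using energy.square_diff[OF H(4,5)] enorm_square H by simp
  also have "a_form P e d = \<delta> * b_form P e e" using ad[OF eV(1)] a_form_commute[OF H(4,5)] by simp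
  also have "?E\<^sup>2 - 2 * (\<delta> * b_form P e e) + ?D\<^sup>2 \<le> ?E\<^sup>2 - 2 * (\<delta> * (\<alpha> * ?E\<^sup>2)) + \<delta>\<^sup>2 * L\<^sup>2 * ?E\<^sup>2"
    using ell[OF H(4)] \<delta> D2 by (intro add_mono diff_left_mono mult_left_mono) auto
  also have "\<dots> = (1 - \<delta> * (2 * \<alpha> - \<delta> * L\<^sup>2)) * ?E\<^sup>2"
    by (simp add: algebra_simps power2_eq_square)
  finally have "sqrt ((edist P g (\<Phi> u))\<^sup>2) \<le> sqrt ((1 - \<delta> * (2 * \<alpha> - \<delta> * L\<^sup>2)) * ?E\<^sup>2)"
    by (rule real_sqrt_le_mono)
  moreover have "0 \<le> edist P g (\<Phi> u)"
    using energy.nonneg[OF energy.diff_mem[OF H(1,3)]] by (simp add: enorm_def)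
  ultimately show ?thesis using pos by (simp add: real_sqrt_mult e_def)
qed

end

section \<open>Finite element spaces\<close>

lemma polynomial_deg_le_comb:
  assumes "polynomial_deg_le p q" "polynomial_deg_le p r"
  shows "polynomial_deg_le p (\<lambda>x. q x + c * r x)"
proof -
  obtain a where a: "\<And>x. q x = (\<Sum>m | (\<Sum>i\<in>UNIV. m i) \<le> p. a m * (\<Prod>i\<in>UNIV. (x $ i) ^ m i))"
    using assms(1) by (auto simp: polynomial_deg_le_def)
  obtain b where b: "\<And>x. r x = (\<Sum>m | (\<Sum>i\<in>UNIV. m i) \<le> p. b m * (\<Prod>i\<in>UNIV. (x $ i) ^ m i))"
    using assms(2) by (auto simp: polynomial_deg_le_def)
  show ?thesis unfolding polynomial_deg_le_def a b
    by (rule exI[of _ "\<lambda>m. a m + c * b m"]) (simp add: sum.distrib sum_distrib_left distrib_right mult.assoc)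
qed

text \<open>In a convex combination of \<open>a\<close>, \<open>b\<close> and a point \<open>y\<close>, the smaller one of the weights of \<open>a\<close> and
  \<open>b\<close> can be moved completely to the midpoint.\<close>
lemma convex_hull_midpoint_split:
  fixes a b :: "'a::real_vector"
  defines "m \<equiv> midpoint a b"
  shows "convex hull (insert a (insert b Y)) \<subseteq>
    convex hull (insert a (insert m Y)) \<union> convex hull (insert b (insert m Y))"
proof
  fix x assume x: "x \<in> convex hull (insert a (insert b Y))"
  have "\<exists>\<alpha> \<beta> \<gamma> y. 0 \<le> \<alpha> \<and> 0 \<le> \<beta> \<and> 0 \<le> \<gamma> \<and> \<alpha> + \<beta> + \<gamma> = 1 \<and>
     x = \<alpha> *\<^sub>R a + \<beta> *\<^sub>R b + \<gamma> *\<^sub>R y \<and> (\<gamma> = 0 \<or> y \<in> convex hull Y)"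
  proof (cases "Y = {}")
    case True
    then obtain u v where "0 \<le> u" "0 \<le> v" "u + v = 1" "x = u *\<^sub>R a + v *\<^sub>R b"
      using x by (auto simp: convex_hull_2)
    thus ?thesis by (intro exI[of _ u] exI[of _ v] exI[of _ 0]) auto
  next
    case False
    obtain u v z where u: "0 \<le> u" "0 \<le> v" "u + v = 1" "z \<in> convex hull (insert b Y)" "x = u *\<^sub>R a + v *\<^sub>R z"
      using x by (subst (asm) convex_hull_insert) auto
    obtain s t y where s: "0 \<le> s" "0 \<le> t" "s + t = 1" "y \<in> convex hull Y" "z = s *\<^sub>R b + t *\<^sub>R y"
      using u(4) False by (subst (asm) convex_hull_insert) auto
    have "u + v * s + v * t = 1" using u(3) s(3) by (metis add.assoc distrib_left mult.right_neutral)
    thus ?thesis using u s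
      by (intro exI[of _ u] exI[of _ "v * s"] exI[of _ "v * t"] exI[of _ y]) (auto simp: algebra_simps)
  qed
  then obtain \<alpha> \<beta> \<gamma> y where c: "0 \<le> \<alpha>" "0 \<le> \<beta>" "0 \<le> \<gamma>" "\<alpha> + \<beta> + \<gamma> = 1"
     "x = \<alpha> *\<^sub>R a + \<beta> *\<^sub>R b + \<gamma> *\<^sub>R y" "\<gamma> = 0 \<or> y \<in> convex hull Y" by blast
  \<comment> \<open>If \<open>Y\<close> is empty, \<open>\<gamma>\<close> vanishes and any point of the hull can take the place of \<open>y\<close>.\<close>
  define y' where "y' = (if \<gamma> = 0 then m else y)"
  have tri: "convex hull {z, m, y'} \<subseteq> convex hull (insert z (insert m Y))" for z
    using c(6) hull_mono[of Y "insert z (insert m Y)" convex]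
    by (intro hull_minimal convex_convex_hull) (auto simp: y'_def hull_inc)
  have m: "2 *\<^sub>R m = a + b" by (simp add: m_def midpoint_def)
  show "x \<in> convex hull (insert a (insert m Y)) \<union> convex hull (insert b (insert m Y))"
  proof (cases "\<beta> \<le> \<alpha>")
    case True
    have "x = (\<alpha> - \<beta>) *\<^sub>R a + (2 * \<beta>) *\<^sub>R m + \<gamma> *\<^sub>R y'"
    proof -
      have "(2 * \<beta>) *\<^sub>R m = \<beta> *\<^sub>R (a + b)" unfolding m[symmetric] by simp
      thus ?thesis using c(5) by (simp add: y'_def algebra_simps)
    qed
    hence "x \<in> convex hull {a, m, y'}" unfolding convex_hull_3 using True c by fastforce
    thus ?thesis using tri by blast
  next
    case False
    have "x = (\<beta> - \<alpha>) *\<^sub>R b + (2 * \<alpha>) *\<^sub>R m + \<gamma> *\<^sub>R y'"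
    proof -
      have "(2 * \<alpha>) *\<^sub>R m = \<alpha> *\<^sub>R (a + b)" unfolding m[symmetric] by simp
      thus ?thesis using c(5) by (simp add: y'_def algebra_simps)
    qed
    hence "x \<in> convex hull {b, m, y'}" unfolding convex_hull_3 using False c by fastforce
    thus ?thesis using tri by blast
  qed
qed

lemma elem_measurable: "elem \<tau> \<in> sets lebesgue"
  unfolding elem_def by (intro lmeasurable_compact[THEN fmeasurableD] finite_imp_compact_convex_hull) simp

text \<open>The reordering of the vertices in the second child only matters for later bisections, not for the
  simplex itself.\<close>
lemma children_elem:
  assumes "2 \<le> length (fst \<tau>)"
  shows "\<And>\<tau>'. \<tau>' \<in> children \<tau> \<Longrightarrow> elem \<tau>' \<subseteq> elem \<tau> \<and> length (fst \<tau>') = length (fst \<tau>)"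
    and "elem \<tau> \<subseteq> \<Union> (elem ` children \<tau>)"
    and "finite (children \<tau>)"
proof -
  define a b ys where "a = hd (fst \<tau>)" and "b = last (fst \<tau>)" and "ys = butlast (tl (fst \<tau>))"
  have zs: "fst \<tau> = a # ys @ [b]"
    using assms by (cases "fst \<tau>") (auto simp: a_def b_def ys_def)
  let ?g = "snd \<tau>" and ?h = "Suc (snd \<tau>) mod CARD('a)"
  have ch: "children \<tau> = {(a # midpoint a b # ys, ?h), (b # midpoint a b # take ?g ys @ rev (drop ?g ys), ?h)}"
    by (simp add: children_def zs Let_def)
  have tk: "set (take ?g ys) \<union> set (drop ?g ys) = set ys"
    by (metis append_take_drop_id set_append)
  have s: "set (fst \<tau>) = insert a (insert b (set ys))" by (auto simp: zs)
  have m: "midpoint a b \<in> convex hull (insert a (insert b (set ys)))"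
    using midpoint_in_closed_segment[of a b] hull_mono[of "{a, b}" "insert a (insert b (set ys))" convex]
    by (auto simp: segment_convex_hull)
  have sub: "convex hull (insert z (insert (midpoint a b) (set ys))) \<subseteq> convex hull (insert a (insert b (set ys)))"
    if "z \<in> {a, b}" for z
    using that m by (intro hull_minimal convex_convex_hull) (auto simp: hull_inc)
  have e: "elem (a # midpoint a b # ys, ?h) = convex hull (insert a (insert (midpoint a b) (set ys)))"
    "elem (b # midpoint a b # take ?g ys @ rev (drop ?g ys), ?h) = convex hull (insert b (insert (midpoint a b) (set ys)))"
    using tk by (simp_all add: elem_def)
  have e0: "elem \<tau> = convex hull (insert a (insert b (set ys)))" by (simp add: elem_def s)
  show "elem \<tau>' \<subseteq> elem \<tau> \<and> length (fst \<tau>') = length (fst \<tau>)" if "\<tau>' \<in> children \<tau>" for \<tau>'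
    using that sub[of a] sub[of b] e e0 unfolding ch by (auto simp: zs)
  show "elem \<tau> \<subseteq> \<Union> (elem ` children \<tau>)"
    unfolding ch image_insert image_empty e e0 using convex_hull_midpoint_split[of a b "set ys"] by auto
  show "finite (children \<tau>)" by (simp add: ch)
qed

text \<open>The part of the properties of a mesh that every single bisection preserves, although intermediate
  meshes need not be conforming.\<close>
definition covering_mesh :: "(real^'d::finite) set \<Rightarrow> 'd mesh \<Rightarrow> bool" where
  "covering_mesh U \<T> \<longleftrightarrow> finite \<T> \<and> (\<forall>\<tau>\<in>\<T>. 2 \<le> length (fst \<tau>)) \<and> U \<subseteq> \<Union> (elem ` \<T>)"

lemma covering_mesh_initial:
  assumes "initial_mesh U (\<T> :: ('d::finite) mesh)"
  shows "covering_mesh U \<T>"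
proof -
  have "finite (elem ` \<T>)" "inj_on elem \<T>"
    using assms by (auto simp: initial_mesh_def conforming_def triangulation_def)
  hence "finite \<T>" by (rule finite_imageD)
  moreover have "2 \<le> length (fst \<tau>)" if "\<tau> \<in> \<T>" for \<tau>
    using that assms zero_less_card_finite[where 'a = 'd]
    unfolding initial_mesh_def tagged_simplex_def by fastforce
  ultimately show ?thesis
    using assms closure_subset[of U] by (auto simp: covering_mesh_def initial_mesh_def)
qed

lemma bisect_covering:
  assumes "bisect \<T> \<T>'" "covering_mesh U \<T>"
  shows "covering_mesh U \<T>'" and "fe_space P p \<T> \<subseteq> fe_space P p \<T>'"
proof -
  obtain \<tau> where \<tau>: "\<tau> \<in> \<T>" and T': "\<T>' = (\<T> - {\<tau>}) \<union> children \<tau>"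
    using assms(1) by (auto simp: bisect_def)
  have l: "2 \<le> length (fst \<tau>)" using \<tau> assms(2) by (auto simp: covering_mesh_def)
  note ch = children_elem[OF l]
  show "covering_mesh U \<T>'"
    unfolding covering_mesh_def
  proof (intro conjI ballI)
    show "finite \<T>'" using ch(3) assms(2) by (simp add: T' covering_mesh_def)
    show "2 \<le> length (fst \<tau>')" if "\<tau>' \<in> \<T>'" for \<tau>'
      using that ch(1)[of \<tau>'] l assms(2) by (auto simp: T' covering_mesh_def)
    have "U \<subseteq> \<Union> (elem ` (\<T> - {\<tau>})) \<union> elem \<tau>"
      using assms(2) \<tau> unfolding covering_mesh_def by blast
    thus "U \<subseteq> \<Union> (elem ` \<T>')" using ch(2) by (auto simp: T')
  qed
  show "fe_space P p \<T> \<subseteq> fe_space P p \<T>'"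
  proof
    fix v assume v: "v \<in> fe_space P p \<T>"
    have "\<exists>q. polynomial_deg_le p q \<and> (AE x in lebesgue_on (elem \<tau>'). v x = q x)" if t: "\<tau>' \<in> \<T>'" for \<tau>'
    proof (cases "\<tau>' \<in> children \<tau>")
      case False
      thus ?thesis using t v by (auto simp: T' fe_space_def)
    next
      case True
      obtain q where q: "polynomial_deg_le p q" "AE x in lebesgue_on (elem \<tau>). v x = q x"
        using v \<tau> by (auto simp: fe_space_def)
      have "AE x in lebesgue_on (elem \<tau>'). v x = q x"
        using q(2) ch(1)[OF True] elem_measurable[of \<tau>] elem_measurable[of \<tau>'] by (auto simp: AE_restrict_space_iff elim!: eventually_mono)
      thus ?thesis using q(1) by blast
    qed
    thus "v \<in> fe_space P p \<T>'" using v by (auto simp: fe_space_def)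
  qed
qed

lemma bisections_covering:
  assumes "bisections \<T> \<T>'" "covering_mesh U \<T>"
  shows "covering_mesh U \<T>' \<and> fe_space P p \<T> \<subseteq> fe_space P p \<T>'"
  using assms(1)
proof (induction rule: rtranclp_induct)
  case base
  thus ?case using assms(2) by simp
next
  case (step \<S> \<S>')
  thus ?case using bisect_covering[OF step.hyps(2)] by blast
qed

lemma refinements_bisections: "\<T>' \<in> refinements \<T> \<Longrightarrow> bisections \<T> \<T>'"
  unfolding refinements_def mem_Collect_eq
proof (induction rule: rtranclp_induct)
  case (step \<S> \<S>')
  then obtain \<M> where "is_refine \<S> \<M> \<S>'" by blast
  hence "bisections \<S> \<S>'" by (simp add: is_refine_def)
  thus ?case using step.IH by simp
qed simp

lemma finite_exponents: "finite {m :: 'd::finite \<Rightarrow> nat. (\<Sum>i\<in>UNIV. m i) \<le> p}"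
proof (rule finite_subset)
  show "{m :: 'd \<Rightarrow> nat. (\<Sum>i\<in>UNIV. m i) \<le> p} \<subseteq> PiE UNIV (\<lambda>_. {..p})"
  proof
    fix m :: "'d \<Rightarrow> nat" assume m: "m \<in> {m. (\<Sum>i\<in>UNIV. m i) \<le> p}"
    have "m i \<le> (\<Sum>i\<in>UNIV. m i)" for i by (rule member_le_sum) auto
    thus "m \<in> PiE UNIV (\<lambda>_. {..p})" using m order_trans by (fastforce simp: PiE_def)
  qed
qed (intro finite_PiE; simp)

context elliptic_problem
begin

lemma fe_space_subset_H10: "fe_space P p \<T> \<subseteq> H10 \<Omega>"
  by (auto simp: fe_space_def)

lemma fe_space_zero: "(\<lambda>x. 0) \<in> fe_space P p \<T>"
proof -
  have "polynomial_deg_le p (\<lambda>x::real^'d. 0)"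
    by (auto simp: polynomial_deg_le_def intro!: exI[of _ "\<lambda>_. 0"])
  thus ?thesis using zero_in_H10 by (auto simp: fe_space_def)
qed

lemma fe_space_comb:
  assumes u: "u \<in> fe_space P p \<T>" and v: "v \<in> fe_space P p \<T>"
  shows "(\<lambda>x. u x + c * v x) \<in> fe_space P p \<T>"
  unfolding fe_space_def
proof (intro CollectI conjI ballI)
  show "(\<lambda>x. u x + c * v x) \<in> H10 \<Omega>" using u v fe_space_subset_H10 by (intro H10_comb) auto
  fix \<tau> assume \<tau>: "\<tau> \<in> \<T>"
  obtain q where q: "polynomial_deg_le p q" "AE x in lebesgue_on (elem \<tau>). u x = q x"
    using u \<tau> by (auto simp: fe_space_def)
  obtain r where r: "polynomial_deg_le p r" "AE x in lebesgue_on (elem \<tau>). v x = r x"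
    using v \<tau> by (auto simp: fe_space_def)
  have "AE x in lebesgue_on (elem \<tau>). u x + c * v x = q x + c * r x"
    using q(2) r(2) by eventually_elim simp
  thus "\<exists>q. polynomial_deg_le p q \<and> (AE x in lebesgue_on (elem \<tau>). u x + c * v x = q x)"
    using polynomial_deg_le_comb[OF q(1) r(1)] by blast
qed

lemma fe_space_diff: "\<lbrakk>u \<in> fe_space P p \<T>; v \<in> fe_space P p \<T>\<rbrakk> \<Longrightarrow> (\<lambda>x. u x - v x) \<in> fe_space P p \<T>"
  using fe_space_comb[where c = "-1"] by simp

text \<open>Elements may overlap in their boundaries. Assigning to each point of the domain one element that
  contains it yields a partition, and the monomials cut off to its parts span the space.\<close>
lemma fe_space_finite_dim:
  assumes "covering_mesh \<Omega> \<T>"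
  shows "finite_dim_subspace \<Omega> (fe_space P p \<T>)"
proof -
  define E where "E = {m :: 'd \<Rightarrow> nat. (\<Sum>i\<in>UNIV. m i) \<le> p}"
  define mon where "mon = (\<lambda>m (x::real^'d). \<Prod>i\<in>UNIV. (x $ i) ^ m i)"
  define pick where "pick = (\<lambda>x. SOME \<tau>. \<tau> \<in> \<T> \<and> x \<in> elem \<tau>)"
  define g where "g = (\<lambda>(\<tau>, m) x. if pick x = \<tau> then mon m x else 0)"
  have fin: "finite (\<T> \<times> E)" using assms finite_exponents by (auto simp: E_def covering_mesh_def)
  have pick: "pick x \<in> \<T> \<and> x \<in> elem (pick x)" if "x \<in> \<Omega>" for x
  proof -
    have "\<exists>\<tau>. \<tau> \<in> \<T> \<and> x \<in> elem \<tau>" using that assms unfolding covering_mesh_def by blast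
    thus ?thesis unfolding pick_def by (rule someI_ex)
  qed
  have span: "\<exists>c. AE x in lebesgue_on \<Omega>. v x = (\<Sum>b\<in>g ` (\<T> \<times> E). c b * b x)" if v: "v \<in> fe_space P p \<T>" for v
  proof -
    have "\<forall>\<tau>\<in>\<T>. \<exists>c. AE x in lebesgue_on (elem \<tau>). v x = (\<Sum>m\<in>E. c m * mon m x)"
    proof
      fix \<tau> assume "\<tau> \<in> \<T>"
      then obtain q where q: "polynomial_deg_le p q" "AE x in lebesgue_on (elem \<tau>). v x = q x"
        using v by (auto simp: fe_space_def)
      obtain c where "\<And>x. q x = (\<Sum>m\<in>E. c m * mon m x)"
        using q(1) by (auto simp: polynomial_deg_le_def E_def mon_def)
      thus "\<exists>c. AE x in lebesgue_on (elem \<tau>). v x = (\<Sum>m\<in>E. c m * mon m x)" using q(2) by auto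
    qed
    from bchoice[OF this] obtain C
      where C: "\<And>\<tau>. \<tau> \<in> \<T> \<Longrightarrow> AE x in lebesgue_on (elem \<tau>). v x = (\<Sum>m\<in>E. C \<tau> m * mon m x)"
      by blast
    have AE\<tau>: "AE x in lebesgue. x \<in> elem \<tau> \<longrightarrow> v x = (\<Sum>m\<in>E. C \<tau> m * mon m x)" if "\<tau> \<in> \<T>" for \<tau>
      using C[OF that] elem_measurable[of \<tau>] by (simp add: AE_restrict_space_iff)
    have "finite \<T>" using assms by (simp add: covering_mesh_def)
    hence "AE x in lebesgue. \<forall>\<tau>\<in>\<T>. x \<in> elem \<tau> \<longrightarrow> v x = (\<Sum>m\<in>E. C \<tau> m * mon m x)"
      by (rule AE_finite_allI) (rule AE\<tau>)
    hence AE: "AE x in lebesgue. x \<in> \<Omega> \<longrightarrow> (\<forall>\<tau>\<in>\<T>. x \<in> elem \<tau> \<longrightarrow> v x = (\<Sum>m\<in>E. C \<tau> m * mon m x))"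
      by eventually_elim simp
    define c where "c = (\<lambda>b. \<Sum>i | i \<in> \<T> \<times> E \<and> g i = b. (case i of (\<tau>, m) \<Rightarrow> C \<tau> m))"
    have "AE x in lebesgue. x \<in> \<Omega> \<longrightarrow> v x = (\<Sum>b\<in>g ` (\<T> \<times> E). c b * b x)"
      using AE
    proof eventually_elim
      case (elim x)
      show ?case
      proof
        assume x: "x \<in> \<Omega>"
        have "(\<Sum>b\<in>g ` (\<T> \<times> E). c b * b x) =
            (\<Sum>b\<in>g ` (\<T> \<times> E). \<Sum>i | i \<in> \<T> \<times> E \<and> g i = b. (case i of (\<tau>, m) \<Rightarrow> C \<tau> m) * g i x)"
          by (intro sum.cong refl) (simp add: c_def sum_distrib_right)
        also have "\<dots> = (\<Sum>i\<in>\<T> \<times> E. (case i of (\<tau>, m) \<Rightarrow> C \<tau> m) * g i x)"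
          by (rule sum.image_gen[OF fin, symmetric])
        also have "\<dots> = (\<Sum>\<tau>\<in>\<T>. \<Sum>m\<in>E. if pick x = \<tau> then C \<tau> m * mon m x else 0)"
          unfolding sum.cartesian_product by (intro sum.cong) (auto simp: g_def)
        also have "\<dots> = (\<Sum>\<tau>\<in>\<T>. if \<tau> = pick x then (\<Sum>m\<in>E. C \<tau> m * mon m x) else 0)"
          by (intro sum.cong) auto
        also have "\<dots> = (\<Sum>m\<in>E. C (pick x) m * mon m x)"
          using assms pick[OF x] by (simp add: covering_mesh_def)
        also have "\<dots> = v x" using elim x pick[OF x] by metis
        finally show "v x = (\<Sum>b\<in>g ` (\<T> \<times> E). c b * b x)" by (rule sym)
      qed
    qed
    hence "AE x in lebesgue_on \<Omega>. v x = (\<Sum>b\<in>g ` (\<T> \<times> E). c b * b x)"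
      using dom_sets by (subst AE_restrict_space_iff) auto
    thus ?thesis by blast
  qed
  show ?thesis
    unfolding finite_dim_subspace_def
  proof (intro conjI ballI allI exI[of _ "g ` (\<T> \<times> E)"])
    show "(\<lambda>x. u x + v x) \<in> fe_space P p \<T>" if "u \<in> fe_space P p \<T>" "v \<in> fe_space P p \<T>" for u v
      using fe_space_comb[OF that, of 1] by simp
    show "(\<lambda>x. c * v x) \<in> fe_space P p \<T>" if "v \<in> fe_space P p \<T>" for c v
      using fe_space_comb[OF fe_space_zero that, of c] by simp
  qed (use fin in \<open>simp_all add: fe_space_zero fe_space_subset_H10 span\<close>)
qed

end

section \<open>Estimator reduction\<close>

lemma eta_sq_nonneg: "0 \<le> eta_sq P \<T> \<tau> v"
  unfolding eta_sq_def face_integral_def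
  by (intro add_nonneg_nonneg mult_nonneg_nonneg sum_nonneg integral_nonneg_AE) auto

lemma eta_on_nonneg: "0 \<le> eta_on P \<T> \<U> v"
  unfolding eta_on_def by (simp add: sum_nonneg eta_sq_nonneg)

lemma eta_on_square: "(eta_on P \<T> \<U> v)\<^sup>2 = (\<Sum>\<tau>\<in>\<U>. eta_sq P \<T> \<tau> v)"
  unfolding eta_on_def by (simp add: sum_nonneg eta_sq_nonneg)

text \<open>On common elements, stability with equal arguments shows that the estimator does not change. All
  marked elements are refined, so by the marking criterion at least the fraction \<open>\<theta>\<close> of the squared
  estimator is reduced by the factor \<open>q\<^sub>r\<^sub>e\<^sub>d\<^sup>2\<close>.\<close>
lemma (in elliptic_problem) estimator_reduction:
  assumes T: "\<T> \<in> refinements \<T>0" "\<T>' \<in> refinements \<T>" and cov: "covering_mesh \<Omega> \<T>0"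
    and stab: "stability P p \<T>0 Cstab" and red: "reduction P p \<T>0 qred" and q: "0 \<le> qred" "qred \<le> 1"
    and M: "\<M> \<in> doerfler_sets P \<theta> \<T> v" "\<M> \<inter> \<T>' = {}"
    and v: "v \<in> fe_space P p \<T>"
  shows "eta P \<T>' v \<le> sqrt (1 - (1 - qred\<^sup>2) * \<theta>) * eta P \<T> v"
proof -
  have c: "covering_mesh \<Omega> \<T>" using bisections_covering[OF refinements_bisections[OF T(1)] cov] by blast
  have c': "covering_mesh \<Omega> \<T>'" and sub: "fe_space P p \<T> \<subseteq> fe_space P p \<T>'"
    using bisections_covering[OF refinements_bisections[OF T(2)] c] by blast+
  have fin: "finite \<T>" "finite \<T>'" using c c' by (auto simp: covering_mesh_def)
  have split: "(eta P \<S> v)\<^sup>2 = (eta_on P \<S> (\<S> \<inter> \<S>') v)\<^sup>2 + (eta_on P \<S> (\<S> - \<S>') v)\<^sup>2"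
    if "finite \<S>" for \<S> \<S>' :: "'d mesh"
    unfolding eta_on_square using that by (subst sum.Int_Diff[of _ _ \<S>']) auto
  have "\<bar>eta_on P \<T>' (\<T>' \<inter> \<T>) v - eta_on P \<T> (\<T>' \<inter> \<T>) v\<bar> \<le> Cstab * edist P v v"
    using stab T v sub unfolding stability_def by blast
  hence common: "eta_on P \<T>' (\<T>' \<inter> \<T>) v = eta_on P \<T> (\<T> \<inter> \<T>') v"
    using edist_self[OF subsetD[OF fe_space_subset_H10 v]] by (simp add: Int_commute)
  have ref1: "eta_on P \<T>' (\<T>' - \<T>) v \<le> qred * eta_on P \<T> (\<T> - \<T>') v"
    using red T v unfolding reduction_def by blast
  have ref: "(eta_on P \<T>' (\<T>' - \<T>) v)\<^sup>2 \<le> qred\<^sup>2 * (eta_on P \<T> (\<T> - \<T>') v)\<^sup>2"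
    using power_mono[OF ref1 eta_on_nonneg, of 2] by (simp add: power_mult_distrib)
  have "\<theta> * (eta P \<T> v)\<^sup>2 \<le> (eta_on P \<T> \<M> v)\<^sup>2" using M by (simp add: doerfler_sets_def)
  also have "\<dots> \<le> (eta_on P \<T> (\<T> - \<T>') v)\<^sup>2"
    unfolding eta_on_square using fin M
    by (intro sum_mono2 eta_sq_nonneg) (auto simp: doerfler_sets_def)
  finally have D: "\<theta> * (eta P \<T> v)\<^sup>2 \<le> (eta_on P \<T> (\<T> - \<T>') v)\<^sup>2" .
  have "qred\<^sup>2 \<le> 1" using q by (simp add: power_le_one)
  hence D': "(1 - qred\<^sup>2) * (\<theta> * (eta P \<T> v)\<^sup>2) \<le> (1 - qred\<^sup>2) * (eta_on P \<T> (\<T> - \<T>') v)\<^sup>2"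
    using D by (intro mult_left_mono) auto
  have "(eta P \<T>' v)\<^sup>2 \<le> (1 - (1 - qred\<^sup>2) * \<theta>) * (eta P \<T> v)\<^sup>2"
    using split[OF fin(2), of \<T>] split[OF fin(1), of \<T>'] common ref D' by (simp add: algebra_simps)
  hence "sqrt ((eta P \<T>' v)\<^sup>2) \<le> sqrt ((1 - (1 - qred\<^sup>2) * \<theta>) * (eta P \<T> v)\<^sup>2)"
    by (rule real_sqrt_le_mono)
  thus ?thesis by (simp add: real_sqrt_mult eta_on_nonneg)
qed

section \<open>From tail sums to linear convergence\<close>

lemma index_le_simp: "index_le (l', k', j') (l, k, j) \<longleftrightarrow>
    l' < l \<or> l' = l \<and> (k' < k \<or> k' = k \<and> j' \<le> j)"
  by (simp add: index_le_def)

lemma index_le_refl: "index_le x x"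
  by (cases x) (auto simp: index_le_simp)

lemma index_le_trans: "\<lbrakk>index_le x y; index_le y z\<rbrakk> \<Longrightarrow> index_le x z"
  by (cases x; cases y; cases z) (auto simp: index_le_simp)

lemma index_le_antisym: "\<lbrakk>index_le x y; index_le y x\<rbrakk> \<Longrightarrow> x = y"
  by (cases x; cases y) (auto simp: index_le_simp)

lemma index_le_total: "index_le x y \<or> index_le y x"
  by (cases x; cases y) (auto simp: index_le_simp)

text \<open>Let \<open>T\<^sub>x\<close> be the sum of \<open>H\<close> from \<open>x\<close> to \<open>i\<close>, and \<open>s\<close> the successor of \<open>x\<close>. The hypothesis
  \<open>T\<^sub>x \<le> C H\<^sub>x = C (T\<^sub>x - T\<^sub>s)\<close> says that \<open>T\<^sub>s \<le> (1 - 1 / C) T\<^sub>x\<close>. The tail sum thus loses a fixed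
  fraction with each step.\<close>
lemma linear_convergence_from_tail_sums:
  fixes H :: "nat \<times> nat \<times> nat \<Rightarrow> real" and Q :: "(nat \<times> nat \<times> nat) set"
  defines "cnt \<equiv> \<lambda>i. card {x \<in> Q. index_le x i}"
  assumes fin: "\<And>i. i \<in> Q \<Longrightarrow> finite {x \<in> Q. index_le x i}"
    and pos: "\<And>i. i \<in> Q \<Longrightarrow> 0 \<le> H i" and C: "1 < C"
    and tail: "\<And>i i'. \<lbrakk>i \<in> Q; i' \<in> Q; index_le i' i\<rbrakk> \<Longrightarrow>
       (\<Sum>x | x \<in> Q \<and> index_le i' x \<and> index_le x i. H x) \<le> C * H i'"
    and i: "i \<in> Q" "i' \<in> Q" "cnt i' \<le> cnt i"
  shows "H i \<le> C * (1 - 1 / C) ^ (cnt i - cnt i') * H i'"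
proof -
  have cnt_less: "cnt x < cnt y" if "x \<in> Q" "y \<in> Q" "index_le x y" "x \<noteq> y" for x y
    unfolding cnt_def
  proof (rule psubset_card_mono[OF fin[OF that(2)]])
    have "\<not> index_le y x" using that index_le_antisym by blast
    thus "{z \<in> Q. index_le z x} \<subset> {z \<in> Q. index_le z y}"
      using that index_le_trans index_le_refl by blast
  qed
  have le_of_cnt: "index_le x y" if "x \<in> Q" "y \<in> Q" "cnt x \<le> cnt y" for x y
    using that cnt_less[of y x] index_le_total[of x y] index_le_refl[of x] by (metis not_le)
  define A where "A = (\<lambda>x. {z. z \<in> Q \<and> index_le x z \<and> index_le z i})"
  have finA: "finite (A x)" for x
    by (rule finite_subset[OF _ fin[OF i(1)]]) (auto simp: A_def)
  have T: "sum H {i} \<le> (1 - 1 / C) ^ n * sum H (A x)"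
    if "x \<in> Q" "index_le x i" "n = cnt i - cnt x" for x n
    using that
  proof (induction n arbitrary: x)
    case 0
    have "cnt i \<le> cnt x" using 0 by simp
    hence "x = i" using 0 le_of_cnt[OF i(1)] index_le_antisym by blast
    hence "A x = {i}" unfolding A_def using index_le_antisym index_le_refl i(1) by blast
    thus ?case by simp
  next
    case (Suc n)
    have "x \<noteq> i" using Suc.prems by auto
    hence "\<exists>s. s \<in> Q \<and> index_le x s \<and> x \<noteq> s \<and> index_le s i"
      using Suc.prems i index_le_refl by blast
    then obtain s where s: "s \<in> Q" "index_le x s" "x \<noteq> s" "index_le s i"
      and least: "\<And>y. y \<in> Q \<Longrightarrow> index_le x y \<Longrightarrow> x \<noteq> y \<Longrightarrow> index_le y i \<Longrightarrow> cnt s \<le> cnt y"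
      using ex_has_least_nat[of "\<lambda>s. s \<in> Q \<and> index_le x s \<and> x \<noteq> s \<and> index_le s i" _ cnt] by metis
    have "{y \<in> Q. index_le y s} = insert s {y \<in> Q. index_le y x}"
    proof (intro set_eqI iffI)
      fix y assume y: "y \<in> {y \<in> Q. index_le y s}"
      show "y \<in> insert s {y \<in> Q. index_le y x}"
      proof (rule ccontr)
        assume n: "y \<notin> insert s {y \<in> Q. index_le y x}"
        hence "cnt s \<le> cnt y"
          using y s index_le_total[of x y] index_le_trans[of y s i] index_le_refl by (intro least) auto
        hence "index_le s y" using y s by (intro le_of_cnt) auto
        thus False using n y index_le_antisym[of s y] by auto
      qed
    qed (use s index_le_trans index_le_refl in blast)
    moreover have "s \<notin> {y \<in> Q. index_le y x}" using s index_le_antisym by blast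
    ultimately have cs: "cnt s = Suc (cnt x)"
      using fin[OF Suc.prems(1)] by (simp add: cnt_def)
    have "A x = insert x (A s)"
    proof (intro set_eqI iffI)
      fix y assume y: "y \<in> A x"
      show "y \<in> insert x (A s)"
      proof (cases "y = x")
        case False
        hence "cnt s \<le> cnt y" using y by (intro least) (auto simp: A_def)
        hence "index_le s y" using y s by (intro le_of_cnt) (auto simp: A_def)
        thus ?thesis using y by (auto simp: A_def)
      qed simp
    next
      fix y assume "y \<in> insert x (A s)"
      thus "y \<in> A x" using Suc.prems s index_le_refl[of x] index_le_trans[of x s y] by (auto simp: A_def)
    qed
    moreover have "x \<notin> A s" using s index_le_antisym[of s x] by (auto simp: A_def)
    ultimately have split: "sum H (A x) = H x + sum H (A s)"
      using finA by simp
    have "sum H (A x) \<le> C * H x" using tail[OF i(1) Suc.prems(1,2)] by (simp add: A_def)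
    hence "sum H (A s) \<le> (1 - 1 / C) * sum H (A x)"
      using C split by (simp add: field_simps)
    moreover have "sum H {i} \<le> (1 - 1 / C) ^ n * sum H (A s)"
      using Suc s cs by (intro Suc.IH) auto
    moreover have "0 \<le> (1 - 1 / C) ^ n" using C by simp
    ultimately have "sum H {i} \<le> (1 - 1 / C) ^ n * ((1 - 1 / C) * sum H (A x))"
      using mult_left_mono order_trans by blast
    thus ?case by (simp add: mult_ac)
  qed
  have le: "index_le i' i" using le_of_cnt i by blast
  have "H i \<le> (1 - 1 / C) ^ (cnt i - cnt i') * sum H (A i')" using T[OF i(2) le refl] by simp
  also have "\<dots> \<le> (1 - 1 / C) ^ (cnt i - cnt i') * (C * H i')"
    using tail[OF i(1,2) le] C by (intro mult_left_mono) (auto simp: A_def)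
  finally show ?thesis by (simp add: mult_ac)
qed

lemma geometric_sum_le: "\<lbrakk>0 \<le> q; q < (1::real)\<rbrakk> \<Longrightarrow> (\<Sum>n<N. q ^ n) \<le> 1 / (1 - q)"
  by (simp add: sum_gp_strict divide_right_mono)

lemma triple_geometric_sum_le:
  fixes q :: real
  assumes q: "0 \<le> q" "q < 1" and F: "finite F"
  shows "(\<Sum>(l, k, j)\<in>F. q ^ (l + k + j)) \<le> (1 / (1 - q)) ^ 3"
proof -
  obtain N where N: "\<And>l k j. (l, k, j) \<in> F \<Longrightarrow> l < N \<and> k < N \<and> j < N"
  proof -
    obtain N1 where "\<forall>x\<in>fst ` F. x < N1" using F finite_nat_set_iff_bounded by blast
    moreover obtain N2 where "\<forall>x\<in>(fst \<circ> snd) ` F. x < N2"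
      using F finite_nat_set_iff_bounded by blast
    moreover obtain N3 where "\<forall>x\<in>(snd \<circ> snd) ` F. x < N3"
      using F finite_nat_set_iff_bounded by blast
    ultimately show ?thesis by (intro that[of "N1 + N2 + N3"]) fastforce
  qed
  have "(\<Sum>(l, k, j)\<in>F. q ^ (l + k + j)) \<le> (\<Sum>(l, k, j)\<in>{..<N} \<times> {..<N} \<times> {..<N}. q ^ (l + k + j))"
    using N q by (intro sum_mono2) auto
  also have "\<dots> = (\<Sum>l<N. \<Sum>k<N. \<Sum>j<N. q ^ l * (q ^ k * q ^ j))"
    by (simp add: sum.cartesian_product power_add mult.assoc)
  also have "\<dots> = (\<Sum>l<N. q ^ l) * (\<Sum>k<N. \<Sum>j<N. q ^ k * q ^ j)"
    by (subst sum_product) (simp only: sum_distrib_left)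
  also have "(\<Sum>k<N. \<Sum>j<N. q ^ k * q ^ j) = (\<Sum>k<N. q ^ k) * (\<Sum>j<N. q ^ j)"
    by (rule sum_product[symmetric])
  also have "(\<Sum>l<N. q ^ l) * ((\<Sum>k<N. q ^ k) * (\<Sum>j<N. q ^ j)) = (\<Sum>l<N. q ^ l) ^ 3"
    by (simp add: power3_eq_cube)
  also have "\<dots> \<le> (1 / (1 - q)) ^ 3"
    using q by (intro power_mono geometric_sum_le sum_nonneg) auto
  finally show ?thesis .
qed

text \<open>In the lexicographic order, an index counts from zero again as soon as a higher index has
  increased. Measured accordingly from \<open>(l', k', j')\<close>, distinct later triples have distinct offsets
  in \<open>\<nat>\<^sup>3\<close>, so a triple geometric series dominates the sum.\<close>
lemma tail_sum_le:
  fixes H :: "nat \<times> nat \<times> nat \<Rightarrow> real"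
  assumes q: "0 \<le> q" "q < 1" and F: "finite F" and h: "0 \<le> h"
    and le: "\<And>x. x \<in> F \<Longrightarrow> index_le (l', k', j') x"
    and bound: "\<And>j. (l', k', j) \<in> F \<Longrightarrow> H (l', k', j) \<le> B * q ^ (j - j') * h"
      "\<And>k j. \<lbrakk>(l', k, j) \<in> F; k' < k\<rbrakk> \<Longrightarrow> H (l', k, j) \<le> B * q ^ (k - k' + j) * h"
      "\<And>l k j. \<lbrakk>(l, k, j) \<in> F; l' < l\<rbrakk> \<Longrightarrow> H (l, k, j) \<le> B * q ^ (l - l' + k + j) * h"
    and B: "0 \<le> B"
  shows "(\<Sum>x\<in>F. H x) \<le> B * (1 / (1 - q)) ^ 3 * h"
proof -
  define f where "f = (\<lambda>(l, k, j). (l - l', if l = l' then k - k' else k, if l = l' \<and> k = k' then j - j' else j))"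
  have inj: "inj_on f F"
  proof (rule inj_onI)
    fix x y assume xy: "x \<in> F" "y \<in> F" "f x = f y"
    obtain l k j m n i where [simp]: "x = (l, k, j)" "y = (m, n, i)" by (metis prod.exhaust)
    show "x = y" using le[OF xy(1)] le[OF xy(2)] xy(3)
      by (auto simp: f_def index_le_simp split: if_splits)
  qed
  have "(\<Sum>x\<in>F. H x) \<le> (\<Sum>x\<in>F. B * h * (case f x of (l, k, j) \<Rightarrow> q ^ (l + k + j)))"
  proof (rule sum_mono)
    fix x assume x: "x \<in> F"
    obtain l k j where [simp]: "x = (l, k, j)" by (metis prod.exhaust)
    consider "l' < l" | "l' = l" "k' < k" | "l' = l" "k' = k"
      using le[OF x] by (auto simp: index_le_simp)
    thus "H x \<le> B * h * (case f x of (l, k, j) \<Rightarrow> q ^ (l + k + j))"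
    proof cases
      case 1 thus ?thesis using bound(3)[of l k j] x by (simp add: f_def mult_ac)
    next
      case 2 thus ?thesis using bound(2)[of k j] x by (simp add: f_def mult_ac)
    next
      case 3 thus ?thesis using bound(1)[of j] x by (simp add: f_def mult_ac)
    qed
  qed
  also have "\<dots> = B * h * (\<Sum>(l, k, j)\<in>f ` F. q ^ (l + k + j))"
    using inj by (simp add: sum.reindex sum_distrib_left o_def)
  also have "\<dots> \<le> B * h * (1 / (1 - q)) ^ 3"
    using B h by (intro mult_left_mono triple_geometric_sum_le q finite_imageI F) auto
  finally show ?thesis by (simp add: mult_ac)
qed

section \<open>Convergence across levels\<close>

lemma quasi_monotone:
  fixes a d :: "nat \<Rightarrow> real"
  assumes q: "0 \<le> q" "q < 1" and D: "0 \<le> D" and a: "0 \<le> a l"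
    and step: "\<And>i. \<lbrakk>l \<le> i; i < n\<rbrakk> \<Longrightarrow> a (Suc i) \<le> q * a i + d i"
    and d: "\<And>i. \<lbrakk>l \<le> i; i < n\<rbrakk> \<Longrightarrow> d i \<le> D * a l"
    and i: "l \<le> i" "i \<le> n"
  shows "a i \<le> (1 + D / (1 - q)) * a l"
  using i
proof (induction i rule: nat_induct_at_least)
  case base
  have "1 * a l \<le> (1 + D / (1 - q)) * a l" using q D a by (intro mult_right_mono) auto
  thus ?case by simp
next
  case (Suc i)
  have "a (Suc i) \<le> q * ((1 + D / (1 - q)) * a l) + D * a l"
    using step[of i] d[of i] Suc q mult_left_mono[of "a i" "(1 + D / (1 - q)) * a l" q] by simp
  also have "\<dots> = (q * (1 + D / (1 - q)) + D) * a l" by (simp add: algebra_simps)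
  also have "q * (1 + D / (1 - q)) + D = q + D / (1 - q)"
    using q by (simp add: field_simps)
  also have "(q + D / (1 - q)) * a l \<le> (1 + D / (1 - q)) * a l"
    using q a by (intro mult_right_mono) auto
  finally show ?case .
qed

text \<open>By convexity of the square, \<open>(q a + d)\<^sup>2 \<le> q a\<^sup>2 + d\<^sup>2 / (1 - q)\<close>. Summation reproduces the left-hand
  side with the factor \<open>q\<close>, which is absorbed.\<close>
lemma square_sum_le:
  fixes a d :: "nat \<Rightarrow> real"
  assumes q: "0 \<le> q" "q < 1" and a: "\<And>i. 0 \<le> a i" and d: "\<And>i. 0 \<le> d i"
    and step: "\<And>i. \<lbrakk>l \<le> i; i \<le> l + N\<rbrakk> \<Longrightarrow> a (Suc i) \<le> q * a i + d i"
  shows "(\<Sum>i=l..l + Suc N. (a i)\<^sup>2) \<le> ((a l)\<^sup>2 + (\<Sum>i=l..l + N. (d i)\<^sup>2) / (1 - q)) / (1 - q)"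
proof -
  have sq: "(a (Suc i))\<^sup>2 \<le> q * (a i)\<^sup>2 + (d i)\<^sup>2 / (1 - q)" if "l \<le> i" "i \<le> l + N" for i
  proof -
    have "(a (Suc i))\<^sup>2 \<le> (q * a i + d i)\<^sup>2" using step[OF that] a by (intro power_mono)
    also have "\<dots> \<le> q * (a i)\<^sup>2 + (d i)\<^sup>2 / (1 - q)"
    proof -
      have "(1 - q) * (q * (a i)\<^sup>2) + (d i)\<^sup>2 - (1 - q) * (q * a i + d i)\<^sup>2 = q * ((1 - q) * a i - d i)\<^sup>2"
        by (simp add: power2_eq_square algebra_simps)
      also have "\<dots> \<ge> 0" using q by simp
      finally have "(q * a i + d i)\<^sup>2 * (1 - q) \<le> (1 - q) * (q * (a i)\<^sup>2) + (d i)\<^sup>2" by (simp add: mult_ac)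
      hence "(q * a i + d i)\<^sup>2 \<le> ((1 - q) * (q * (a i)\<^sup>2) + (d i)\<^sup>2) / (1 - q)"
        using q by (simp add: pos_le_divide_eq)
      also have "\<dots> = q * (a i)\<^sup>2 + (d i)\<^sup>2 / (1 - q)" using q by (simp add: add_divide_distrib)
      finally show ?thesis .
    qed
    finally show ?thesis .
  qed
  let ?S = "\<Sum>i=l..l + Suc N. (a i)\<^sup>2"
  have "?S = (a l)\<^sup>2 + (\<Sum>i=Suc l..Suc (l + N). (a i)\<^sup>2)"
    by (subst sum.atLeast_Suc_atMost) auto
  also have "(\<Sum>i=Suc l..Suc (l + N). (a i)\<^sup>2) = (\<Sum>i=l..l + N. (a (Suc i))\<^sup>2)"
    by (rule sum.shift_bounds_cl_Suc_ivl)
  also have "\<dots> \<le> (\<Sum>i=l..l + N. q * (a i)\<^sup>2 + (d i)\<^sup>2 / (1 - q))"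
    using sq by (intro sum_mono) auto
  also have "\<dots> = q * (\<Sum>i=l..l + N. (a i)\<^sup>2) + (\<Sum>i=l..l + N. (d i)\<^sup>2) / (1 - q)"
    by (simp add: sum.distrib sum_distrib_left sum_divide_distrib)
  also have "q * (\<Sum>i=l..l + N. (a i)\<^sup>2) \<le> q * ?S"
    using q by (intro mult_left_mono sum_mono2) auto
  finally have "(1 - q) * ?S \<le> (a l)\<^sup>2 + (\<Sum>i=l..l + N. (d i)\<^sup>2) / (1 - q)"
    by (simp add: algebra_simps)
  thus ?thesis using q by (simp add: pos_le_divide_eq mult.commute)
qed

text \<open>Quasi-monotonicity makes each of the \<open>N + 2\<close> terms of the sum of \<open>a\<^sub>i\<^sup>2\<close> at least a multiple of the
  last one, while the sum itself is at most of order \<open>N\<^sup>1\<^sup>-\<^sup>\<delta> a\<^sub>l\<^sup>2\<close>. Hence \<open>a\<^sub>l\<^sub>+\<^sub>N\<close> is at most half of \<open>a\<^sub>l\<close>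
  for one fixed \<open>N\<close>. The predicate \<open>P\<close> restricts the recursion to an initial segment of levels,
  since the algorithm may stay on one mesh forever.\<close>
lemma level_convergence:
  fixes a d :: "nat \<Rightarrow> real" and P :: "nat \<Rightarrow> bool"
  assumes q: "0 \<le> q" "q < 1" and a: "\<And>i. 0 \<le> a i" and d: "\<And>i. 0 \<le> d i"
    and P: "\<And>i j. \<lbrakk>P j; i \<le> j\<rbrakk> \<Longrightarrow> P i"
    and step: "\<And>i. P (Suc i) \<Longrightarrow> a (Suc i) \<le> q * a i + d i"
    and D: "0 \<le> D" "\<And>l i. \<lbrakk>l \<le> i; P (Suc i)\<rbrakk> \<Longrightarrow> d i \<le> D * a l"
    and S: "0 \<le> S" "0 < \<delta>" "\<delta> \<le> 1" "\<And>l N. P (Suc (l + N)) \<Longrightarrow>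
      (\<Sum>i=l..l + N. (d i)\<^sup>2) \<le> S * (real N + 1) powr (1 - \<delta>) * (a l)\<^sup>2"
  shows "\<exists>C r. 1 \<le> C \<and> 0 < r \<and> r < 1 \<and> (\<forall>l m. P (l + m) \<longrightarrow> a (l + m) \<le> C * r ^ m * a l)"
proof -
  define M where "M = 1 + D / (1 - q)"
  have M1: "1 \<le> M" using q D by (simp add: M_def)
  have mono: "a i \<le> M * a l" if "l \<le> i" "P i" for l i
    unfolding M_def
    by (rule quasi_monotone[where n = i and d = d])
      (use that q D a P step in \<open>auto intro: P[OF that(2)]\<close>)
  define K where "K = M\<^sup>2 * ((1 + S / (1 - q)) / (1 - q))"
  have K0: "0 \<le> K" using q S by (simp add: K_def)
  have decay: "(a (l + Suc N))\<^sup>2 \<le> K * (real N + 1) powr (- \<delta>) * (a l)\<^sup>2" if p: "P (l + Suc N)" for l N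
  proof -
    let ?X = "(real N + 1) powr (1 - \<delta>)"
    have X1: "1 \<le> ?X" using S by (intro ge_one_powr_ge_zero) auto
    have p': "P (Suc i)" if "i \<le> l + N" for i using P[OF p, of "Suc i"] that by simp
    have "(real N + 1) * (a (l + Suc N))\<^sup>2 \<le> (\<Sum>i=l..l + Suc N. (a (l + Suc N))\<^sup>2)"
      by (simp add: mult_right_mono)
    also have "\<dots> \<le> (\<Sum>i=l..l + Suc N. M\<^sup>2 * (a i)\<^sup>2)"
    proof (rule sum_mono)
      fix i assume "i \<in> {l..l + Suc N}"
      hence "a (l + Suc N) \<le> M * a i" using p by (intro mono) auto
      thus "(a (l + Suc N))\<^sup>2 \<le> M\<^sup>2 * (a i)\<^sup>2"
        using power_mono[OF _ a, of _ _ 2] by (metis power_mult_distrib)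
    qed
    also have "\<dots> = M\<^sup>2 * (\<Sum>i=l..l + Suc N. (a i)\<^sup>2)" by (simp only: sum_distrib_left)
    also have "\<dots> \<le> M\<^sup>2 * (((a l)\<^sup>2 + (\<Sum>i=l..l + N. (d i)\<^sup>2) / (1 - q)) / (1 - q))"
      using p' step by (intro mult_left_mono square_sum_le q a d) auto
    also have "\<dots> \<le> M\<^sup>2 * ((?X * (a l)\<^sup>2 + (S * ?X * (a l)\<^sup>2) / (1 - q)) / (1 - q))"
      using S(4)[of l N] p q X1 mult_right_mono[OF X1, of "(a l)\<^sup>2"]
      by (intro mult_left_mono divide_right_mono add_mono) auto
    also have "\<dots> = K * (?X * (a l)\<^sup>2)"
      using q by (simp add: K_def field_simps)
    also have "?X = (real N + 1) * (real N + 1) powr (- \<delta>)"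
      by (simp add: powr_mult_base)
    finally have "(real N + 1) * (a (l + Suc N))\<^sup>2 \<le> (real N + 1) * (K * (real N + 1) powr (- \<delta>) * (a l)\<^sup>2)"
      by (simp add: mult_ac)
    thus ?thesis by simp
  qed
  have "(\<lambda>N. K * (real N + 1) powr (- \<delta>)) \<longlonglongrightarrow> K * 0"
  proof (intro tendsto_mult tendsto_const tendsto_neg_powr)
    show "LIM N sequentially. real N + 1 :> at_top"
      using filterlim_compose[OF filterlim_real_sequentially filterlim_Suc] by (simp add: add.commute)
  qed (use S(2) in simp)
  hence "eventually (\<lambda>N. K * (real N + 1) powr (- \<delta>) < 1 / 4) sequentially"
    by (intro order_tendstoD) auto
  then obtain N where N: "K * (real N + 1) powr (- \<delta>) < 1 / 4"
    by (auto simp: eventually_sequentially)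
  define n where "n = Suc N"
  have half: "a (l + n) \<le> a l / 2" if "P (l + n)" for l
  proof -
    have "(a (l + n))\<^sup>2 \<le> K * (real N + 1) powr (- \<delta>) * (a l)\<^sup>2"
      using decay[of l N] that unfolding n_def by blast
    also have "\<dots> \<le> 1 / 4 * (a l)\<^sup>2"
      by (intro mult_right_mono less_imp_le[OF N]) simp
    also have "\<dots> = (a l / 2)\<^sup>2" by (simp add: power_divide)
    finally show ?thesis by (rule power2_le_imp_le) (simp add: a)
  qed
  have halves: "a (l + t * n) \<le> (1 / 2) ^ t * a l" if "P (l + t * n)" for l t
    using that
  proof (induction t)
    case (Suc t)
    have "a (l + t * n + n) \<le> a (l + t * n) / 2" using Suc.prems by (intro half) (simp add: add_ac)
    moreover have "P (l + t * n)" using P[OF Suc.prems] by simp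
    ultimately show ?case using Suc.IH by (simp add: add_ac)
  qed simp
  \<comment> \<open>Halving in every \<open>n\<close> levels is decay with rate \<open>r\<close> per level, up to a factor 2 for incomplete blocks.\<close>
  define r where "r = root n (1 / 2)"
  have r: "0 < r" "r < 1" "r ^ n = 1 / 2"
    using real_root_pow_pos2[of n "1 / 2"] by (simp_all add: r_def n_def del: power_Suc)
  have "a (l + m) \<le> (2 * M) * r ^ m * a l" if p: "P (l + m)" for l m
  proof -
    let ?t = "m div n" and ?s = "m mod n"
    have m: "m = ?t * n + ?s" by simp
    have "a (l + m) \<le> M * a (l + ?t * n)" using p by (intro mono) (auto simp: div_times_less_eq_dividend)
    also have "\<dots> \<le> M * ((1 / 2) ^ ?t * a l)"
      using M1 P[OF p, of "l + ?t * n"] by (intro mult_left_mono halves) (auto simp: div_times_less_eq_dividend)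
    also have "\<dots> \<le> M * ((2 * r ^ m) * a l)"
    proof -
      have "1 / 2 \<le> r ^ ?s" unfolding r(3)[symmetric]
        using r by (intro power_decreasing) (auto simp: n_def less_imp_le)
      hence "r ^ (?t * n) * (1 / 2) \<le> r ^ (?t * n) * r ^ ?s" using r by (intro mult_left_mono) auto
      also have "\<dots> = r ^ m" by (simp add: power_add[symmetric])
      also have "r ^ (?t * n) = (1 / 2) ^ ?t"
        unfolding r(3)[symmetric] by (simp add: power_mult[symmetric] mult.commute)
      finally have "(1 / 2) ^ ?t \<le> 2 * r ^ m" by simp
      thus ?thesis
        using M1 a[of l] by (intro mult_left_mono mult_right_mono) auto
    qed
    finally show ?thesis by (simp add: mult_ac)
  qed
  thus ?thesis using r M1 by (intro exI[of _ "2 * M"] exI[of _ r]) auto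
qed

section \<open>Nested loops in an abstract setting\<close>

lemma one_le_decay_constant:
  fixes q A B :: real
  assumes "0 < q" "q < 1" "1 \<le> A" "1 \<le> B"
  shows "1 \<le> B * A / q\<^sup>2"
proof -
  have "q\<^sup>2 \<le> 1" using assms by (simp add: power_le_one)
  moreover have "1 * 1 \<le> B * A" using assms by (intro mult_mono) auto
  ultimately show ?thesis using assms by (simp add: le_divide_eq)
qed

text \<open>The common pattern of the two inner loops: the criterion that is violated by every step except the
  last one provides the decay, and the last step is merely bounded. The division by \<open>q\<^sup>2\<close> pays for
  the shift by one in the decay and for the last step.\<close>
lemma decay_through_last_step:
  fixes f :: "nat \<Rightarrow> real" and N :: enat
  assumes q: "0 < q" "q < 1" and A: "1 \<le> A" and B: "1 \<le> B" and fi: "0 \<le> f i"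
    and run: "\<And>n. \<lbrakk>i < n; enat n < N\<rbrakk> \<Longrightarrow> f n \<le> A * q ^ (n - Suc i) * f i"
    and last: "\<And>n. \<lbrakk>i \<le> n; enat (Suc n) = N\<rbrakk> \<Longrightarrow> f (Suc n) \<le> B * f n"
    and ij: "i \<le> j" "enat j \<le> N"
  shows "f j \<le> B * A / q\<^sup>2 * q ^ (j - i) * f i"
proof -
  have BA: "A \<le> B * A" "B \<le> B * A"
    using mult_right_mono[OF B, of A] mult_left_mono[OF A, of B] A B by simp_all
  have qn: "q ^ m \<le> q ^ n / q\<^sup>2" if "n \<le> m + 2" for m n
  proof -
    have "q ^ m * q\<^sup>2 = q ^ (m + 2)" by (simp only: power_add)
    also have "\<dots> \<le> q ^ n" using that q by (intro power_decreasing) auto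
    finally show ?thesis using q by (simp add: pos_le_divide_eq)
  qed
  have goal: "C * q ^ m * f i \<le> B * A / q\<^sup>2 * q ^ (j - i) * f i" if "0 \<le> C" "C \<le> B * A" "j - i \<le> m + 2" for C m
  proof -
    have "C * q ^ m \<le> (B * A) * (q ^ (j - i) / q\<^sup>2)"
      using that q by (intro mult_mono qn) auto
    hence "C * q ^ m * f i \<le> (B * A) * (q ^ (j - i) / q\<^sup>2) * f i" using fi by (rule mult_right_mono)
    thus ?thesis by simp
  qed
  consider "i = j" | "i < j" "enat j < N" | "i < j" "enat j = N"
    using ij by (metis le_neq_implies_less order.not_eq_order_implies_strict)
  thus ?thesis
  proof cases
    case 1
    thus ?thesis using goal[of 1 0] A BA B by simp
  next
    case 2
    have "f j \<le> A * q ^ (j - Suc i) * f i" by (rule run[OF 2])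
    also have "\<dots> \<le> B * A / q\<^sup>2 * q ^ (j - i) * f i" using A BA by (intro goal) auto
    finally show ?thesis .
  next
    case 3
    then obtain n where n: "j = Suc n" "i \<le> n" by (cases j) auto
    have st: "f j \<le> B * f n" using last[of n] n 3 by simp
    show ?thesis
    proof (cases "i = n")
      case True
      thus ?thesis using st goal[of B 0] n B BA by simp
    next
      case False
      have lt: "enat n < N" using 3 n by (metis enat_ord_simps(2) lessI)
      have "B * f n \<le> B * (A * q ^ (n - Suc i) * f i)"
        using run[OF _ lt] False n B by (intro mult_left_mono) auto
      also have "\<dots> = (B * A) * q ^ (n - Suc i) * f i" by simp
      also have "\<dots> \<le> B * A / q\<^sup>2 * q ^ (j - i) * f i" using A B n by (intro goal) auto
      finally show ?thesis using st by simp
    qed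
  qed
qed

text \<open>Here \<open>x\<close> and \<open>y\<close> stand for the error and the estimator of the final iterate of a level, \<open>x'\<close> and
  \<open>y'\<close> for those of the next level, and \<open>z\<close> for the distance of the next Galerkin solution to the
  last iterate. Elimination of \<open>y'\<close> leaves a bound \<open>A z + B \<gamma> y\<close>. With \<open>g = C \<gamma>\<close> and \<open>k = C \<kappa>\<close>, the
  condition \<open>B < 1\<close> requires \<open>g\<close> to be large enough and \<open>A < 1\<close> requires it to be small enough;
  the value \<open>(1 - a) / (3 + a)\<close> satisfies both for all admissible \<open>k\<close>.\<close>
lemma level_contraction_factor:
  fixes a b C \<kappa> :: real
  assumes a: "0 \<le> a" "a < 1" and b: "0 < b" "b < 1" and C: "0 < C" and \<kappa>: "0 < \<kappa>"
    and small: "C * \<kappa> < (1 - a) * (1 - b) / 4"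
  defines "\<gamma> \<equiv> (1 - a) / (3 + a) / C"
  obtains q where "0 \<le> q" "q < 1"
    "\<And>x' y' y z. \<lbrakk>x' \<le> a * z + \<kappa> * y'; y' \<le> b * y + C * (x' + z); 0 \<le> y; 0 \<le> z\<rbrakk> \<Longrightarrow>
       x' + \<gamma> * y' \<le> q * (z + \<gamma> * y)"
proof -
  define k g where "k = C * \<kappa>" and "g = (1 - a) / (3 + a)"
  have g: "0 < g" "g * (3 + a) = 1 - a" using a by (simp_all add: g_def)
  have \<gamma>: "\<gamma> = g / C" by (simp add: \<gamma>_def g_def)
  have \<gamma>0: "0 < \<gamma>" using g C by (simp add: \<gamma>)
  have k: "0 < k" "k < (1 - a) * (1 - b) / 4" using C \<kappa> small by (simp_all add: k_def)
  have "(1 - a) * (1 - b) \<le> 1 * 1" using a b by (intro mult_mono) auto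
  hence k1: "k < 1" using k by simp
  define A B where "A = a + (k + g) / (1 - k) * (1 + a)" and "B = (k + g) / (1 - k) * b / g"
  have B1: "B < 1"
  proof -
    have "k * (b + g) < g * (1 - b)"
    proof -
      have "k * (b + g) * (3 + a) = k * (b * (3 + a) + g * (3 + a))" by (simp add: algebra_simps)
      also have "g * (3 + a) = 1 - a" by (rule g(2))
      also have "b * (3 + a) + (1 - a) \<le> 4"
      proof -
        have "b * (3 + a) \<le> 1 * (3 + a)" using a b by (intro mult_right_mono) auto
        thus ?thesis by simp
      qed
      hence "k * (b * (3 + a) + (1 - a)) \<le> k * 4" using k by (intro mult_left_mono) auto
      also have "k * 4 < (1 - a) * (1 - b)" using k by simp
      also have "\<dots> = g * (1 - b) * (3 + a)" using g(2) by (simp add: mult_ac)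
      finally show ?thesis using a by simp
    qed
    hence "(k + g) * b < g * (1 - k)" by (simp add: algebra_simps)
    thus ?thesis using k1 g by (simp add: B_def field_simps)
  qed
  have A1: "A < 1"
  proof -
    have "(k + g) * (1 + a) < (1 - a) * (1 - k)"
    proof -
      have e: "(1 + a) * g * 2 < 1 - a"
      proof -
        have "(1 + a) * 2 < 3 + a" using a by simp
        hence "(1 + a) * 2 * g < (3 + a) * g" using g(1) by (rule mult_strict_right_mono)
        thus ?thesis using g(2) by (simp add: mult_ac)
      qed
      have "2 * k \<le> (1 - a) * (1 - b) / 2" using k by simp
      also have "\<dots> \<le> (1 - a) / 2" using a b by (simp add: mult_left_le)
      finally have "k * (1 + a) + k * (1 - a) \<le> (1 - a) / 2" by (simp add: algebra_simps)
      with e show ?thesis by (simp add: algebra_simps)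
    qed
    hence "(k + g) / (1 - k) * (1 + a) < 1 - a" using k1 by (simp add: field_simps)
    thus ?thesis by (simp add: A_def)
  qed
  have A0: "0 \<le> A" using a k k1 g by (simp add: A_def)
  show ?thesis
  proof (rule that[of "max A B"])
    show "0 \<le> max A B" "max A B < 1" using A0 A1 B1 by auto
    fix x' y' y z assume x': "x' \<le> a * z + \<kappa> * y'" and y': "y' \<le> b * y + C * (x' + z)"
      and y: "0 \<le> y" and z: "0 \<le> z"
    have "C * x' \<le> C * (a * z + \<kappa> * y')" using x' C by simp
    hence "y' * (1 - k) \<le> b * y + C * (1 + a) * z"
      using y' by (simp add: k_def algebra_simps)
    hence Y: "y' \<le> (b * y + C * (1 + a) * z) / (1 - k)" using k1 by (simp add: pos_le_divide_eq)
    have "x' + \<gamma> * y' \<le> a * z + (\<kappa> + \<gamma>) * y'" using x' by (simp add: algebra_simps)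
    also have "\<dots> \<le> a * z + (\<kappa> + \<gamma>) * ((b * y + C * (1 + a) * z) / (1 - k))"
      using Y \<kappa> \<gamma>0 by (intro add_left_mono mult_left_mono) auto
    also have "\<kappa> + \<gamma> = (k + g) / C" using C by (simp add: k_def \<gamma> field_simps)
    also have "a * z + (k + g) / C * ((b * y + C * (1 + a) * z) / (1 - k)) = A * z + B * (\<gamma> * y)"
    proof -
      have "B * (\<gamma> * y) = (k + g) / (1 - k) * (b * y / C)"
        using g(1) by (simp add: B_def \<gamma>)
      moreover have e: "(b * y + C * (1 + a) * z) / C = b * y / C + (1 + a) * z"
        using C by (simp add: add_divide_distrib)
      moreover have "(k + g) / C * (n / (1 - k)) = (k + g) / (1 - k) * (n / C)" for n
        by (simp add: mult.commute)
      ultimately have "a * z + (k + g) / C * ((b * y + C * (1 + a) * z) / (1 - k)) =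
          a * z + (k + g) / (1 - k) * (b * y / C + (1 + a) * z)" by metis
      also have "\<dots> = A * z + (k + g) / (1 - k) * (b * y / C)"
        by (simp only: A_def distrib_left distrib_right add_ac mult.assoc)
      finally show ?thesis unfolding \<open>B * (\<gamma> * y) = _\<close> .
    qed
    also have "\<dots> \<le> max A B * z + max A B * (\<gamma> * y)"
      using z y \<gamma>0 by (intro add_mono mult_right_mono) auto
    finally show "x' + \<gamma> * y' \<le> max A B * (z + \<gamma> * y)" by (simp add: distrib_left)
  qed
qed

text \<open>One run of the algorithm, reduced to what its convergence depends on: a pseudometric \<open>d\<close>, the iterates
  \<open>u l k j\<close> with the exact symmetrized iterates \<open>us l k\<close>, the stopping indices \<open>jm\<close> and \<open>km\<close>, and
  the estimators \<open>\<eta> l\<close>. The properties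
  of a level are only required if the run reaches it.\<close>
locale nested_solver_run =
  fixes W :: "'u set" and d :: "'u \<Rightarrow> 'u \<Rightarrow> real"
    and X :: "nat \<Rightarrow> 'u set" and ug :: "nat \<Rightarrow> 'u" and ustar :: 'u
    and \<eta> :: "nat \<Rightarrow> 'u \<Rightarrow> real"
    and u :: "nat \<Rightarrow> nat \<Rightarrow> nat \<Rightarrow> 'u" and us :: "nat \<Rightarrow> nat \<Rightarrow> 'u"
    and jm :: "nat \<Rightarrow> nat \<Rightarrow> nat" and km :: "nat \<Rightarrow> enat"
    and qsym qs qa lsym lalg qt Cs Crel Cmon Corth \<delta> :: real
  assumes d_nonneg: "\<lbrakk>v \<in> W; w \<in> W\<rbrakk> \<Longrightarrow> 0 \<le> d v w"
    and d_commute: "\<lbrakk>v \<in> W; w \<in> W\<rbrakk> \<Longrightarrow> d v w = d w v"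
    and d_self: "v \<in> W \<Longrightarrow> d v v = 0"
    and d_triangle: "\<lbrakk>v \<in> W; w \<in> W; z \<in> W\<rbrakk> \<Longrightarrow> d v z \<le> d v w + d w z"
    and ustar_mem: "ustar \<in> W"
    and \<eta>_nonneg: "0 \<le> \<eta> l v"
    and km_pos: "(\<forall>l'<l. km l' \<noteq> \<infinity>) \<Longrightarrow> 1 \<le> km l"
    and X_sub: "(\<forall>l'<l. km l' \<noteq> \<infinity>) \<Longrightarrow> X l \<subseteq> W"
    and ug_mem: "(\<forall>l'<l. km l' \<noteq> \<infinity>) \<Longrightarrow> ug l \<in> X l"
    and u_mem: "\<lbrakk>\<forall>l'<l. km l' \<noteq> \<infinity>; enat k \<le> km l; j \<le> jm l k\<rbrakk> \<Longrightarrow> u l k j \<in> X l"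
    and us_mem: "\<lbrakk>\<forall>l'<l. km l' \<noteq> \<infinity>; enat k \<le> km l\<rbrakk> \<Longrightarrow> us l k \<in> X l"
    and jm_0: "(\<forall>l'<l. km l' \<noteq> \<infinity>) \<Longrightarrow> jm l 0 = 0"
    and us_0: "(\<forall>l'<l. km l' \<noteq> \<infinity>) \<Longrightarrow> us l 0 = u l 0 0"
    and jm_pos: "\<lbrakk>\<forall>l'<l. km l' \<noteq> \<infinity>; enat (Suc k) \<le> km l\<rbrakk> \<Longrightarrow> 1 \<le> jm l (Suc k)"
    and start: "\<lbrakk>\<forall>l'<l. km l' \<noteq> \<infinity>; enat (Suc k) \<le> km l\<rbrakk> \<Longrightarrow> u l (Suc k) 0 = u l k (jm l k)"
    and zarantonello: "\<lbrakk>\<forall>l'<l. km l' \<noteq> \<infinity>; enat (Suc k) \<le> km l\<rbrakk> \<Longrightarrow>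
       d (ug l) (us l (Suc k)) \<le> qs * d (ug l) (u l k (jm l k))"
    and algebraic: "\<lbrakk>\<forall>l'<l. km l' \<noteq> \<infinity>; enat (Suc k) \<le> km l; j < jm l (Suc k)\<rbrakk> \<Longrightarrow>
       d (us l (Suc k)) (u l (Suc k) (Suc j)) \<le> qa * d (us l (Suc k)) (u l (Suc k) j)"
    and stop_alg: "\<lbrakk>\<forall>l'<l. km l' \<noteq> \<infinity>; enat (Suc k) \<le> km l; j < jm l (Suc k)\<rbrakk> \<Longrightarrow>
       d (u l (Suc k) (Suc j)) (u l (Suc k) j) \<le>
         lalg * (lsym * \<eta> l (u l (Suc k) (Suc j)) + d (u l (Suc k) (Suc j)) (u l k (jm l k)))
       \<longleftrightarrow> Suc j = jm l (Suc k)"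
    and stop_sym: "\<lbrakk>\<forall>l'<l. km l' \<noteq> \<infinity>; enat (Suc k) \<le> km l\<rbrakk> \<Longrightarrow>
       d (u l (Suc k) (jm l (Suc k))) (u l k (jm l k)) \<le> lsym * \<eta> l (u l (Suc k) (jm l (Suc k)))
       \<longleftrightarrow> enat (Suc k) = km l"
    and next_level: "\<forall>l'<Suc l. km l' \<noteq> \<infinity> \<Longrightarrow>
       u (Suc l) 0 0 = u l (the_enat (km l)) (jm l (the_enat (km l)))"
    and \<eta>_stable: "\<lbrakk>\<forall>l'<l. km l' \<noteq> \<infinity>; v \<in> X l; w \<in> X l\<rbrakk> \<Longrightarrow> \<eta> l v \<le> \<eta> l w + Cs * d v w"
    and \<eta>_reduce: "\<forall>l'<Suc l. km l' \<noteq> \<infinity> \<Longrightarrow>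
       \<eta> (Suc l) (u (Suc l) 0 0) \<le> qt * \<eta> l (u (Suc l) 0 0)"
    and reliable: "\<forall>l'<l. km l' \<noteq> \<infinity> \<Longrightarrow> d ustar (ug l) \<le> Crel * \<eta> l (ug l)"
    and \<eta>_monotone: "\<lbrakk>\<forall>l'<m. km l' \<noteq> \<infinity>; l \<le> m\<rbrakk> \<Longrightarrow> \<eta> m (ug m) \<le> Cmon * \<eta> l (ug l)"
    and orthogonality: "\<forall>l'<Suc (l + N). km l' \<noteq> \<infinity> \<Longrightarrow>
       (\<Sum>i=l..l + N. (d (ug (Suc i)) (ug i))\<^sup>2) \<le> Corth * (real N + 1) powr (1 - \<delta>) * (d ustar (ug l))\<^sup>2"
    and qs: "0 \<le> qs" "qs < 1" and qa: "0 < qa" "qa < 1" and qt: "0 < qt" "qt < 1"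
    and lsym: "0 < lsym" and lalg: "0 < lalg"
    and Cs: "0 < Cs" and Crel: "0 < Crel" and Cmon: "0 < Cmon" and Corth: "0 < Corth"
    and \<delta>: "0 < \<delta>" "\<delta> \<le> 1"
    and qsym: "qsym = (qs + 2 * qa / (1 - qa) * lalg) / (1 - 2 * qa / (1 - qa) * lalg)" "0 < qsym" "qsym < 1"
    and small: "lalg * lsym < (1 - qa) * (1 - qs) * (1 - qt) / (8 * qa * Cs)"
begin

abbreviation reach :: "nat \<Rightarrow> bool" where "reach l \<equiv> \<forall>l'<l. km l' \<noteq> \<infinity>"

definition final :: "nat \<Rightarrow> nat \<Rightarrow> 'u" where "final l k = u l k (jm l k)"

definition galerkin_dist :: "nat \<Rightarrow> nat \<Rightarrow> real" where "galerkin_dist l k = d (ug l) (final l k)"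

definition quasi :: "nat \<times> nat \<times> nat \<Rightarrow> real" where
  "quasi = (\<lambda>(l, k, j). d (ug l) (u l k j) + d (us l k) (u l k j) + \<eta> l (u l k j))"

lemma mem_W: "\<lbrakk>reach l; v \<in> X l\<rbrakk> \<Longrightarrow> v \<in> W"
  using X_sub by blast

lemma final_mem: "\<lbrakk>reach l; enat k \<le> km l\<rbrakk> \<Longrightarrow> final l k \<in> X l"
  unfolding final_def by (rule u_mem) auto

lemma enat_Suc_leD: "enat (Suc k) \<le> n \<Longrightarrow> enat k \<le> n"
  by (metis Suc_n_not_le_n enat_ord_simps(1) linear order_trans)

lemma quasi_nonneg:
  assumes "reach l" "enat k \<le> km l" "j \<le> jm l k"
  shows "0 \<le> quasi (l, k, j)"
  using assms mem_W[OF assms(1)] u_mem[OF assms] us_mem[OF assms(1,2)] ug_mem[OF assms(1)]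
  by (auto simp: quasi_def intro!: add_nonneg_nonneg d_nonneg \<eta>_nonneg)

subsection \<open>Inner loop\<close>

lemma algebraic_power:
  assumes r: "reach l" "enat (Suc k) \<le> km l" and j: "i \<le> j" "j \<le> jm l (Suc k)"
  shows "d (us l (Suc k)) (u l (Suc k) j) \<le> qa ^ (j - i) * d (us l (Suc k)) (u l (Suc k) i)"
  using j
proof (induction j rule: nat_induct_at_least)
  case base
  thus ?case by simp
next
  case (Suc j)
  have "d (us l (Suc k)) (u l (Suc k) (Suc j)) \<le> qa * d (us l (Suc k)) (u l (Suc k) j)"
    using Suc.prems by (intro algebraic r) auto
  also have "\<dots> \<le> qa * (qa ^ (j - i) * d (us l (Suc k)) (u l (Suc k) i))"
    using Suc qa by (intro mult_left_mono) auto
  finally show ?case using Suc.hyps by (simp add: Suc_diff_le)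
qed

lemma algebraic_aposteriori:
  assumes r: "reach l" "enat (Suc k) \<le> km l" and j: "j < jm l (Suc k)"
  shows "d (us l (Suc k)) (u l (Suc k) (Suc j)) \<le> qa / (1 - qa) * d (u l (Suc k) (Suc j)) (u l (Suc k) j)"
proof -
  let ?s = "us l (Suc k)" and ?v = "u l (Suc k) (Suc j)" and ?w = "u l (Suc k) j"
  have m: "?s \<in> W" "?v \<in> W" "?w \<in> W"
    using j by (auto intro!: mem_W[OF r(1)] us_mem r u_mem)
  have "d ?s ?v \<le> qa * d ?s ?w" by (rule algebraic[OF r j])
  also have "\<dots> \<le> qa * (d ?s ?v + d ?v ?w)" using d_triangle[of ?s ?v ?w] m qa by (intro mult_left_mono) auto
  finally show ?thesis using qa by (simp add: field_simps)
qed

lemma final_error: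
  assumes r: "reach l" "enat (Suc k) \<le> km l"
  shows "d (us l (Suc k)) (final l (Suc k)) \<le>
    qa / (1 - qa) * lalg * (lsym * \<eta> l (final l (Suc k)) + d (final l (Suc k)) (final l k))"
proof -
  obtain j where j: "jm l (Suc k) = Suc j" using jm_pos[OF r] by (cases "jm l (Suc k)") auto
  have "d (us l (Suc k)) (final l (Suc k)) \<le> qa / (1 - qa) * d (u l (Suc k) (Suc j)) (u l (Suc k) j)"
    using algebraic_aposteriori[OF r, of j] j by (simp add: final_def)
  also have "\<dots> \<le> qa / (1 - qa) * (lalg * (lsym * \<eta> l (final l (Suc k)) + d (final l (Suc k)) (final l k)))"
    using stop_alg[OF r, of j] j qa by (intro mult_left_mono) (auto simp: final_def)
  finally show ?thesis by (simp add: mult.assoc)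
qed

text \<open>The a posteriori bound of the exact Zarantonello step, by its contraction property.\<close>
lemma symmetrized_error_le:
  assumes r: "reach l" "enat (Suc k) \<le> km l"
  shows "d (ug l) (us l (Suc k)) \<le> d (us l (Suc k)) (final l k) / (1 - qs)"
proof -
  have m: "ug l \<in> W" "us l (Suc k) \<in> W" "final l k \<in> W"
    using r enat_Suc_leD by (auto intro!: mem_W[OF r(1)] us_mem ug_mem final_mem)
  have "d (ug l) (us l (Suc k)) \<le> qs * d (ug l) (final l k)" using zarantonello[OF r] by (simp add: final_def)
  also have "\<dots> \<le> qs * (d (ug l) (us l (Suc k)) + d (us l (Suc k)) (final l k))"
    using d_triangle m qs by (intro mult_left_mono) auto
  also have "\<dots> \<le> qs * d (ug l) (us l (Suc k)) + 1 * d (us l (Suc k)) (final l k)"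
    unfolding distrib_left using m d_nonneg qs by (intro add_left_mono mult_right_mono) auto
  finally show ?thesis using qs by (simp add: field_simps)
qed

definition C_running :: real where
  "C_running = (1 + 2 / lalg) / (1 - qs) + 2 + 2 / (lalg * lsym)"

lemma C_running_ge_1: "1 \<le> C_running"
  using lalg lsym qs by (simp add: C_running_def add_increasing)

text \<open>The violated stopping criterion bounds estimator and increment by \<open>d (u\<^sub>j) (u\<^sub>j\<^sub>-\<^sub>1)\<close>, which is at
  most twice the previous algebraic error. The distance to the Galerkin solution then follows from
  the a posteriori bound of the Zarantonello step.\<close>
lemma quasi_not_stopped:
  assumes r: "reach l" "enat (Suc k) \<le> km l" and j: "Suc j < jm l (Suc k)"
  shows "quasi (l, Suc k, Suc j) \<le> C_running * d (us l (Suc k)) (u l (Suc k) j)"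
proof -
  let ?s = "us l (Suc k)" and ?v = "u l (Suc k) (Suc j)" and ?w = "u l (Suc k) j"
  let ?S = "d ?s ?w"
  have m: "?s \<in> W" "?v \<in> W" "?w \<in> W" "final l k \<in> W" "ug l \<in> W"
    using j r enat_Suc_leD by (auto intro!: mem_W[OF r(1)] us_mem u_mem ug_mem final_mem)
  have S0: "0 \<le> ?S" using m d_nonneg by blast
  have s1: "d ?s ?v \<le> ?S"
    using algebraic[OF r, of j] j mult_right_mono[of qa 1 ?S] S0 qa by simp
  have "lalg * (lsym * \<eta> l ?v + d ?v (final l k)) \<le> d ?v ?w"
    using stop_alg[OF r, of j] j by (simp add: final_def)
  also have "\<dots> \<le> 2 * ?S" using d_triangle[of ?v ?s ?w] d_commute[of ?v ?s] s1 m by simp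
  finally have le: "lsym * \<eta> l ?v + d ?v (final l k) \<le> 2 / lalg * ?S"
    using lalg by (simp add: field_simps)
  have "lsym * \<eta> l ?v \<le> 2 / lalg * ?S" using le d_nonneg[of ?v "final l k"] m by simp
  hence \<eta>: "\<eta> l ?v \<le> 2 / (lalg * lsym) * ?S" using lsym lalg by (simp add: field_simps)
  have D: "d ?v (final l k) \<le> 2 / lalg * ?S"
    using le mult_nonneg_nonneg[OF less_imp_le[OF lsym] \<eta>_nonneg[of l ?v]] by linarith
  have "d ?s (final l k) \<le> (1 + 2 / lalg) * ?S"
    using d_triangle[of ?s ?v "final l k"] s1 D m by (simp add: distrib_right)
  hence "d ?s (final l k) / (1 - qs) \<le> (1 + 2 / lalg) * ?S / (1 - qs)"
    using qs by (intro divide_right_mono) auto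
  hence "d (ug l) ?s \<le> (1 + 2 / lalg) / (1 - qs) * ?S"
    using symmetrized_error_le[OF r] by simp
  hence "d (ug l) ?v \<le> (1 + 2 / lalg) / (1 - qs) * ?S + ?S"
    using d_triangle[of "ug l" ?s ?v] m s1 by simp
  thus ?thesis using s1 \<eta> by (simp add: quasi_def C_running_def distrib_right)
qed

lemma quasi_stopped:
  assumes r: "reach l" "enat (Suc k) \<le> km l" and j: "Suc j = jm l (Suc k)"
  shows "quasi (l, Suc k, Suc j) \<le> (3 + 2 * Cs) * quasi (l, Suc k, j)"
proof -
  let ?s = "us l (Suc k)" and ?v = "u l (Suc k) (Suc j)" and ?w = "u l (Suc k) j"
  let ?S = "d ?s ?w"
  have X: "?v \<in> X l" "?w \<in> X l" "?s \<in> X l" "ug l \<in> X l"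
    using j r by (auto intro!: us_mem u_mem ug_mem)
  hence m: "?s \<in> W" "?v \<in> W" "?w \<in> W" "ug l \<in> W" by (auto intro: mem_W[OF r(1)])
  have S0: "0 \<le> ?S" "0 \<le> d (ug l) ?w" using m d_nonneg by blast+
  have s1: "d ?s ?v \<le> ?S"
    using algebraic[OF r, of j] j mult_right_mono[of qa 1 ?S] S0 qa by simp
  have vw: "d ?v ?w \<le> 2 * ?S" using d_triangle[of ?v ?s ?w] d_commute[of ?v ?s] s1 m by simp
  have e: "d (ug l) ?v \<le> d (ug l) ?w + 2 * ?S"
    using d_triangle[of "ug l" ?w ?v] d_commute[of ?w ?v] vw m by simp
  have \<eta>: "\<eta> l ?v \<le> \<eta> l ?w + 2 * Cs * ?S"
    using \<eta>_stable[OF r(1) X(1,2)] mult_left_mono[OF vw less_imp_le[OF Cs]] by simp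
  have "quasi (l, Suc k, Suc j) \<le> d (ug l) ?w + \<eta> l ?w + (3 + 2 * Cs) * ?S"
    using e \<eta> s1 by (simp add: quasi_def algebra_simps)
  also have "\<dots> \<le> (3 + 2 * Cs) * d (ug l) ?w + (3 + 2 * Cs) * \<eta> l ?w + (3 + 2 * Cs) * ?S"
    using mult_right_mono[of 1 "3 + 2 * Cs" "d (ug l) ?w"]
      mult_right_mono[of 1 "3 + 2 * Cs" "\<eta> l ?w"] S0 \<eta>_nonneg[of l ?w] Cs by simp
  finally show ?thesis by (simp add: quasi_def algebra_simps)
qed

definition C_inner :: real where "C_inner = (3 + 2 * Cs) * C_running / qa\<^sup>2"

lemma C_inner_ge_1: "1 \<le> C_inner"
  unfolding C_inner_def using qa Cs C_running_ge_1 by (intro one_le_decay_constant) auto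

lemma quasi_inner_loop:
  assumes r: "reach l" "enat k \<le> km l" and ij: "i \<le> j" "j \<le> jm l k"
  shows "quasi (l, k, j) \<le> C_inner * qa ^ (j - i) * quasi (l, k, i)"
proof (cases k)
  case 0
  hence "i = j" using ij jm_0[OF r(1)] by simp
  thus ?thesis using C_inner_ge_1 quasi_nonneg[OF r ij(2)] mult_right_mono[of 1 C_inner "quasi (l, k, j)"] by simp
next
  case k: (Suc k')
  have r': "enat (Suc k') \<le> km l" using r k by simp
  have Q0: "0 \<le> quasi (l, k, i)" using ij by (intro quasi_nonneg r) auto
  have sQ: "d (us l k) (u l k i) \<le> quasi (l, k, i)"
    using ij d_nonneg[of "ug l" "u l k i"] \<eta>_nonneg[of l "u l k i"]
      mem_W[OF r(1) ug_mem[OF r(1)]] mem_W[OF r(1) u_mem[OF r, of i]] by (simp add: quasi_def)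
  have run: "quasi (l, k, n) \<le> C_running * qa ^ (n - Suc i) * quasi (l, k, i)"
    if n: "i < n" "enat n < enat (jm l k)" for n
  proof -
    obtain n' where n': "n = Suc n'" using n by (cases n) auto
    have "quasi (l, k, n) \<le> C_running * d (us l k) (u l k n')"
      using quasi_not_stopped[OF r(1) r', of n'] n n' k by simp
    also have "\<dots> \<le> C_running * (qa ^ (n' - i) * d (us l k) (u l k i))"
      using algebraic_power[OF r(1) r', of i n'] n n' k C_running_ge_1 by (intro mult_left_mono) auto
    also have "\<dots> \<le> C_running * (qa ^ (n' - i) * quasi (l, k, i))"
      using sQ qa C_running_ge_1 by (intro mult_left_mono) auto
    finally show ?thesis using n' by (simp add: mult.assoc)
  qed
  have last: "quasi (l, k, Suc n) \<le> (3 + 2 * Cs) * quasi (l, k, n)" if "enat (Suc n) = enat (jm l k)" for n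
    unfolding k by (rule quasi_stopped[OF r(1) r']) (use that k in simp)
  show ?thesis
    unfolding C_inner_def using qa Cs C_running_ge_1 Q0 ij
    by (intro decay_through_last_step[where f = "\<lambda>j. quasi (l, k, j)" and N = "enat (jm l k)"] run last) auto
qed

subsection \<open>Middle loop\<close>

lemma quasi_restart:
  assumes r: "reach l" "enat (Suc k) \<le> km l"
  shows "quasi (l, Suc k, 0) \<le> 3 * quasi (l, k, jm l k)"
proof -
  have m: "ug l \<in> W" "us l (Suc k) \<in> W" "final l k \<in> W" "us l k \<in> W"
    using r enat_Suc_leD by (auto intro!: mem_W[OF r(1)] us_mem ug_mem final_mem)
  have "d (us l (Suc k)) (final l k) \<le> d (ug l) (us l (Suc k)) + d (ug l) (final l k)"
    using d_triangle[of "us l (Suc k)" "ug l" "final l k"] d_commute[of "ug l" "us l (Suc k)"] m by simp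
  moreover have "d (ug l) (us l (Suc k)) \<le> qs * d (ug l) (final l k)"
    using zarantonello[OF r] by (simp add: final_def)
  moreover have "qs * d (ug l) (final l k) \<le> 1 * d (ug l) (final l k)"
    using qs d_nonneg[of "ug l" "final l k"] m by (intro mult_right_mono) auto
  moreover have "0 \<le> d (us l k) (final l k)" "0 \<le> \<eta> l (final l k)" using d_nonneg m \<eta>_nonneg by auto
  ultimately show ?thesis using start[OF r] by (simp add: quasi_def final_def)
qed

abbreviation c where "c \<equiv> 2 * qa / (1 - qa) * lalg"

text \<open>The numerator in the definition of \<open>qsym\<close> is positive, so \<open>0 < qsym\<close> forces the denominator
  \<open>1 - c\<close> to be positive as well.\<close>
lemma c_bounds: "0 < c" "c < 1"
proof -
  show c0: "0 < c" using qa lalg by simp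
  hence "0 < qs + c" using qs by simp
  thus "c < 1" using qsym by (metis diff_gt_0_iff_gt zero_less_divide_iff order_less_not_sym)
qed

text \<open>If the symmetrization loop goes on, its increment dominates the estimator. The algebraic error is
  therefore at most \<open>c\<close> times the sum of the old and the new distance to the Galerkin solution, and
  the new distance can be absorbed.\<close>
lemma inexact_contraction:
  assumes r: "reach l" "enat (Suc k) < km l"
  shows "galerkin_dist l (Suc k) \<le> qsym * galerkin_dist l k"
    and "lsym * \<eta> l (final l (Suc k)) \<le> galerkin_dist l (Suc k) + galerkin_dist l k"
proof -
  have r': "enat (Suc k) \<le> km l" using r by simp
  have m: "ug l \<in> W" "us l (Suc k) \<in> W" "final l k \<in> W" "final l (Suc k) \<in> W"
    using r r' enat_Suc_leD by (auto intro!: mem_W[OF r(1)] us_mem ug_mem final_mem)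
  let ?D = "d (final l (Suc k)) (final l k)"
  have y: "lsym * \<eta> l (final l (Suc k)) \<le> ?D"
    using stop_sym[OF r(1) r'] r(2) by (auto simp: final_def)
  have D: "?D \<le> galerkin_dist l (Suc k) + galerkin_dist l k"
    using d_triangle[of "final l (Suc k)" "ug l" "final l k"] d_commute[of "ug l" "final l (Suc k)"] m by (simp add: galerkin_dist_def)
  show "lsym * \<eta> l (final l (Suc k)) \<le> galerkin_dist l (Suc k) + galerkin_dist l k" using y D by simp
  have "d (us l (Suc k)) (final l (Suc k)) \<le> qa / (1 - qa) * lalg * (lsym * \<eta> l (final l (Suc k)) + ?D)"
    by (rule final_error[OF r(1) r'])
  also have "\<dots> \<le> qa / (1 - qa) * lalg * (2 * (galerkin_dist l (Suc k) + galerkin_dist l k))"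
    using y D qa lalg by (intro mult_left_mono) auto
  also have "\<dots> = c * (galerkin_dist l (Suc k) + galerkin_dist l k)" by simp
  finally have s: "d (us l (Suc k)) (final l (Suc k)) \<le> c * (galerkin_dist l (Suc k) + galerkin_dist l k)" .
  have "galerkin_dist l (Suc k) \<le> d (ug l) (us l (Suc k)) + d (us l (Suc k)) (final l (Suc k))"
    using d_triangle m by (simp add: galerkin_dist_def)
  also have "d (ug l) (us l (Suc k)) \<le> qs * galerkin_dist l k"
    using zarantonello[OF r(1) r'] by (simp add: galerkin_dist_def final_def)
  finally have "galerkin_dist l (Suc k) \<le> qs * galerkin_dist l k + c * (galerkin_dist l (Suc k) + galerkin_dist l k)" using s by simp
  hence "(1 - c) * galerkin_dist l (Suc k) \<le> (qs + c) * galerkin_dist l k" by (simp add: algebra_simps)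
  thus "galerkin_dist l (Suc k) \<le> qsym * galerkin_dist l k"
    unfolding qsym(1) using c_bounds by (simp add: pos_le_divide_eq mult.commute)
qed

lemma galerkin_dist_nonneg:
  assumes r: "reach l" and k: "enat k \<le> km l"
  shows "0 \<le> galerkin_dist l k"
  unfolding galerkin_dist_def by (rule d_nonneg[OF mem_W[OF r ug_mem[OF r]] mem_W[OF r final_mem[OF r k]]])

lemma galerkin_dist_power:
  assumes r: "reach l" and k: "m \<le> k" "enat k < km l"
  shows "galerkin_dist l k \<le> qsym ^ (k - m) * galerkin_dist l m"
  using k
proof (induction k rule: nat_induct_at_least)
  case base
  thus ?case by simp
next
  case (Suc k)
  have lt: "enat k < km l" using Suc.prems by (metis enat_ord_simps(2) lessI less_trans)
  have "galerkin_dist l (Suc k) \<le> qsym * galerkin_dist l k" using Suc.prems by (intro inexact_contraction r)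
  also have "\<dots> \<le> qsym * (qsym ^ (k - m) * galerkin_dist l m)"
    using Suc.IH lt qsym by (intro mult_left_mono) auto
  finally show ?case using Suc.hyps by (simp add: Suc_diff_le)
qed

definition C_start :: real where "C_start = 3 + 2 / lsym"

lemma C_start_ge_1: "1 \<le> C_start" using lsym by (simp add: C_start_def add_increasing2)

lemma quasi_le_galerkin_dist:
  assumes r: "reach l" "enat (Suc k) < km l"
  shows "quasi (l, Suc k, jm l (Suc k)) \<le> C_start * galerkin_dist l k"
proof -
  have r': "enat (Suc k) \<le> km l" using r by simp
  have m: "ug l \<in> W" "us l (Suc k) \<in> W" "final l k \<in> W" "final l (Suc k) \<in> W"
    using r r' enat_Suc_leD by (auto intro!: mem_W[OF r(1)] us_mem ug_mem final_mem)
  have E0: "0 \<le> galerkin_dist l k" using r(1) enat_Suc_leD[OF r'] by (rule galerkin_dist_nonneg)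
  have E1: "galerkin_dist l (Suc k) \<le> galerkin_dist l k"
    using inexact_contraction(1)[OF r] mult_right_mono[of qsym 1 "galerkin_dist l k"] E0 qsym by simp
  have "lsym * \<eta> l (final l (Suc k)) \<le> 2 * galerkin_dist l k" using inexact_contraction(2)[OF r] E1 by simp
  hence y: "\<eta> l (final l (Suc k)) \<le> 2 / lsym * galerkin_dist l k" using lsym by (simp add: field_simps)
  have z: "d (ug l) (us l (Suc k)) \<le> galerkin_dist l k"
    using zarantonello[OF r(1) r'] mult_right_mono[of qs 1 "galerkin_dist l k"] E0 qs by (simp add: galerkin_dist_def final_def)
  have "d (us l (Suc k)) (final l (Suc k)) \<le> 2 * galerkin_dist l k"
    using d_triangle[of "us l (Suc k)" "ug l" "final l (Suc k)"] d_commute[of "us l (Suc k)" "ug l"] z E1 m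
    by (simp add: galerkin_dist_def)
  thus ?thesis using y E1 by (simp add: quasi_def galerkin_dist_def final_def C_start_def distrib_right)
qed

definition C_middle :: real where "C_middle = 3 * C_inner * C_start / qsym\<^sup>2"

lemma C_middle_ge_1: "1 \<le> C_middle"
  unfolding C_middle_def using qsym(2,3) C_inner_ge_1 C_start_ge_1 by (intro one_le_decay_constant) auto

lemma quasi_middle_loop:
  assumes r: "reach l" and k: "m \<le> k" "enat k \<le> km l"
  shows "quasi (l, k, jm l k) \<le> C_middle * qsym ^ (k - m) * quasi (l, m, jm l m)"
proof -
  have mk: "enat m \<le> km l" using k by (metis enat_ord_simps(1) order_trans)
  have Q0: "0 \<le> quasi (l, m, jm l m)" by (intro quasi_nonneg r mk) simp
  have EQ: "galerkin_dist l m \<le> quasi (l, m, jm l m)"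
    using d_nonneg[OF mem_W[OF r us_mem[OF r mk]] mem_W[OF r final_mem[OF r mk]]] \<eta>_nonneg[of l "final l m"]
    by (simp add: quasi_def galerkin_dist_def final_def)
  have run: "quasi (l, n, jm l n) \<le> C_start * qsym ^ (n - Suc m) * quasi (l, m, jm l m)"
    if n: "m < n" "enat n < km l" for n
  proof -
    obtain n' where n': "n = Suc n'" using n by (cases n) auto
    have lt: "enat n' < km l" using n n' by (metis enat_ord_simps(2) lessI less_trans)
    have "quasi (l, n, jm l n) \<le> C_start * galerkin_dist l n'"
      unfolding n' by (rule quasi_le_galerkin_dist[OF r]) (use n n' in simp)
    also have "\<dots> \<le> C_start * (qsym ^ (n' - m) * galerkin_dist l m)"
      using n n' lt C_start_ge_1 by (intro mult_left_mono galerkin_dist_power r) auto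
    also have "\<dots> \<le> C_start * (qsym ^ (n' - m) * quasi (l, m, jm l m))"
      using EQ qsym C_start_ge_1 by (intro mult_left_mono) auto
    finally show ?thesis using n' by (simp add: mult.assoc)
  qed
  have last: "quasi (l, Suc n, jm l (Suc n)) \<le> 3 * C_inner * quasi (l, n, jm l n)" if n: "enat (Suc n) = km l" for n
  proof -
    have n': "enat (Suc n) \<le> km l" using n by simp
    have "quasi (l, Suc n, jm l (Suc n)) \<le> C_inner * qa ^ (jm l (Suc n)) * quasi (l, Suc n, 0)"
      using quasi_inner_loop[OF r n', of 0 "jm l (Suc n)"] by simp
    also have "\<dots> \<le> C_inner * 1 * quasi (l, Suc n, 0)"
      using qa C_inner_ge_1 quasi_nonneg[OF r n', of 0]
      by (intro mult_right_mono mult_left_mono power_le_one) auto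
    also have "\<dots> \<le> C_inner * 1 * (3 * quasi (l, n, jm l n))"
      using quasi_restart[OF r n'] C_inner_ge_1 by (intro mult_left_mono) auto
    finally show ?thesis by simp
  qed
  show ?thesis
    unfolding C_middle_def using qsym(2,3) C_inner_ge_1 C_start_ge_1 Q0 k
    by (intro decay_through_last_step[where f = "\<lambda>k. quasi (l, k, jm l k)" and N = "km l"] run last) auto
qed

subsection \<open>Outer loop\<close>

definition k_last :: "nat \<Rightarrow> nat" where "k_last l = the_enat (km l)"

definition last_iterate :: "nat \<Rightarrow> 'u" where "last_iterate l = final l (k_last l)"

definition \<kappa> :: real where "\<kappa> = 2 * qa / (1 - qa) * (lalg * lsym)"

text \<open>The weight for which \<open>level_contraction_factor\<close> provides a contraction.\<close>
definition \<gamma> :: real where "\<gamma> = (1 - qs) / (3 + qs) / Cs"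

definition err :: "nat \<Rightarrow> real" where "err l = d (ug l) (last_iterate l) + \<gamma> * \<eta> l (last_iterate l)"

lemma km_eq:
  assumes "reach (Suc l)"
  shows "km l = enat (k_last l)" "1 \<le> k_last l" "reach l"
proof -
  show e: "km l = enat (k_last l)" using assms by (auto simp: k_last_def)
  show "reach l" using assms by simp
  hence "1 \<le> enat (k_last l)" using km_pos e by metis
  thus "1 \<le> k_last l" by (simp add: one_enat_def)
qed

lemma \<kappa>: "0 < \<kappa>" "Cs * \<kappa> < (1 - qs) * (1 - qt) / 4"
proof -
  show "0 < \<kappa>" using qa lalg lsym by (simp add: \<kappa>_def)
  have "Cs * \<kappa> = (Cs * (2 * qa / (1 - qa))) * (lalg * lsym)" by (simp add: \<kappa>_def)
  also have "\<dots> < (Cs * (2 * qa / (1 - qa))) * ((1 - qa) * (1 - qs) * (1 - qt) / (8 * qa * Cs))"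
    using small Cs qa by (intro mult_strict_left_mono) auto
  also have "\<dots> = (1 - qs) * (1 - qt) / 4" using Cs qa by (simp add: field_simps)
  finally show "Cs * \<kappa> < (1 - qs) * (1 - qt) / 4" .
qed

lemma \<gamma>_pos: "0 < \<gamma>" using qs Cs by (simp add: \<gamma>_def)

lemma last_iterate_mem: "reach (Suc l) \<Longrightarrow> last_iterate l \<in> X l"
  unfolding last_iterate_def by (rule final_mem[OF km_eq(3)]) (simp_all only: km_eq(1) order_refl)

text \<open>When both loops have stopped, the increment is bounded by the estimator, and so is the algebraic
  error.\<close>
lemma final_symmetrized_error:
  assumes r: "reach (Suc l)"
  shows "d (us l (k_last l)) (last_iterate l) \<le> \<kappa> * \<eta> l (last_iterate l)"
proof -
  obtain k where k: "k_last l = Suc k" using km_eq[OF r] by (cases "k_last l") auto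
  have r': "enat (Suc k) \<le> km l" "enat (Suc k) = km l" using km_eq[OF r] k by auto
  note rl = km_eq(3)[OF r]
  have D: "d (final l (Suc k)) (final l k) \<le> lsym * \<eta> l (final l (Suc k))"
    using stop_sym[OF rl r'(1)] r'(2) by (simp add: final_def)
  have "d (us l (Suc k)) (final l (Suc k)) \<le> qa / (1 - qa) * lalg * (lsym * \<eta> l (final l (Suc k)) + d (final l (Suc k)) (final l k))"
    by (rule final_error[OF rl r'(1)])
  also have "\<dots> \<le> qa / (1 - qa) * lalg * (2 * (lsym * \<eta> l (final l (Suc k))))"
    using D qa lalg by (intro mult_left_mono) auto
  finally show ?thesis by (simp add: \<kappa>_def last_iterate_def k mult_ac)
qed

lemma next_start: "reach (Suc l) \<Longrightarrow> u (Suc l) 0 0 = last_iterate l"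
  using next_level[of l] by (simp add: last_iterate_def k_last_def final_def)

lemma err_nonneg:
  assumes r: "reach (Suc l)"
  shows "0 \<le> err l"
proof -
  note rl = km_eq(3)[OF r]
  have "0 \<le> d (ug l) (last_iterate l)" by (rule d_nonneg[OF mem_W[OF rl ug_mem[OF rl]] mem_W[OF rl last_iterate_mem[OF r]]])
  thus ?thesis using \<gamma>_pos \<eta>_nonneg by (simp add: err_def)
qed

lemma next_distance:
  assumes r: "reach (Suc l)"
  shows "d (ug (Suc l)) (last_iterate l) \<le> d (ug l) (last_iterate l) + d (ug (Suc l)) (ug l)"
proof -
  have "ug (Suc l) \<in> W" "ug l \<in> W" "last_iterate l \<in> W"
    by (rule mem_W[OF r ug_mem[OF r]], rule mem_W[OF km_eq(3)[OF r] ug_mem[OF km_eq(3)[OF r]]],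
        rule mem_W[OF km_eq(3)[OF r] last_iterate_mem[OF r]])
  thus ?thesis using d_triangle[of "ug (Suc l)" "ug l" "last_iterate l"] by simp
qed

lemma last_iterate_mem_next:
  assumes "reach (Suc l)"
  shows "last_iterate l \<in> X (Suc l)"
  using u_mem[OF assms, of 0 0] next_start[OF assms] by (simp add: zero_enat_def[symmetric])

text \<open>The iteration on the new level starts from the previous final iterate. All its steps except the
  last one only decrease the distance to the new Galerkin solution, and the last one contributes the
  factor \<open>qs\<close> and an algebraic error bounded by the estimator.\<close>
lemma err_step:
  obtains q where "0 \<le> q" "q < 1" "\<And>l. reach (Suc (Suc l)) \<Longrightarrow> err (Suc l) \<le> q * err l + d (ug (Suc l)) (ug l)"
proof -
  obtain q where q: "0 \<le> q" "q < 1"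
    "\<And>x' y' y z. \<lbrakk>x' \<le> qs * z + \<kappa> * y'; y' \<le> qt * y + Cs * (x' + z); 0 \<le> y; 0 \<le> z\<rbrakk> \<Longrightarrow>
       x' + \<gamma> * y' \<le> q * (z + \<gamma> * y)"
    unfolding \<gamma>_def using level_contraction_factor[OF qs qt Cs \<kappa>] by metis
  have "err (Suc l) \<le> q * err l + d (ug (Suc l)) (ug l)" if r: "reach (Suc (Suc l))" for l
  proof -
    let ?l = "Suc l"
    have r1: "reach ?l" using r by simp
    obtain k where k: "k_last ?l = Suc k" using km_eq[OF r] by (cases "k_last ?l") auto
    have r': "enat (Suc k) \<le> km ?l" "enat (Suc k) = km ?l" using km_eq[OF r] k by auto
    have klt: "enat k < km ?l" unfolding r'(2)[symmetric] by simp
    have X: "last_iterate ?l \<in> X ?l" "last_iterate l \<in> X ?l" "ug ?l \<in> X ?l" "us ?l (Suc k) \<in> X ?l"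
      using last_iterate_mem[OF r] last_iterate_mem_next[OF r1] ug_mem[OF r1] us_mem[OF r1 r'(1)] by auto
    have W: "last_iterate ?l \<in> W" "last_iterate l \<in> W" "ug ?l \<in> W" "us ?l (Suc k) \<in> W" using X mem_W[OF r1] by auto
    have w0: "final ?l 0 = last_iterate l" using jm_0[OF r1] next_start[OF r1] by (simp add: final_def)
    let ?z = "d (ug ?l) (last_iterate l)"
    have z0: "0 \<le> ?z" using W d_nonneg by blast
    have "galerkin_dist ?l k \<le> qsym ^ k * galerkin_dist ?l 0" using galerkin_dist_power[OF r1 _ klt, of 0] by simp
    also have "\<dots> \<le> 1 * galerkin_dist ?l 0"
      using qsym z0 by (intro mult_right_mono power_le_one) (auto simp: galerkin_dist_def w0)
    finally have Ek: "galerkin_dist ?l k \<le> ?z" by (simp add: galerkin_dist_def w0)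
    have "d (ug ?l) (last_iterate ?l) \<le> d (ug ?l) (us ?l (Suc k)) + d (us ?l (Suc k)) (last_iterate ?l)"
      using d_triangle W by blast
    also have "d (ug ?l) (us ?l (Suc k)) \<le> qs * galerkin_dist ?l k"
      using zarantonello[OF r1 r'(1)] by (simp add: galerkin_dist_def final_def)
    also have "qs * galerkin_dist ?l k \<le> qs * ?z" using Ek qs by (intro mult_left_mono)
    also have "d (us ?l (Suc k)) (last_iterate ?l) \<le> \<kappa> * \<eta> ?l (last_iterate ?l)"
      using final_symmetrized_error[OF r] k by simp
    finally have x': "d (ug ?l) (last_iterate ?l) \<le> qs * ?z + \<kappa> * \<eta> ?l (last_iterate ?l)" by simp
    have "\<eta> ?l (last_iterate ?l) \<le> \<eta> ?l (last_iterate l) + Cs * d (last_iterate ?l) (last_iterate l)" by (rule \<eta>_stable[OF r1 X(1,2)])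
    also have "\<eta> ?l (last_iterate l) \<le> qt * \<eta> l (last_iterate l)" using \<eta>_reduce[OF r1] next_start[OF r1] by simp
    also have "Cs * d (last_iterate ?l) (last_iterate l) \<le> Cs * (d (ug ?l) (last_iterate ?l) + ?z)"
      using d_triangle[of "last_iterate ?l" "ug ?l" "last_iterate l"] d_commute[of "last_iterate ?l" "ug ?l"] W Cs
      by (intro mult_left_mono) auto
    finally have y': "\<eta> ?l (last_iterate ?l) \<le> qt * \<eta> l (last_iterate l) + Cs * (d (ug ?l) (last_iterate ?l) + ?z)" by simp
    have dn: "0 \<le> d (ug ?l) (ug l)"
      by (rule d_nonneg[OF W(3) mem_W[OF km_eq(3)[OF r1] ug_mem[OF km_eq(3)[OF r1]]]])
    have "err ?l \<le> q * (?z + \<gamma> * \<eta> l (last_iterate l))"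
      unfolding err_def by (rule q(3)[OF x' y' \<eta>_nonneg z0])
    also have "\<dots> \<le> q * (err l + d (ug ?l) (ug l))"
      using next_distance[OF r1] q by (intro mult_left_mono) (auto simp: err_def)
    also have "\<dots> \<le> q * err l + d (ug ?l) (ug l)"
      using q dn mult_right_mono[of q 1 "d (ug ?l) (ug l)"] by (simp add: distrib_left)
    finally show ?thesis .
  qed
  with q show ?thesis using that by blast
qed

definition C_estimator :: real where "C_estimator = 1 / \<gamma> + Cs"

lemma C_estimator_pos: "0 < C_estimator" using \<gamma>_pos Cs by (simp add: C_estimator_def add_pos_pos)

lemma \<eta>_galerkin_le:
  assumes r: "reach (Suc l)"
  shows "\<eta> l (ug l) \<le> C_estimator * err l"
proof -
  note rl = km_eq(3)[OF r]
  have X: "ug l \<in> X l" "last_iterate l \<in> X l" using ug_mem[OF rl] last_iterate_mem[OF r] by auto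
  let ?x = "d (ug l) (last_iterate l)" and ?y = "\<eta> l (last_iterate l)"
  have p: "0 \<le> ?x" "0 \<le> ?y" using X mem_W[OF rl] d_nonneg \<eta>_nonneg by auto
  have "\<eta> l (ug l) \<le> ?y + Cs * ?x" by (rule \<eta>_stable[OF rl X])
  also have "\<dots> \<le> (?y + Cs * ?x) + (?x / \<gamma> + Cs * \<gamma> * ?y)"
    using p \<gamma>_pos Cs by simp
  also have "\<dots> = C_estimator * err l" using \<gamma>_pos by (simp add: C_estimator_def err_def field_simps)
  finally show ?thesis .
qed

text \<open>Reliability and quasi-monotonicity bound the distance of \<open>ustar\<close> to both Galerkin solutions by the
  estimator on level \<open>l\<close>.\<close>
lemma galerkin_increment_le:
  assumes li: "l \<le> i" and r: "reach (Suc i)"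
  shows "d (ug (Suc i)) (ug i) \<le> 2 * Crel * Cmon * C_estimator * err l"
proof -
  have rl: "reach (Suc l)" "reach l" "reach i" using r li by auto
  have W: "ug (Suc i) \<in> W" "ug i \<in> W"
    by (rule mem_W[OF r ug_mem[OF r]], rule mem_W[OF rl(3) ug_mem[OF rl(3)]])
  have "d ustar (ug m) \<le> Crel * (Cmon * \<eta> l (ug l))" if "reach m" "l \<le> m" for m
    using reliable[OF that(1)] mult_left_mono[OF \<eta>_monotone[OF that] less_imp_le[OF Crel]] by simp
  hence "d ustar (ug (Suc i)) \<le> Crel * (Cmon * \<eta> l (ug l))" "d ustar (ug i) \<le> Crel * (Cmon * \<eta> l (ug l))"
    using r rl li by auto
  hence "d (ug (Suc i)) (ug i) \<le> 2 * (Crel * (Cmon * \<eta> l (ug l)))"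
    using d_triangle[OF W(1) ustar_mem W(2)] d_commute[OF W(1) ustar_mem] by simp
  also have "\<dots> \<le> 2 * (Crel * (Cmon * (C_estimator * err l)))"
    using \<eta>_galerkin_le[OF rl(1)] Crel Cmon by (intro mult_left_mono) auto
  finally show ?thesis by (simp add: mult.assoc)
qed

lemma err_linear_convergence:
  obtains C r where "1 \<le> C" "0 < r" "r < 1"
    "\<And>l m. reach (Suc (l + m)) \<Longrightarrow> err (l + m) \<le> C * r ^ m * err l"
proof -
  obtain q where q: "0 \<le> q" "q < 1"
    "\<And>l. reach (Suc (Suc l)) \<Longrightarrow> err (Suc l) \<le> q * err l + d (ug (Suc l)) (ug l)"
    using err_step by metis
  \<comment> \<open>The level error is meaningful only on levels where the middle loop stops; zero elsewhere keeps it nonnegative.\<close>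
  define a where "a = (\<lambda>l. if reach (Suc l) then err l else 0)"
  define e where "e = (\<lambda>l. if reach (Suc l) then d (ug (Suc l)) (ug l) else 0)"
  define completed where "completed = (\<lambda>l. reach (Suc l))"
  have "\<exists>C r. 1 \<le> C \<and> 0 < r \<and> r < 1 \<and> (\<forall>l m. completed (l + m) \<longrightarrow> a (l + m) \<le> C * r ^ m * a l)"
  proof (rule level_convergence[where d = e and q = q and D = "2 * Crel * Cmon * C_estimator"
        and S = "Corth * (Crel * C_estimator)\<^sup>2" and \<delta> = \<delta>])
    show "0 \<le> a i" for i unfolding a_def using err_nonneg[of i] by (simp only: split: if_splits) simp
    show "0 \<le> e i" for i
    proof (cases "reach (Suc i)")
      case True
      have "0 \<le> d (ug (Suc i)) (ug i)"
        by (rule d_nonneg[OF mem_W[OF True ug_mem[OF True]]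
            mem_W[OF km_eq(3)[OF True] ug_mem[OF km_eq(3)[OF True]]]])
      thus ?thesis by (simp add: e_def)
    next
      case False
      thus ?thesis unfolding e_def by (simp only: if_False order_refl)
    qed
    show "completed i" if "completed j" "i \<le> j" for i j
      using that unfolding completed_def by simp
    show "a (Suc i) \<le> q * a i + e i" if c: "completed (Suc i)" for i
    proof -
      have r: "reach (Suc (Suc i))" "reach (Suc i)" using c by (auto simp: completed_def)
      show ?thesis using q(3)[OF r(1)] unfolding a_def e_def if_P[OF r(1)] if_P[OF r(2)] .
    qed
    show "0 \<le> 2 * Crel * Cmon * C_estimator" using Crel Cmon C_estimator_pos by simp
    show "e i \<le> 2 * Crel * Cmon * C_estimator * a l" if li: "l \<le> i" and c: "completed (Suc i)" for l i
    proof -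
      have r: "reach (Suc i)" "reach (Suc l)" using c li by (auto simp: completed_def)
      show ?thesis using galerkin_increment_le[OF li r(1)] unfolding a_def e_def if_P[OF r(1)] if_P[OF r(2)] .
    qed
    show "0 \<le> Corth * (Crel * C_estimator)\<^sup>2" using Corth by simp
    fix l N assume "completed (Suc (l + N))"
    hence r: "reach (Suc (Suc (l + N)))" by (simp add: completed_def)
    have rl: "reach (Suc l)" "reach l" using r by auto
    have "(\<Sum>i=l..l + N. (e i)\<^sup>2) = (\<Sum>i=l..l + N. (d (ug (Suc i)) (ug i))\<^sup>2)"
    proof (intro sum.cong refl)
      fix i assume "i \<in> {l..l + N}"
      hence ri: "reach (Suc i)" using r by auto
      show "(e i)\<^sup>2 = (d (ug (Suc i)) (ug i))\<^sup>2" unfolding e_def if_P[OF ri] by (rule refl)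
    qed
    also have "\<dots> \<le> Corth * (real N + 1) powr (1 - \<delta>) * (d ustar (ug l))\<^sup>2"
      using r by (intro orthogonality) simp
    also have "\<dots> \<le> Corth * (real N + 1) powr (1 - \<delta>) * (Crel * (C_estimator * err l))\<^sup>2"
    proof (intro mult_left_mono power_mono)
      show "d ustar (ug l) \<le> Crel * (C_estimator * err l)"
        using reliable[OF rl(2)] mult_left_mono[OF \<eta>_galerkin_le[OF rl(1)] less_imp_le[OF Crel]] by simp
      show "0 \<le> d ustar (ug l)" by (rule d_nonneg[OF ustar_mem mem_W[OF rl(2) ug_mem[OF rl(2)]]])
    qed (use Corth in auto)
    finally show "(\<Sum>i=l..l + N. (e i)\<^sup>2) \<le> Corth * (Crel * C_estimator)\<^sup>2 * (real N + 1) powr (1 - \<delta>) * (a l)\<^sup>2"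
      unfolding a_def if_P[OF rl(1)] by (simp add: power_mult_distrib mult_ac)
  qed (rule q \<delta>)+
  then obtain C r where Cr: "1 \<le> C" "0 < r" "r < 1"
    "\<And>l m. completed (l + m) \<Longrightarrow> a (l + m) \<le> C * r ^ m * a l" by blast
  show ?thesis
  proof (rule that[OF Cr(1-3)])
    fix l m assume r: "reach (Suc (l + m))"
    show "err (l + m) \<le> C * r ^ m * err l"
    proof -
      have r': "reach (Suc l)" using r by simp
      have "completed (l + m)" using r by (simp add: completed_def)
      from Cr(4)[OF this] show ?thesis unfolding a_def if_P[OF r] if_P[OF r'] .
    qed
  qed
qed

lemma err_le_quasi:
  assumes r: "reach (Suc l)"
  shows "err l \<le> (1 + \<gamma>) * quasi (l, k_last l, jm l (k_last l))"
proof -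
  note rl = km_eq(3)[OF r]
  have W: "ug l \<in> W" "last_iterate l \<in> W" "us l (k_last l) \<in> W"
    by (rule mem_W[OF rl ug_mem[OF rl]], rule mem_W[OF rl last_iterate_mem[OF r]],
        rule mem_W[OF rl us_mem[OF rl eq_refl[OF km_eq(1)[OF r, symmetric]]]])
  let ?x = "d (ug l) (last_iterate l)" and ?s = "d (us l (k_last l)) (last_iterate l)" and ?y = "\<eta> l (last_iterate l)"
  have p: "0 \<le> ?x" "0 \<le> ?s" "0 \<le> ?y" using W d_nonneg \<eta>_nonneg by auto
  have "err l \<le> (1 + \<gamma>) * ?x + (1 + \<gamma>) * ?s + (1 + \<gamma>) * ?y"
    using p \<gamma>_pos by (simp add: err_def distrib_right)
  thus ?thesis by (simp add: quasi_def last_iterate_def final_def distrib_left)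
qed

lemma quasi_next_level:
  assumes r: "reach (Suc l)"
  shows "quasi (Suc l, 0, 0) \<le> (1 + 1 / \<gamma> + 2 * Crel * Cmon * C_estimator) * err l"
proof -
  note rl = km_eq(3)[OF r]
  have W: "ug l \<in> W" "last_iterate l \<in> W"
    by (rule mem_W[OF rl ug_mem[OF rl]], rule mem_W[OF rl last_iterate_mem[OF r]])
  let ?x = "d (ug l) (last_iterate l)" and ?y = "\<eta> l (last_iterate l)"
  have p: "0 \<le> ?x" "0 \<le> ?y" by (rule d_nonneg[OF W], rule \<eta>_nonneg)
  have "\<eta> (Suc l) (last_iterate l) \<le> ?y"
    using \<eta>_reduce[OF r] mult_right_mono[OF less_imp_le[OF qt(2)] p(2)]
    unfolding next_start[OF r] by linarith
  moreover have "d (us (Suc l) 0) (last_iterate l) = 0"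
    unfolding us_0[OF r] next_start[OF r] by (rule d_self[OF W(2)])
  moreover have "?x + ?y \<le> (1 + 1 / \<gamma>) * err l"
    using p \<gamma>_pos by (simp add: err_def field_simps)
  ultimately show ?thesis
    using next_distance[OF r] galerkin_increment_le[OF order_refl r]
    unfolding quasi_def case_prod_conv next_start[OF r] by (simp only: distrib_right)
qed

lemma quasi_outer_loop:
  obtains C r where "1 \<le> C" "0 < r" "r < 1"
    "\<And>l m. \<lbrakk>reach m; l < m\<rbrakk> \<Longrightarrow> quasi (m, 0, 0) \<le> C * r ^ (m - l) * quasi (l, k_last l, jm l (k_last l))"
proof -
  obtain C r where C: "1 \<le> C" "0 < r" "r < 1"
    "\<And>l m. reach (Suc (l + m)) \<Longrightarrow> err (l + m) \<le> C * r ^ m * err l"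
    using err_linear_convergence by metis
  let ?A = "1 + 1 / \<gamma> + 2 * Crel * Cmon * C_estimator"
  have A: "1 \<le> ?A" using \<gamma>_pos Crel Cmon C_estimator_pos by simp
  have B: "1 \<le> 1 + \<gamma>" using \<gamma>_pos by simp
  have "quasi (m, 0, 0) \<le> (?A * (C / r) * (1 + \<gamma>)) * r ^ (m - l) * quasi (l, k_last l, jm l (k_last l))"
    if rm: "reach m" and lm: "l < m" for l m
  proof -
    obtain n where n: "m = Suc (l + n)" using lm less_iff_Suc_add by blast
    have rl: "reach (Suc l)" using rm lm by auto
    have rn: "reach (Suc (l + n))" using rm unfolding n .
    have A0: "0 \<le> ?A" using A by simp
    have "quasi (m, 0, 0) \<le> ?A * err (l + n)" unfolding n by (rule quasi_next_level[OF rn])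
    also have "\<dots> \<le> ?A * (C * r ^ n * err l)" by (rule mult_left_mono[OF C(4)[OF rn] A0])
    also have "\<dots> \<le> ?A * (C * r ^ n * ((1 + \<gamma>) * quasi (l, k_last l, jm l (k_last l))))"
      using C(1,2) by (intro mult_left_mono[OF _ A0] mult_left_mono[OF err_le_quasi[OF rl]]) simp
    also have "\<dots> = (?A * (C / r) * (1 + \<gamma>)) * (r * r ^ n) * quasi (l, k_last l, jm l (k_last l))"
      using C(2) by simp
    also have "r * r ^ n = r ^ (m - l)" using n by simp
    finally show ?thesis .
  qed
  note bound = this
  have "1 \<le> ?A * (C / r) * (1 + \<gamma>)"
  proof -
    have "1 \<le> C / r" using C(1-3) by simp
    hence "1 * 1 \<le> ?A * (C / r)" using A by (intro mult_mono) auto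
    hence "1 * 1 \<le> (?A * (C / r)) * (1 + \<gamma>)" using B by (intro mult_mono) auto
    thus ?thesis by simp
  qed
  from that[OF this C(2,3) bound] show ?thesis .
qed

subsection \<open>Full linear convergence\<close>

definition Q :: "(nat \<times> nat \<times> nat) set" where
  "Q = {(l, k, j). reach l \<and> enat k \<le> km l \<and> j \<le> jm l k}"

text \<open>All levels before the level of \<open>x\<close> have finite stopping indices, since the run has left them.\<close>
lemma finite_initial_segment:
  assumes "x \<in> Q"
  shows "finite {y \<in> Q. index_le y x}"
proof -
  obtain l k j where x: "x = (l, k, j)" by (metis prod.exhaust)
  have r: "reach l" using assms by (simp add: x Q_def)
  define M where "M = (\<lambda>l'. if l' < l then k_last l' else k)"
  have "{y \<in> Q. index_le y x} \<subseteq> (SIGMA l':{..l}. SIGMA k':{..M l'}. {..jm l' k'})"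
  proof
    fix y assume y: "y \<in> {y \<in> Q. index_le y x}"
    obtain l' k' j' where y': "y = (l', k', j')" by (metis prod.exhaust)
    have "k' \<le> k_last l'" if "l' < l"
      using y y' that r by (auto simp: Q_def k_last_def)
    thus "y \<in> (SIGMA l':{..l}. SIGMA k':{..M l'}. {..jm l' k'})"
      using y by (auto simp: y' x index_le_simp M_def Q_def)
  qed
  thus ?thesis by (rule finite_subset) (intro finite_SigmaI; simp)
qed

text \<open>A later index is compared with an earlier one by descending to the start of its inner loop, then
  to the start of its middle loop, then through the levels, and finally back into the level of the
  earlier index. All decay rates are replaced by their maximum \<open>q\<close>.\<close>
theorem linear_convergence:
  "\<exists>q C. 0 < q \<and> q < 1 \<and> 0 < C \<and> (\<forall>i\<in>Q. \<forall>i'\<in>Q.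
     card {x \<in> Q. index_le x i'} \<le> card {x \<in> Q. index_le x i} \<longrightarrow>
     quasi i \<le> C * q ^ (card {x \<in> Q. index_le x i} - card {x \<in> Q. index_le x i'}) * quasi i')"
proof -
  obtain Cl r where Cl: "1 \<le> Cl" "0 < r" "r < 1"
    "\<And>l m. \<lbrakk>reach m; l < m\<rbrakk> \<Longrightarrow> quasi (m, 0, 0) \<le> Cl * r ^ (m - l) * quasi (l, k_last l, jm l (k_last l))"
    using quasi_outer_loop by metis
  define q where "q = max r (max qsym qa)"
  have q: "0 \<le> q" "q < 1" "r \<le> q" "qsym \<le> q" "qa \<le> q" using Cl qsym qa by (auto simp: q_def)
  have pw: "r ^ n \<le> q ^ n" "qsym ^ n \<le> q ^ n" "qa ^ n \<le> q ^ n" "q ^ n \<le> 1" "0 \<le> q ^ n" for n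
    using q Cl qsym qa by (auto intro!: power_mono power_le_one)
  have Qn: "0 \<le> quasi i" if "i \<in> Q" for i
    using that quasi_nonneg by (cases i) (auto simp: Q_def)
  have q0: "0 < q" using q(3) Cl(2) by simp
  define M where "M = 3 * C_middle / q"
  note C1 = C_inner_ge_1 C_middle_ge_1 Cl(1)
  have M1: "1 \<le> M" using C1(2) q q0 by (simp add: M_def)
  have inner: "quasi (l, k, j) \<le> C_inner * q ^ (j - j') * quasi (l, k, j')"
    if x: "(l, k, j) \<in> Q" "j' \<le> j" for l k j j'
  proof -
    have "quasi (l, k, j) \<le> C_inner * qa ^ (j - j') * quasi (l, k, j')"
      using x by (intro quasi_inner_loop) (auto simp: Q_def)
    also have "\<dots> \<le> C_inner * q ^ (j - j') * quasi (l, k, j')"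
      using x C1 pw(3) Qn[of "(l, k, j')"] by (intro mult_right_mono mult_left_mono) (auto simp: Q_def)
    finally show ?thesis .
  qed
  have inner': "quasi (l, k, j) \<le> C_inner * quasi (l, k, j')"
    if x: "(l, k, j) \<in> Q" "j' \<le> j" for l k j j'
  proof -
    have "C_inner * q ^ (j - j') * quasi (l, k, j') \<le> C_inner * 1 * quasi (l, k, j')"
      using x C1 pw(4) Qn[of "(l, k, j')"] by (intro mult_right_mono mult_left_mono) (auto simp: Q_def)
    thus ?thesis using inner[OF x] by simp
  qed
  have middle: "quasi (l, k, 0) \<le> M * q ^ (k - m) * quasi (l, m, jm l m)"
    if x: "(l, k, 0) \<in> Q" "m < k" for l k m
  proof -
    obtain k' where k': "k = Suc k'" using x by (cases k) auto
    have r: "reach l" "enat (Suc k') \<le> km l" using x k' by (auto simp: Q_def)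
    have m: "(l, m, jm l m) \<in> Q" using x by (auto simp: Q_def intro: order_trans[of "enat m" "enat k"])
    have "quasi (l, k, 0) \<le> 3 * quasi (l, k', jm l k')" unfolding k' by (rule quasi_restart[OF r])
    also have "\<dots> \<le> 3 * (C_middle * qsym ^ (k' - m) * quasi (l, m, jm l m))"
      using x k' enat_Suc_leD[OF r(2)] by (intro mult_left_mono quasi_middle_loop r) auto
    also have "\<dots> \<le> 3 * (C_middle * q ^ (k' - m) * quasi (l, m, jm l m))"
      using C1 pw(2) Qn[OF m] by (intro mult_left_mono mult_right_mono) auto
    also have "\<dots> = M * (q * q ^ (k' - m)) * quasi (l, m, jm l m)" using q0 by (simp add: M_def)
    also have "q * q ^ (k' - m) = q ^ (k - m)" using x k' by (simp add: Suc_diff_le)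
    finally show ?thesis .
  qed
  have outer: "quasi (l, k, 0) \<le> M * q ^ k * (Cl * q ^ (l - l') * (C_middle * quasi (l', k', jm l' k')))"
    if x: "(l, k, 0) \<in> Q" and y: "(l', k', jm l' k') \<in> Q" and l: "l' < l" for l k l' k'
  proof -
    have r: "reach l" "reach (Suc l')" "reach l'" using x l by (auto simp: Q_def)
    have z: "(l, 0, 0) \<in> Q" using r(1) by (simp add: Q_def zero_enat_def[symmetric])
    have K: "enat (k_last l') \<le> km l'" "k' \<le> k_last l'" using km_eq(1)[OF r(2)] y by (auto simp: Q_def)
    have KQ: "(l', k_last l', jm l' (k_last l')) \<in> Q" using K r by (simp add: Q_def)
    have "quasi (l, k, 0) \<le> M * q ^ k * quasi (l, 0, 0)"
    proof (cases "k = 0")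
      case True
      thus ?thesis using M1 Qn[OF z] mult_right_mono[of 1 M "quasi (l, 0, 0)"] by simp
    next
      case False
      thus ?thesis using middle[OF x, of 0] jm_0[OF r(1)] by simp
    qed
    also have "\<dots> \<le> M * q ^ k * (Cl * r ^ (l - l') * quasi (l', k_last l', jm l' (k_last l')))"
      using M1 pw(5) Cl(4)[OF r(1) l] by (intro mult_left_mono) auto
    also have "\<dots> \<le> M * q ^ k * (Cl * q ^ (l - l') * quasi (l', k_last l', jm l' (k_last l')))"
      using M1 pw(1,5) C1 Qn[OF KQ] by (intro mult_left_mono mult_right_mono) auto
    also have "\<dots> \<le> M * q ^ k * (Cl * q ^ (l - l') * (C_middle * quasi (l', k', jm l' k')))"
    proof -
      have "quasi (l', k_last l', jm l' (k_last l')) \<le> C_middle * qsym ^ (k_last l' - k') * quasi (l', k', jm l' k')"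
        by (rule quasi_middle_loop[OF r(3) K(2,1)])
      also have "\<dots> \<le> C_middle * 1 * quasi (l', k', jm l' k')"
        using C1 qsym Qn[OF y] by (intro mult_right_mono mult_left_mono power_le_one) auto
      finally show ?thesis using M1 pw(5) C1 by (intro mult_left_mono) auto
    qed
    finally show ?thesis .
  qed
  define B where "B = (C_inner * M * C_inner) * (Cl * C_middle)"
  have jj: "C_inner \<le> C_inner * M * C_inner" "0 \<le> C_inner * M * C_inner" "1 \<le> Cl * C_middle"
  proof -
    have "C_inner * 1 * 1 \<le> C_inner * M * C_inner" using C1 M1 by (intro mult_mono) auto
    thus "C_inner \<le> C_inner * M * C_inner" by simp
    show "0 \<le> C_inner * M * C_inner" using C1 M1 by simp
    have "1 * 1 \<le> Cl * C_middle" using C1 by (intro mult_mono) auto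
    thus "1 \<le> Cl * C_middle" by simp
  qed
  have BB: "C_inner * M * C_inner \<le> B"
    using mult_left_mono[OF jj(3,2)] by (simp add: B_def)
  \<comment> \<open>The maximum with 2 keeps the rate \<open>1 - 1 / C\<close> positive.\<close>
  define C where "C = max 2 (B * (1 / (1 - q)) ^ 3)"
  have tail: "(\<Sum>x | x \<in> Q \<and> index_le i' x \<and> index_le x i. quasi x) \<le> C * quasi i'"
    if i: "i \<in> Q" "i' \<in> Q" "index_le i' i" for i i'
  proof -
    obtain l' k' j' where i': "i' = (l', k', j')" by (metis prod.exhaust)
    let ?F = "{x. x \<in> Q \<and> index_le i' x \<and> index_le x i}"
    have h: "0 \<le> quasi i'" by (rule Qn[OF i(2)])
    have yQ: "(l', k', jm l' k') \<in> Q" "j' \<le> jm l' k'" using i(2) by (auto simp: i' Q_def)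
    have fj: "quasi (l', k', jm l' k') \<le> C_inner * quasi i'" unfolding i' by (rule inner'[OF yQ])
    have "(\<Sum>x\<in>?F. quasi x) \<le> B * (1 / (1 - q)) ^ 3 * quasi i'"
    proof (rule tail_sum_le[where l' = l' and k' = k' and j' = j'])
      show "finite ?F" by (rule finite_subset[OF _ finite_initial_segment[OF i(1)]]) auto
      show "0 \<le> B" using BB jj by linarith
      show "index_le (l', k', j') x" if "x \<in> ?F" for x using that by (simp add: i')
      show "quasi (l', k', j) \<le> B * q ^ (j - j') * quasi i'" if x: "(l', k', j) \<in> ?F" for j
      proof -
        have "quasi (l', k', j) \<le> C_inner * q ^ (j - j') * quasi i'"
          unfolding i' using x by (intro inner) (auto simp: i' index_le_simp)
        also have "\<dots> \<le> B * q ^ (j - j') * quasi i'"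
          using BB jj pw(5) h by (intro mult_right_mono) auto
        finally show ?thesis .
      qed
      show "quasi (l', k, j) \<le> B * q ^ (k - k' + j) * quasi i'" if x: "(l', k, j) \<in> ?F" "k' < k" for k j
      proof -
        have xQ: "(l', k, j) \<in> Q" "(l', k, 0) \<in> Q" using x by (auto simp: Q_def)
        have "quasi (l', k, j) \<le> C_inner * q ^ j * quasi (l', k, 0)" using inner[OF xQ(1), of 0] by simp
        also have "\<dots> \<le> C_inner * q ^ j * (M * q ^ (k - k') * quasi (l', k', jm l' k'))"
          using C1 pw(5) by (intro mult_left_mono middle xQ x) auto
        also have "\<dots> \<le> C_inner * q ^ j * (M * q ^ (k - k') * (C_inner * quasi i'))"
          using C1 M1 pw(5) fj by (intro mult_left_mono) auto
        also have "\<dots> = (C_inner * M * C_inner) * q ^ (k - k' + j) * quasi i'" by (simp add: power_add)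
        also have "\<dots> \<le> B * q ^ (k - k' + j) * quasi i'"
          using BB pw(5) h by (intro mult_right_mono) auto
        finally show ?thesis .
      qed
      show "quasi (l, k, j) \<le> B * q ^ (l - l' + k + j) * quasi i'" if x: "(l, k, j) \<in> ?F" "l' < l" for l k j
      proof -
        have xQ: "(l, k, j) \<in> Q" "(l, k, 0) \<in> Q" using x by (auto simp: Q_def)
        have "quasi (l, k, j) \<le> C_inner * q ^ j * quasi (l, k, 0)" using inner[OF xQ(1), of 0] by simp
        also have "\<dots> \<le> C_inner * q ^ j * (M * q ^ k * (Cl * q ^ (l - l') * (C_middle * quasi (l', k', jm l' k'))))"
          using C1 pw(5) by (intro mult_left_mono outer xQ yQ x) auto
        also have "\<dots> \<le> C_inner * q ^ j * (M * q ^ k * (Cl * q ^ (l - l') * (C_middle * (C_inner * quasi i'))))"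
          using C1 M1 pw(5) fj by (intro mult_left_mono mult_nonneg_nonneg) auto
        also have "\<dots> = B * q ^ (l - l' + k + j) * quasi i'" by (simp add: B_def power_add)
        finally show ?thesis .
      qed
    qed (use q h in auto)
    also have "\<dots> \<le> C * quasi i'" using h by (intro mult_right_mono) (auto simp: C_def)
    finally show ?thesis .
  qed
  have C: "1 < C" by (simp add: C_def)
  show ?thesis
  proof (rule exI[of _ "1 - 1 / C"], rule exI[of _ C], intro conjI ballI impI)
    fix i i' assume i: "i \<in> Q" "i' \<in> Q"
      "card {x \<in> Q. index_le x i'} \<le> card {x \<in> Q. index_le x i}"
    show "quasi i \<le> C * (1 - 1 / C) ^ (card {x \<in> Q. index_le x i} - card {x \<in> Q. index_le x i'}) * quasi i'"
      by (rule linear_convergence_from_tail_sums[OF finite_initial_segment Qn C tail i])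
  qed (use C in auto)
qed

end

section \<open>The adaptive algorithm\<close>

locale afem_problem = elliptic_problem P
  for P :: "('d::finite) problem" +
  fixes p :: nat and \<T>0 :: "'d mesh"
    and ug :: "'d mesh \<Rightarrow> real^'d \<Rightarrow> real"
    and \<Phi> :: "'d mesh \<Rightarrow> (real^'d \<Rightarrow> real) \<Rightarrow> (real^'d \<Rightarrow> real)"
    and \<Psi> :: "'d mesh \<Rightarrow> (real^'d \<Rightarrow> real) \<Rightarrow> (real^'d \<Rightarrow> real) \<Rightarrow> (real^'d \<Rightarrow> real)"
    and u0 :: "real^'d \<Rightarrow> real" and R :: "'d execution"
    and qalg \<theta> Cmark lsym lalg :: real
  assumes initial: "initial_mesh (dom P) \<T>0"
    and galerkin: "\<And>\<T>. \<T> \<in> refinements \<T>0 \<Longrightarrow> galerkin_solution P (fe_space P p \<T>) (ug \<T>)"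
    and zarantonello_map: "\<And>\<T> u. \<lbrakk>\<T> \<in> refinements \<T>0; u \<in> fe_space P p \<T>\<rbrakk> \<Longrightarrow> \<Phi> \<T> u \<in> fe_space P p \<T>"
    and solver: "\<And>\<T>. \<T> \<in> refinements \<T>0 \<Longrightarrow>
           contractive_solver P qalg (fe_space P p \<T>) (\<Phi> \<T>) (\<Psi> \<T>)"
    and u0: "u0 \<in> fe_space P p \<T>0"
    and execution: "afem_execution P \<T>0 \<theta> Cmark lsym lalg \<Phi> \<Psi> u0 R"
begin

abbreviation X :: "nat \<Rightarrow> (real^'d \<Rightarrow> real) set" where "X l \<equiv> fe_space P p (msh R l)"

lemma reached_less: "\<lbrakk>reached R m; l \<le> m\<rbrakk> \<Longrightarrow> reached R l"
  by (auto simp: reached_def)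

lemma k_loop_reached: "reached R l \<Longrightarrow> k_loop P lsym lalg \<Phi> \<Psi> R l"
  using execution by (auto simp: afem_execution_def)

lemma refine_reached:
  assumes "reached R (Suc l)"
  shows "mark_and_refine P \<theta> Cmark R l"
  using execution assms reached_less[OF assms, of l] by (auto simp: afem_execution_def reached_def)

lemma next_mesh:
  assumes "reached R (Suc l)"
  shows "marked R l \<in> doerfler_sets P \<theta> (msh R l) (iter R (Suc l) 0 0)"
    and "is_refine (msh R l) (marked R l) (msh R (Suc l))"
    and "iter R (Suc l) 0 0 = final_iter R l (the_enat (kmax R l))"
    and "msh R (Suc l) \<in> refinements (msh R l)"
proof -
  show 1: "marked R l \<in> doerfler_sets P \<theta> (msh R l) (iter R (Suc l) 0 0)"
    and 2: "is_refine (msh R l) (marked R l) (msh R (Suc l))"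
    and 3: "iter R (Suc l) 0 0 = final_iter R l (the_enat (kmax R l))"
    using refine_reached[OF assms] by (simp_all add: mark_and_refine_def Let_def)
  have "marked R l \<subseteq> msh R l" using 1 by (simp add: doerfler_sets_def)
  thus "msh R (Suc l) \<in> refinements (msh R l)" using 2 by (auto simp: refinements_def)
qed

lemma mesh_nested:
  assumes "l \<le> m" "reached R m"
  shows "msh R m \<in> refinements (msh R l)"
  using assms
proof (induction m rule: nat_induct_at_least)
  case base
  thus ?case by (simp add: refinements_def)
next
  case (Suc m)
  have "msh R m \<in> refinements (msh R l)" using Suc reached_less[OF Suc.prems] by simp
  thus ?case using next_mesh(4)[OF Suc.prems] unfolding refinements_def mem_Collect_eq by (rule rtranclp_trans)
qed

lemma mesh_admissible:
  assumes "reached R l"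
  shows "msh R l \<in> refinements \<T>0"
  using mesh_nested[of 0 l] assms execution by (simp add: afem_execution_def)

lemma mesh_covering: "reached R l \<Longrightarrow> covering_mesh \<Omega> (msh R l)"
  using bisections_covering[OF refinements_bisections[OF mesh_admissible] covering_mesh_initial[OF initial]]
  by blast

lemma space_nested: "\<lbrakk>l \<le> m; reached R m\<rbrakk> \<Longrightarrow> X l \<subseteq> X m"
  using bisections_covering[OF refinements_bisections[OF mesh_nested] mesh_covering] reached_less by blast

text \<open>Membership in the space of the level has to be known before the contraction properties can be
  used, which hold for discrete functions only.\<close>
lemma iterates_in_level:
  assumes r: "reached R l" and start: "iter R l 0 0 \<in> X l"
  shows "\<lbrakk>enat k \<le> kmax R l; j \<le> jmax R l k\<rbrakk> \<Longrightarrow> iter R l k j \<in> X l"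
    and "enat k \<le> kmax R l \<Longrightarrow> iter_star R l k \<in> X l"
proof -
  note kl = k_loop_reached[OF r]
  note S = solver[OF mesh_admissible[OF r], unfolded contractive_solver_def]
  have star: "iter_star R l (Suc k) = \<Phi> (msh R l) (final_iter R l k)"
    if "enat (Suc k) \<le> kmax R l" for k
    using kl that by (auto simp: k_loop_def j_loop_def)
  have it: "iter R l k j \<in> X l" if "enat k \<le> kmax R l" "j \<le> jmax R l k" for k j
    using that
  proof (induction k arbitrary: j)
    case 0
    thus ?case using kl start by (simp add: k_loop_def)
  next
    case (Suc k)
    have jl: "j_loop P lsym lalg \<Phi> \<Psi> R l (Suc k)" using kl Suc.prems by (simp add: k_loop_def)
    have prev: "final_iter R l k \<in> X l"
      unfolding final_iter_def using Suc.prems by (intro Suc.IH) (auto elim: order_trans[rotated])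
    from Suc.prems(2) show ?case
    proof (induction j)
      case 0
      thus ?case using jl prev by (simp add: j_loop_def)
    next
      case (Suc j)
      have "iter R l (Suc k) (Suc j) = \<Psi> (msh R l) (\<Phi> (msh R l) (final_iter R l k)) (iter R l (Suc k) j)"
        using jl Suc.prems by (simp add: j_loop_def)
      thus ?case using S prev Suc by simp
    qed
  qed
  thus "\<lbrakk>enat k \<le> kmax R l; j \<le> jmax R l k\<rbrakk> \<Longrightarrow> iter R l k j \<in> X l" .
  show "iter_star R l k \<in> X l" if k: "enat k \<le> kmax R l"
  proof (cases k)
    case 0
    thus ?thesis using kl start by (simp add: k_loop_def)
  next
    case (Suc k')
    have "enat k' \<le> kmax R l" using k Suc by (auto elim: order_trans[rotated])
    hence "final_iter R l k' \<in> X l" unfolding final_iter_def by (rule it) simp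
    thus ?thesis using star[of k'] k Suc zarantonello_map[OF mesh_admissible[OF r]] by simp
  qed
qed

lemma start_in_space: "reached R l \<Longrightarrow> iter R l 0 0 \<in> X l"
proof (induction l)
  case 0
  thus ?case using u0 execution by (simp add: afem_execution_def)
next
  case (Suc l)
  have r: "reached R l" using Suc.prems reached_less by simp
  have "enat (the_enat (kmax R l)) \<le> kmax R l" using Suc.prems by (auto simp: reached_def)
  hence "final_iter R l (the_enat (kmax R l)) \<in> X l"
    unfolding final_iter_def by (intro iterates_in_level(1)[OF r Suc.IH[OF r]]) simp_all
  thus ?case using next_mesh(3)[OF Suc.prems] space_nested[of l "Suc l"] Suc.prems by auto
qed

lemmas iterates_in_space = iterates_in_level[OF _ start_in_space]

text \<open>Quasi-orthogonality concerns infinite sequences of spaces, but the run may reach only finitely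
  many levels. The sequence is continued by repeating the space of level \<open>l + N + 1\<close>.\<close>
lemma quasi_orthogonality_levels:
  assumes qo: "quasi_orthogonality P ustar Corth \<delta>'" and r: "reached R (Suc (l + N))"
  shows "(\<Sum>i=l..l + N. (edist P (ug (msh R (Suc i))) (ug (msh R i)))\<^sup>2)
    \<le> Corth * (real N + 1) powr (1 - \<delta>') * (edist P ustar (ug (msh R l)))\<^sup>2"
proof -
  define m where "m = (\<lambda>i. min i (Suc (l + N)))"
  have rm: "reached R (m i)" for i using reached_less[OF r] by (simp add: m_def)
  have "finite_dim_subspace (dom P) (X (m i)) \<and> X (m i) \<subseteq> X (m (Suc i)) \<and>
      galerkin_solution P (X (m i)) (ug (msh R (m i)))" for i
  proof (intro conjI)
    show "finite_dim_subspace \<Omega> (X (m i))" by (rule fe_space_finite_dim[OF mesh_covering[OF rm]])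
    show "X (m i) \<subseteq> X (m (Suc i))" by (rule space_nested[OF _ rm]) (simp add: m_def)
    show "galerkin_solution P (X (m i)) (ug (msh R (m i)))" by (rule galerkin[OF mesh_admissible[OF rm]])
  qed
  hence "(\<Sum>i=l..l + N. (edist P (ug (msh R (m (Suc i)))) (ug (msh R (m i))))\<^sup>2)
    \<le> Corth * (real N + 1) powr (1 - \<delta>') * (edist P ustar (ug (msh R (m l))))\<^sup>2"
    using qo[unfolded quasi_orthogonality_def, rule_format,
        of "\<lambda>i. X (m i)" "\<lambda>i. ug (msh R (m i))" l N] by blast
  moreover have "m i = i" if "i \<le> Suc (l + N)" for i using that by (simp add: m_def)
  ultimately show ?thesis by simp
qed

end

theorem theorem19:
  fixes P :: "('d::finite) problem" and p :: nat and \<T>0 :: "'d mesh"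
    and ustar :: "real^'d \<Rightarrow> real" and ug :: "'d mesh \<Rightarrow> real^'d \<Rightarrow> real"
    and \<Phi> :: "'d mesh \<Rightarrow> (real^'d \<Rightarrow> real) \<Rightarrow> (real^'d \<Rightarrow> real)"
    and \<Psi> :: "'d mesh \<Rightarrow> (real^'d \<Rightarrow> real) \<Rightarrow> (real^'d \<Rightarrow> real) \<Rightarrow> (real^'d \<Rightarrow> real)"
    and u0 :: "real^'d \<Rightarrow> real" and R :: "'d execution"
    and \<alpha> L Cstab \<delta> qalg \<theta> Cmark lsym lalg qred qstar q\<theta> qsym :: real
  assumes "model_problem P"
    and "continuous_elliptic (dom P) (a_form P)" and "continuous_elliptic (dom P) (b_form P)"
    and "0 < \<alpha>" and "\<alpha> \<le> L"
    and "\<And>v. v \<in> H10 (dom P) \<Longrightarrow> \<alpha> * (enorm P v)\<^sup>2 \<le> b_form P v v"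
    and "\<And>v w. v \<in> H10 (dom P) \<Longrightarrow> w \<in> H10 (dom P) \<Longrightarrow>
           \<bar>b_form P v w\<bar> \<le> L * enorm P v * enorm P w"
    and "weak_solution P ustar"
    and "initial_mesh (dom P) \<T>0" and "1 \<le> p"
    and "\<And>\<T>. \<T> \<in> refinements \<T>0 \<Longrightarrow> galerkin_solution P (fe_space P p \<T>) (ug \<T>)"
    and "estimator_well_defined P p \<T>0"
    and "qred = 2 powr (- 1 / (2 * real CARD('d)))"
    and "0 < Cstab" and "stability P p \<T>0 Cstab"
    and "reduction P p \<T>0 qred"
    and "\<exists>Crel>0. reliability P \<T>0 ustar ug Crel"
    and "\<exists>Cmon>0. quasi_monotonicity P \<T>0 ug Cmon"
    and "\<exists>Corth>0. \<exists>\<delta>'. 0 < \<delta>' \<and> \<delta>' \<le> 1 \<and> quasi_orthogonality P ustar Corth \<delta>'"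
    and "0 < \<delta>" and "\<delta> < 2 * \<alpha> / L\<^sup>2"
    and "qstar = sqrt (1 - \<delta> * (2 * \<alpha> - \<delta> * L\<^sup>2))"
    and "\<And>\<T>. \<T> \<in> refinements \<T>0 \<Longrightarrow> zarantonello P \<delta> (fe_space P p \<T>) (\<Phi> \<T>)"
    and "0 < qalg" and "qalg < 1"
    and "\<And>\<T>. \<T> \<in> refinements \<T>0 \<Longrightarrow>
           contractive_solver P qalg (fe_space P p \<T>) (\<Phi> \<T>) (\<Psi> \<T>)"
    and "0 < \<theta>" and "\<theta> \<le> 1" and "1 \<le> Cmark" and "0 < lsym" and "0 < lalg"
    and "u0 \<in> fe_space P p \<T>0"
    and "q\<theta> = sqrt (1 - (1 - qred\<^sup>2) * \<theta>)"
    and "qsym = (qstar + 2 * qalg / (1 - qalg) * lalg) / (1 - 2 * qalg / (1 - qalg) * lalg)"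
    and "0 < qsym" and "qsym < 1"
    and "lalg * lsym < (1 - qalg) * (1 - qstar) * (1 - q\<theta>) / (8 * qalg * Cstab)"
    and "afem_execution P \<T>0 \<theta> Cmark lsym lalg \<Phi> \<Psi> u0 R"
  shows "\<exists>qlin Clin. 0 < qlin \<and> qlin < 1 \<and> 0 < Clin \<and>
           (\<forall>i\<in>index_set R. \<forall>i'\<in>index_set R. step_count R i' \<le> step_count R i \<longrightarrow>
              quasi_error P ug R i
                \<le> Clin * qlin ^ (step_count R i - step_count R i') * quasi_error P ug R i')"
proof -
  interpret elliptic_problem P using assms(1) by unfold_locales
  interpret afem_problem P p \<T>0 ug \<Phi> \<Psi> u0 R qalg \<theta> Cmark lsym lalg
  proof
    show "\<Phi> \<T> u \<in> fe_space P p \<T>" if "\<T> \<in> refinements \<T>0" "u \<in> fe_space P p \<T>" for \<T> u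
      using assms(23)[OF that(1)] that(2) by (simp add: zarantonello_def)
  qed (fact assms)+
  obtain Crel where Crel: "0 < Crel" "reliability P \<T>0 ustar ug Crel" using assms(17) by blast
  obtain Cmon where Cmon: "0 < Cmon" "quasi_monotonicity P \<T>0 ug Cmon" using assms(18) by blast
  obtain Corth \<delta>' where Corth: "0 < Corth" "0 < \<delta>'" "\<delta>' \<le> 1" "quasi_orthogonality P ustar Corth \<delta>'"
    using assms(19) by blast
  have L: "0 < L" using assms(4,5) by simp
  have qs: "0 \<le> qstar" "qstar < 1"
  proof -
    have "\<alpha>\<^sup>2 \<le> L\<^sup>2" using assms(4,5) by (intro power_mono) auto
    hence "\<delta>\<^sup>2 * \<alpha>\<^sup>2 \<le> \<delta>\<^sup>2 * L\<^sup>2" by (intro mult_left_mono) auto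
    hence "(1 - \<delta> * \<alpha>)\<^sup>2 \<le> 1 - \<delta> * (2 * \<alpha> - \<delta> * L\<^sup>2)"
      by (simp add: power2_eq_square algebra_simps)
    thus "0 \<le> qstar" unfolding assms(22) using order_trans[OF zero_le_power2] by (intro real_sqrt_ge_zero) blast
    have "\<delta> * L\<^sup>2 < 2 * \<alpha>" using assms(21) L by (simp add: field_simps)
    hence "0 < \<delta> * (2 * \<alpha> - \<delta> * L\<^sup>2)" using assms(20) by simp
    thus "qstar < 1" unfolding assms(22) by simp
  qed
  have qr: "0 < qred" "qred < 1"
    unfolding assms(13) by (auto intro!: powr_less_one simp: field_simps)
  have qt: "0 < q\<theta>" "q\<theta> < 1"
  proof -
    have q2: "0 < qred\<^sup>2" "qred\<^sup>2 < 1" using qr by (auto simp: power_less_one_iff abs_square_less_1)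
    have "(1 - qred\<^sup>2) * \<theta> \<le> (1 - qred\<^sup>2) * 1" using assms(28) q2 by (intro mult_left_mono) auto
    also have "\<dots> < 1" using q2 by simp
    finally have "0 < 1 - (1 - qred\<^sup>2) * \<theta>" by (simp only: diff_gt_0_iff_gt)
    thus "0 < q\<theta>" unfolding assms(33) by (rule real_sqrt_gt_zero)
    show "q\<theta> < 1" unfolding assms(33) using q2 assms(27) by simp
  qed
  have stab: "eta P \<T> v \<le> eta P \<T> w + Cstab * edist P v w"
    if "\<T> \<in> refinements \<T>0" "v \<in> fe_space P p \<T>" "w \<in> fe_space P p \<T>" for \<T> v w
  proof -
    have "\<T> \<in> refinements \<T>" by (simp add: refinements_def)
    hence "\<bar>eta_on P \<T> (\<T> \<inter> \<T>) v - eta_on P \<T> (\<T> \<inter> \<T>) w\<bar> \<le> Cstab * edist P v w"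
      using assms(15) that unfolding stability_def by blast
    thus ?thesis by simp
  qed
  interpret run: nested_solver_run "H10 \<Omega>" "edist P" "\<lambda>l. fe_space P p (msh R l)"
    "\<lambda>l. ug (msh R l)" ustar "\<lambda>l. eta P (msh R l)" "iter R" "iter_star R" "jmax R" "kmax R"
    qsym qstar qalg lsym lalg q\<theta> Cstab Crel Cmon Corth \<delta>'
  proof (unfold_locales, fold reached_def final_iter_def)
    show "0 \<le> edist P v w" if "v \<in> H10 \<Omega>" "w \<in> H10 \<Omega>" for v w
      using energy.nonneg[OF energy.diff_mem[OF that]] by (simp add: enorm_def)
    show "edist P v w = edist P w v" if "v \<in> H10 \<Omega>" "w \<in> H10 \<Omega>" for v w
      by (rule edist_commute[OF that])
    show "edist P v v = 0" if "v \<in> H10 \<Omega>" for v by (rule edist_self[OF that])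
    show "edist P v z \<le> edist P v w + edist P w z" if "v \<in> H10 \<Omega>" "w \<in> H10 \<Omega>" "z \<in> H10 \<Omega>" for v w z
      by (rule edist_triangle[OF that])
    show "ustar \<in> H10 \<Omega>" using assms(8) by (simp add: galerkin_solution_def)
    show "0 \<le> eta P (msh R l) v" for l v by (rule eta_on_nonneg)
    show "X l \<subseteq> H10 \<Omega>" for l by (rule fe_space_subset_H10)
    show "edist P (ug (msh R l)) (iter_star R l (Suc k)) \<le> qstar * edist P (ug (msh R l)) (final_iter R l k)"
      if r: "reached R l" "enat (Suc k) \<le> kmax R l" for l k
    proof -
      have k: "enat k \<le> kmax R l" using r(2) by (auto elim: order_trans[rotated])
      have "final_iter R l k \<in> X l"
        unfolding final_iter_def by (rule iterates_in_space(1)[OF r(1) r(1) k]) simp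
      hence "edist P (ug (msh R l)) (\<Phi> (msh R l) (final_iter R l k)) \<le>
          qstar * edist P (ug (msh R l)) (final_iter R l k)"
        unfolding assms(22) using L assms(20)
        by (intro zarantonello_contraction[OF fe_space_subset_H10 fe_space_diff
              galerkin[OF mesh_admissible[OF r(1)]] assms(23)[OF mesh_admissible[OF r(1)]] assms(6,7)]) auto
      moreover have "iter_star R l (Suc k) = \<Phi> (msh R l) (final_iter R l k)"
        using k_loop_reached[OF r(1)] r(2) by (auto simp: k_loop_def j_loop_def)
      ultimately show ?thesis by simp
    qed
    show "edist P (iter_star R l (Suc k)) (iter R l (Suc k) (Suc j)) \<le>
        qalg * edist P (iter_star R l (Suc k)) (iter R l (Suc k) j)"
      if r: "reached R l" "enat (Suc k) \<le> kmax R l" "j < jmax R l (Suc k)" for l k j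
    proof -
      have k: "enat k \<le> kmax R l" using r(2) by (auto elim: order_trans[rotated])
      have w: "final_iter R l k \<in> X l"
        unfolding final_iter_def by (rule iterates_in_space(1)[OF r(1) r(1) k]) simp
      have i: "iter R l (Suc k) j \<in> X l"
        using r(3) by (intro iterates_in_space(1)[OF r(1) r(1) r(2)]) simp
      have jl: "j_loop P lsym lalg \<Phi> \<Psi> R l (Suc k)"
        using k_loop_reached[OF r(1)] r(2) by (simp add: k_loop_def)
      have "iter R l (Suc k) (Suc j) = \<Psi> (msh R l) (iter_star R l (Suc k)) (iter R l (Suc k) j)"
        "iter_star R l (Suc k) = \<Phi> (msh R l) (final_iter R l k)"
        using jl r(3) by (auto simp: j_loop_def)
      thus ?thesis using solver[OF mesh_admissible[OF r(1)]] w i by (simp add: contractive_solver_def)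
    qed
    show "edist P (iter R l (Suc k) (Suc j)) (iter R l (Suc k) j) \<le>
        lalg * (lsym * eta P (msh R l) (iter R l (Suc k) (Suc j)) + edist P (iter R l (Suc k) (Suc j)) (final_iter R l k))
        \<longleftrightarrow> Suc j = jmax R l (Suc k)"
      if r: "reached R l" "enat (Suc k) \<le> kmax R l" "j < jmax R l (Suc k)" for l k j
    proof -
      have "j_loop P lsym lalg \<Phi> \<Psi> R l (Suc k)"
        using k_loop_reached[OF r(1)] r(2) by (simp add: k_loop_def)
      hence "stop_alg P lsym lalg R l (Suc k) (Suc j) \<longleftrightarrow> Suc j = jmax R l (Suc k)"
        using r(3) unfolding j_loop_def by auto
      thus ?thesis by (simp add: stop_alg_def)
    qed
    show "edist P (final_iter R l (Suc k)) (final_iter R l k) \<le> lsym * eta P (msh R l) (final_iter R l (Suc k))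
        \<longleftrightarrow> enat (Suc k) = kmax R l"
      if r: "reached R l" "enat (Suc k) \<le> kmax R l" for l k
      using k_loop_reached[OF r(1)] r(2) unfolding k_loop_def stop_sym_def by auto
    show "iter R (Suc l) 0 0 = final_iter R l (the_enat (kmax R l))" if "reached R (Suc l)" for l
      by (rule next_mesh(3)[OF that])
    show "eta P (msh R l) v \<le> eta P (msh R l) w + Cstab * edist P v w"
      if "reached R l" "v \<in> X l" "w \<in> X l" for l v w
      by (rule stab[OF mesh_admissible[OF that(1)] that(2,3)])
    show "eta P (msh R (Suc l)) (iter R (Suc l) 0 0) \<le> q\<theta> * eta P (msh R l) (iter R (Suc l) 0 0)"
      if r: "reached R (Suc l)" for l
    proof -
      have rl: "reached R l" using reached_less[OF r] by simp
      have "enat (the_enat (kmax R l)) \<le> kmax R l" using r by (auto simp: reached_def)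
      hence "iter R (Suc l) 0 0 \<in> X l"
        unfolding next_mesh(3)[OF r] final_iter_def by (intro iterates_in_space(1)[OF rl rl]) simp_all
      moreover have "marked R l \<inter> msh R (Suc l) = {}" using next_mesh(2)[OF r] by (simp add: is_refine_def)
      ultimately show ?thesis
        unfolding assms(33) using qr
        by (intro estimator_reduction[OF mesh_admissible[OF rl] next_mesh(4)[OF r]
              covering_mesh_initial[OF initial] assms(15,16) _ _ next_mesh(1)[OF r]]) auto
    qed
    show "edist P ustar (ug (msh R l)) \<le> Crel * eta P (msh R l) (ug (msh R l))" if "reached R l" for l
      using Crel(2) mesh_admissible[OF that] by (simp add: reliability_def)
    show "eta P (msh R m) (ug (msh R m)) \<le> Cmon * eta P (msh R l) (ug (msh R l))"
      if "reached R m" "l \<le> m" for l m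
      using Cmon(2) mesh_admissible[OF reached_less[OF that]] mesh_nested[OF that(2,1)]
      by (simp add: quasi_monotonicity_def)
    show "(\<Sum>i=l..l + N. (edist P (ug (msh R (Suc i))) (ug (msh R i)))\<^sup>2)
        \<le> Corth * (real N + 1) powr (1 - \<delta>') * (edist P ustar (ug (msh R l)))\<^sup>2"
      if "reached R (Suc (l + N))" for l N
      by (rule quasi_orthogonality_levels[OF Corth(4) that])
    fix l assume r: "reached R l"
    note kl = k_loop_reached[OF r]
    show "1 \<le> kmax R l" "jmax R l 0 = 0" "iter_star R l 0 = iter R l 0 0"
      using kl by (simp_all add: k_loop_def)
    show "ug (msh R l) \<in> X l" using galerkin[OF mesh_admissible[OF r]] by (simp add: galerkin_solution_def)
    show "iter R l k j \<in> X l" if "enat k \<le> kmax R l" "j \<le> jmax R l k" for k j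
      by (rule iterates_in_space(1)[OF r r that])
    show "iter_star R l k \<in> X l" if "enat k \<le> kmax R l" for k
      by (rule iterates_in_space(2)[OF r r that])
    show "1 \<le> jmax R l (Suc k)" "iter R l (Suc k) 0 = final_iter R l k" if "enat (Suc k) \<le> kmax R l" for k
      using kl that by (auto simp: k_loop_def j_loop_def)
  qed (use qs qt Crel(1) Cmon(1) Corth(1-3) assms in simp_all)
  have Q: "run.Q = index_set R"
    unfolding run.Q_def index_set_def reached_def by (rule refl)
  have H: "run.quasi = quasi_error P ug R"
    unfolding run.quasi_def quasi_error_def by (rule refl)
  show ?thesis
    using run.linear_convergence unfolding Q H step_count_def .
qed

end
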